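(* Suppose that each Hamiltonian system $(M_{ij},\omega_{ij},H_{ij})$, $1\le i\le n$, $0\le j\le n_i$, has properties 1) and 2) of the context and $N\ge2$. For any collection of segments $[a^\circ_{ij},b^\circ_{ij}]\subset(a_{ij},b_{ij})$ there exists $\varpi_0>0$ such that the following holds. Suppose that $\varpi\in(0,\varpi_0]$ and the collection of angular frequencies $\Omega_{ij}=\Omega_{ij}(I_{ij}^\circ)$, for some $I_{ij}^\circ\in[a_{ij}^\circ,b_{ij}^\circ]$, satisfy the relative resonance condition 3). Suppose that $\alpha=\varpi_1T\in2\pi\mathbb Z$ and that a smooth function $R_0$ on $M$ projects to the factor $M_0$. Fix the two-dimensional torus $\gamma\subset\Lambda^\circ=\prod_{i}\prod_jS^1\times\{(I_{ij}^\circ,0,0)\}$ corresponding to a $T$-periodic solution of the model system. Suppose that some (and, hence, any) point of $\gamma$ is not a critical point of the function $\langle R_0^\circ\rangle$ obtained by averaging the function $R_0^\circ:=R_0|_{\cap_iH_{i0}^{-1}(H_{i0}(I_{i0}^\circ,0,0))}$ along $T$-periodic solutions of the model system. Then for any real number $D>0$ and any neighbourhood $U_1\subset M_1$ of the projection $p_1(\Lambda^\circ)$ with compact closure $\overline U_1$ there exist a real number $\mu_0>0$ and a neighbourhood $U_0$ of the projection $p(\gamma)$ in $M_0$ such that for any $\varepsilon>0$, $\varpi\varepsilon/\mu_0\le\mu\le\mu_0$ and $|\widetilde T-T|+|\widetilde\alpha|\le D\mu$ the following holds: the neighbourhood $U:=U_0\times U_1$ of the torus $\gamma$ does not contain any $(\widetilde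 T,\widetilde\alpha)$-periodic solution of the $S^1$-symmetric perturbed system $$(M,\omega_0+\varepsilon\omega_1,\widetilde H)\cong(M,M_0,p;\omega_0,\omega_1;\widetilde H,\widetilde H_1+\varpi^2\widetilde\Phi)^\varepsilon,\qquad\widetilde H=\varpi\widetilde H_0+\varepsilon\widetilde H_1+\varpi^2\varepsilon\widetilde\Phi,$$ provided that $\widetilde H_0=H_0+\mu\widetilde R_0$, the function $\widetilde R_0$ projects to the factor $M_0$, the function $\widetilde H_1$ projects to the factor $M_1$, $\|\widetilde R_0-R_0\|_{C^2}\le\mu_0$ and $\|\widetilde\Phi\|_{C^2}\le D$.
   Context: **Setting.** Let $n\ge1$, $n_i\ge0$ be integers, $N=\sum_{i=1}^n(1+n_i)$. For $1\le i\le n$, $0\le j\le n_i$ let $M_{ij}=S^1\times(a_{ij},b_{ij})\times\mathbb R^2$ with coordinates $\varphi_{ij}\bmod2\pi,I_{ij},q_{ij},p_{ij}$, symplectic form $\omega_{ij}=dI_{ij}\wedge d\varphi_{ij}+dp_{ij}\wedge dq_{ij}$, and let $H_{ij}=H_{ij}(I_{ij},q_{ij},p_{ij})$ be a smooth function. Put $M_0=\prod_iM_{i0}$, $M_1=\prod_i\prod_{j\ge1}M_{ij}$, $M=M_0\times M_1$, with projections $p:M\to M_0$, $p_1:M\to M_1$; $\omega_0=\sum_i\omega_{i0}$, $\omega_1=\sum_i\sum_{j\ge1}\omega_{ij}$, $H_0=\sum_iH_{i0}$, $H_1=\sum_i\sum_{j\ge1}H_{ij}$, $I_0=\sum_iI_{i0}$,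 $I_1=\sum_i\sum_{j\ge1}I_{ij}$ (functions and forms on factors are lifted to $M$; a function "projects" to a factor if it is lifted from it). Each cylinder $\{q_{ij}=p_{ij}=0\}\subset M_{ij}$ consists of relative equilibria ($dH_{ij}$ is proportional to $dI_{ij}$ there). **$\lambda$-Hamiltonian systems.** For $\lambda\in\mathbb R$ and functions $\mathcal H,\mathcal H_1$ on $M$ with $\mathcal H-\lambda\mathcal H_1$ lifted from $M_0$, the $\lambda$-Hamiltonian system $(M,M_0,p;\omega_0,\omega_1;\mathcal H,\mathcal H_1)^\lambda$ is given by the vector field $v=v_{\mathcal H,\mathcal H_1}$ with $(\omega_0(\cdot,v)-d\mathcal H)|_{\ker\omega_1}=0$, $(\omega_1(\cdot,v)-d\mathcal H_1)|_{\ker dp}=0$; its flow is $g^t_{\mathcal H,\mathcal H_1}$. For $\lambda\ne0$ it equals ($\cong$) the Hamiltonian system $(M,\omega_0+\lambda\omega_1,\mathcal H)$. The circle $S^1=\mathbb R/2\pi\mathbb Z$ acts by simultaneously shifting all $\varphi_{ij}$, i.e. by the flow of $v_{I,I_1}$, $I=I_0+\lambda I_1$. The system is $S^1$-symmetric if $\mathcal H,\mathcal H_1$ are $S^1$-invariant. A solution $\gamma(t)$ defined for all $t$ is $(T,\alpha)$-periodic ($T\ne0$) if $\gamma(t)=g^T_{\mathcal H,\mathcal H_1}g^{-\alpha}_{I,I_1}(\gamma(t))$. Solutions differing by shifts along $v_{\mathcal H,\mathcal H_1}$ and $v_{I,I_1}$ are regarded as one solution, and the union of their trajectories is its phase orbit.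 **Model system.** $(M,M_0,p;\omega_0,\omega_1;\varpi H_0,H_1)^0\cong(M,\omega_0+\omega_1,\varpi H_0+H_1)$. **Conditions.** Let $\overline\ell=\max\{0,\ell\}$. 1) All solutions of $(M_{ij},\omega_{ij},H_{ij})$ are periodic with periods $T_{ij}\circ H_{ij}$ for some functions $T_{ij}=T_{ij}(h)\ne0$. 2) At the points $(I_{ij},0,0)$, $I_{ij}\in(a_{ij},b_{ij})$, with $\Omega_{ij}(I_{ij}):=2\pi/T_{ij}(H_{ij}(I_{ij},0,0))$: $\frac{\partial H_{ij}}{\partial I_{ij}}=\Omega_{ij}(I_{ij})$, $\frac{\partial^2H_{ij}}{\partial I_{ij}^2}\ne0=\frac{\partial H_{ij}}{\partial q_{ij}}=\frac{\partial H_{ij}}{\partial p_{ij}}$, $\det\frac{\partial^2H_{ij}}{\partial(q_{ij},p_{ij})^2}=\Omega_{ij}^2(I_{ij})$. 3) $\varpi^{\overline{1-j}}\Omega_{ij}=\varpi_1+k_{ij}\frac{2\pi}T$ for $1\le i\le n$, $0\le j\le n_i$, where the integers $k_{ij}$ are not simultaneously $0$, $\varpi_1:=\varpi\Omega_{10}$, $T>0$. *)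

theory Defs
  imports "HOL-Analysis.Analysis"
begin

section \<open>Smooth functions and the $C^2$ norm\<close>

definition pd :: "'a::euclidean_space \<Rightarrow> ('a \<Rightarrow> real) \<Rightarrow> 'a \<Rightarrow> real" where
  "pd u f x = frechet_derivative f (at x) u"

text \<open>Meaningful for open \<open>S\<close> only.\<close>

primrec Ck_on :: "nat \<Rightarrow> 'a::euclidean_space set \<Rightarrow> ('a \<Rightarrow> real) \<Rightarrow> bool" where
  "Ck_on 0 S f \<longleftrightarrow> continuous_on S f"
| "Ck_on (Suc r) S f \<longleftrightarrow>
     (\<forall>x\<in>S. f differentiable (at x)) \<and> (\<forall>u\<in>Basis. Ck_on r S (pd u f))"

definition smooth_on :: "'a::euclidean_space set \<Rightarrow> ('a \<Rightarrow> real) \<Rightarrow> bool" where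
  "smooth_on S f \<longleftrightarrow> (\<forall>r. Ck_on r S f)"

definition C2_norm :: "'a::euclidean_space set \<Rightarrow> ('a \<Rightarrow> real) \<Rightarrow> ennreal" where
  "C2_norm S f = Sup ({ennreal \<bar>f x\<bar> | x. x \<in> S}
     \<union> {ennreal \<bar>pd u f x\<bar> | x u. x \<in> S \<and> u \<in> Basis}
     \<union> {ennreal \<bar>pd u (pd w f) x\<bar> | x u w. x \<in> S \<and> u \<in> Basis \<and> w \<in> Basis})"

section \<open>Phase spaces\<close>

text \<open>
  A point of one factor $S^1\times(a,b)\times{\bf R}^2$ is a quadruple \<open>(z, I, q, p)\<close> whose first
  entry lies on the unit circle of the complex plane. The coordinates \<open>(\<phi>, I, q, p)\<close> are those of
  the universal cover, \<open>z = cis \<phi>\<close>; differentiability, differentials and tangent vectors always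
  refer to them, whereas open sets and compactness refer to the points. The finite type \<open>'k\<close>
  labels the factors, and \<open>J k\<close> is the interval of the variable \<open>I\<close> in the factor \<open>k\<close>.
\<close>

type_synonym point1 = "complex \<times> real \<times> real \<times> real"
type_synonym coord1 = "real \<times> real \<times> real \<times> real"
type_synonym 'k point = "point1 ^ 'k"
type_synonym 'k coord = "coord1 ^ 'k"

definition cover1 :: "coord1 \<Rightarrow> point1" where
  "cover1 = (\<lambda>(\<phi>, I, q, p). (cis \<phi>, I, q, p))"

definition cover :: "'k::finite coord \<Rightarrow> 'k point" where
  "cover c = (\<chi> k. cover1 (c $ k))"

definition phase_space1 :: "real set \<Rightarrow> point1 set" where
  "phase_space1 J = sphere 0 1 \<times> J \<times> UNIV \<times> UNIV"

definition phase_space :: "('k::finite \<Rightarrow> real set) \<Rightarrow> 'k point set" where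
  "phase_space J = {x. \<forall>k. x $ k \<in> phase_space1 (J k)}"

text \<open>
  The subproduct over the factors in \<open>A\<close> is realised inside the same vector type, the remaining
  components being \<open>0\<close>.
\<close>

definition proj :: "'k::finite set \<Rightarrow> ('a::zero) ^ 'k \<Rightarrow> 'a ^ 'k" where
  "proj A x = (\<chi> k. if k \<in> A then x $ k else 0)"

definition subproduct :: "('k::finite \<Rightarrow> real set) \<Rightarrow> 'k set \<Rightarrow> 'k point set" where
  "subproduct J A = proj A ` phase_space J"

definition product_set ::
    "('k::finite \<Rightarrow> real set) \<Rightarrow> 'k set \<Rightarrow> 'k point set \<Rightarrow> 'k point set \<Rightarrow> 'k point set" where
  "product_set J P U\<^sub>0 U\<^sub>1 = {x \<in> phase_space J. proj P x \<in> U\<^sub>0 \<and> proj (- P) x \<in> U\<^sub>1}"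

definition projects_to :: "('k::finite \<Rightarrow> real set) \<Rightarrow> 'k set \<Rightarrow> ('k point \<Rightarrow> real) \<Rightarrow> bool" where
  "projects_to J A f \<longleftrightarrow> (\<exists>g. \<forall>x\<in>phase_space J. f x = g (proj A x))"

definition Ck_fun :: "nat \<Rightarrow> ('k::finite \<Rightarrow> real set) \<Rightarrow> ('k point \<Rightarrow> real) \<Rightarrow> bool" where
  "Ck_fun r J f \<longleftrightarrow> Ck_on r (cover -` phase_space J) (f \<circ> cover)"

definition smooth_fun :: "('k::finite \<Rightarrow> real set) \<Rightarrow> ('k point \<Rightarrow> real) \<Rightarrow> bool" where
  "smooth_fun J f \<longleftrightarrow> smooth_on (cover -` phase_space J) (f \<circ> cover)"

definition C2_norm_fun :: "'k::finite point set \<Rightarrow> ('k point \<Rightarrow> real) \<Rightarrow> ennreal" where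
  "C2_norm_fun U f = C2_norm (cover -` U) (f \<circ> cover)"

definition open_nbhd :: "'a::topological_space set \<Rightarrow> 'a set \<Rightarrow> 'a set \<Rightarrow> bool" where
  "open_nbhd X K U \<longleftrightarrow> openin (top_of_set X) U \<and> K \<subseteq> U"

definition rot :: "real \<Rightarrow> 'k::finite point \<Rightarrow> 'k point" where
  "rot \<beta> x = (\<chi> k. case x $ k of (z, I, q, p) \<Rightarrow> (cis \<beta> * z, I, q, p))"

definition invariant :: "('k::finite \<Rightarrow> real set) \<Rightarrow> ('k point \<Rightarrow> real) \<Rightarrow> bool" where
  "invariant J f \<longleftrightarrow> (\<forall>\<beta>. \<forall>x\<in>phase_space J. f (rot \<beta> x) = f x)"

section \<open>Hamiltonian and \<open>\<lambda>\<close>-Hamiltonian systems\<close>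

text \<open>$dI\wedge d\varphi+dp\wedge dq$, and its sum over the factors in \<open>A\<close>.\<close>

definition om1 :: "coord1 \<Rightarrow> coord1 \<Rightarrow> real" where
  "om1 = (\<lambda>(\<phi>, I, q, p) (\<phi>', I', q', p'). (I * \<phi>' - \<phi> * I') + (p * q' - q * p'))"

definition om :: "'k::finite set \<Rightarrow> 'k coord \<Rightarrow> 'k coord \<Rightarrow> real" where
  "om A u v = (\<Sum>k\<in>A. om1 (u $ k) (v $ k))"

text \<open>The function \<open>h(I, q, p)\<close> as a function on one factor.\<close>

definition fun1 :: "(real \<times> real \<times> real \<Rightarrow> real) \<Rightarrow> point1 \<Rightarrow> real" where
  "fun1 h = (\<lambda>(z, I, q, p). h (I, q, p))"

definition ham1_solution ::
    "real set \<Rightarrow> (real \<times> real \<times> real \<Rightarrow> real) \<Rightarrow> (real \<Rightarrow> point1) \<Rightarrow> bool" where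
  "ham1_solution J h \<gamma> \<longleftrightarrow> (\<exists>c. \<forall>t. \<gamma> t = cover1 (c t) \<and> \<gamma> t \<in> phase_space1 J \<and>
     (\<exists>v. (\<forall>u. om1 u v = pd u (fun1 h \<circ> cover1) (c t)) \<and> (c has_vector_derivative v) (at t)))"

text \<open>
  The value \<open>v\<close> at \<open>c\<close> of the \<open>\<lambda>\<close>-Hamiltonian vector field with $M_0$ = the factors in \<open>P\<close>,
  $M_1$ = the others, and functions \<open>F\<close>, \<open>F\<^sub>1\<close>. The parameter \<open>\<lambda>\<close> does not enter the equations;
  it only constrains the pair \<open>F\<close>, \<open>F\<^sub>1\<close>.
\<close>

definition lham_vec ::
    "'k::finite set \<Rightarrow> ('k point \<Rightarrow> real) \<Rightarrow> ('k point \<Rightarrow> real) \<Rightarrow> 'k coord \<Rightarrow> 'k coord \<Rightarrow> bool" where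
  "lham_vec P F F\<^sub>1 c v \<longleftrightarrow>
     (\<forall>u. (\<forall>w. om (- P) u w = 0) \<longrightarrow> om P u v = pd u (F \<circ> cover) c) \<and>
     (\<forall>u. proj P u = 0 \<longrightarrow> om (- P) u v = pd u (F\<^sub>1 \<circ> cover) c)"

text \<open>Solutions on the interval \<open>S\<close>; \<open>c\<close> is a lift of \<open>\<gamma>\<close> to the universal cover.\<close>

definition lham_solution ::
    "('k::finite \<Rightarrow> real set) \<Rightarrow> 'k set \<Rightarrow> ('k point \<Rightarrow> real) \<Rightarrow> ('k point \<Rightarrow> real) \<Rightarrow>
      real set \<Rightarrow> (real \<Rightarrow> 'k point) \<Rightarrow> bool" where
  "lham_solution J P F F\<^sub>1 S \<gamma> \<longleftrightarrow> (\<exists>c. \<forall>t\<in>S. \<gamma> t = cover (c t) \<and> \<gamma> t \<in> phase_space J \<and>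
     (\<exists>v. lham_vec P F F\<^sub>1 (c t) v \<and> (c has_vector_derivative v) (at t within S)))"

text \<open>\<open>flow_rel J P F F\<^sub>1 t x y\<close>: the flow at time \<open>t\<close> is defined at \<open>x\<close> and maps it to \<open>y\<close>.\<close>

definition flow_rel ::
    "('k::finite \<Rightarrow> real set) \<Rightarrow> 'k set \<Rightarrow> ('k point \<Rightarrow> real) \<Rightarrow> ('k point \<Rightarrow> real) \<Rightarrow>
      real \<Rightarrow> 'k point \<Rightarrow> 'k point \<Rightarrow> bool" where
  "flow_rel J P F F\<^sub>1 t x y \<longleftrightarrow>
     (\<exists>\<delta>. lham_solution J P F F\<^sub>1 (closed_segment 0 t) \<delta> \<and> \<delta> 0 = x \<and> \<delta> t = y)"

definition lham_flow ::
    "('k::finite \<Rightarrow> real set) \<Rightarrow> 'k set \<Rightarrow> ('k point \<Rightarrow> real) \<Rightarrow> ('k point \<Rightarrow> real) \<Rightarrow>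
      real \<Rightarrow> 'k point \<Rightarrow> 'k point" where
  "lham_flow J P F F\<^sub>1 t x = (THE y. flow_rel J P F F\<^sub>1 t x y)"

definition rel_periodic_solution ::
    "('k::finite \<Rightarrow> real set) \<Rightarrow> 'k set \<Rightarrow> ('k point \<Rightarrow> real) \<Rightarrow> ('k point \<Rightarrow> real) \<Rightarrow>
      real \<Rightarrow> real \<Rightarrow> (real \<Rightarrow> 'k point) \<Rightarrow> bool" where
  "rel_periodic_solution J P F F\<^sub>1 T \<alpha> \<gamma> \<longleftrightarrow>
     T \<noteq> 0 \<and> lham_solution J P F F\<^sub>1 UNIV \<gamma> \<and>
     (\<forall>t. flow_rel J P F F\<^sub>1 T (rot (- \<alpha>) (\<gamma> t)) (\<gamma> t))"

definition phase_orbit :: "(real \<Rightarrow> 'k::finite point) \<Rightarrow> 'k point set" where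
  "phase_orbit \<gamma> = {rot \<beta> (\<gamma> t) | \<beta> t. True}"

section \<open>The model system\<close>

definition lift_ham :: "('k::finite \<Rightarrow> real \<times> real \<times> real \<Rightarrow> real) \<Rightarrow> 'k \<Rightarrow> 'k point \<Rightarrow> real" where
  "lift_ham H k x = fun1 (H k) (x $ k)"

text \<open>$H_0$ and $H_1$ are \<open>sum_ham H P\<close> and \<open>sum_ham H (- P)\<close>.\<close>

definition sum_ham :: "('k::finite \<Rightarrow> real \<times> real \<times> real \<Rightarrow> real) \<Rightarrow> 'k set \<Rightarrow> 'k point \<Rightarrow> real" where
  "sum_ham H A x = (\<Sum>k\<in>A. lift_ham H k x)"

definition freq :: "(real \<times> real \<times> real \<Rightarrow> real) \<Rightarrow> (real \<Rightarrow> real) \<Rightarrow> real \<Rightarrow> real" where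
  "freq h \<tau> I = 2 * pi / \<tau> (h (I, 0, 0))"

text \<open>
  Conditions on one factor with Hamiltonian \<open>h\<close> and period function \<open>\<tau>\<close>. Solutions of the
  initial value problem being unique, existence of a periodic solution through every point says that
  all solutions are periodic (and extend to the whole real line).
\<close>

definition all_periodic :: "real set \<Rightarrow> (real \<times> real \<times> real \<Rightarrow> real) \<Rightarrow> (real \<Rightarrow> real) \<Rightarrow> bool" where
  "all_periodic J h \<tau> \<longleftrightarrow> (\<forall>x\<in>phase_space1 J. \<tau> (fun1 h x) \<noteq> 0 \<and>
     (\<exists>\<gamma>. ham1_solution J h \<gamma> \<and> \<gamma> 0 = x \<and> (\<forall>t. \<gamma> (t + \<tau> (fun1 h x)) = \<gamma> t)))"

definition nondegenerate :: "real set \<Rightarrow> (real \<times> real \<times> real \<Rightarrow> real) \<Rightarrow> (real \<Rightarrow> real) \<Rightarrow> bool" where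
  "nondegenerate J h \<tau> \<longleftrightarrow> (\<forall>I\<in>J.
     let x = (I, 0, 0); dI = (1, 0, 0); dq = (0, 1, 0); dp = (0, 0, 1) in
       pd dI h x = freq h \<tau> I \<and>
       pd dI (pd dI h) x \<noteq> 0 \<and> pd dq h x = 0 \<and> pd dp h x = 0 \<and>
       pd dq (pd dq h) x * pd dp (pd dp h) x - pd dq (pd dp h) x * pd dp (pd dq h) x
         = (freq h \<tau> I)\<^sup>2)"

definition cyl_torus :: "('k::finite \<Rightarrow> real) \<Rightarrow> 'k point set" where
  "cyl_torus I = {x. \<forall>k. x $ k \<in> sphere 0 1 \<times> {I k} \<times> {0} \<times> {0}}"

text \<open>The common level set of the functions \<open>H k\<close>, \<open>k \<in> P\<close>, through the points \<open>(I k, 0, 0)\<close>.\<close>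

definition level_set ::
    "('k::finite \<Rightarrow> real set) \<Rightarrow> 'k set \<Rightarrow> ('k \<Rightarrow> real \<times> real \<times> real \<Rightarrow> real) \<Rightarrow> ('k \<Rightarrow> real) \<Rightarrow>
      'k point set" where
  "level_set J P H I = {x \<in> phase_space J. \<forall>k\<in>P. lift_ham H k x = H k (I k, 0, 0)}"

definition average ::
    "('k::finite \<Rightarrow> real set) \<Rightarrow> 'k set \<Rightarrow> ('k point \<Rightarrow> real) \<Rightarrow> ('k point \<Rightarrow> real) \<Rightarrow>
      real \<Rightarrow> ('k point \<Rightarrow> real) \<Rightarrow> 'k point \<Rightarrow> real" where
  "average J P F F\<^sub>1 T R x = (1 / T) * integral {0..T} (\<lambda>t. R (lham_flow J P F F\<^sub>1 t x))"

text \<open>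
  \<open>x\<close> is a critical point of the restriction of \<open>f\<close> to \<open>L\<close>, expressed by curves in \<open>L\<close>. It is
  used where \<open>L\<close> is a submanifold near \<open>x\<close> and the restriction is differentiable.
\<close>

definition critical_point_on ::
    "'k::finite point set \<Rightarrow> ('k point \<Rightarrow> real) \<Rightarrow> 'k point \<Rightarrow> bool" where
  "critical_point_on L f x \<longleftrightarrow> x \<in> L \<and>
     (\<forall>c v. cover (c 0) = x \<and> (\<forall>t. cover (c t) \<in> L) \<and> (c has_vector_derivative v) (at 0)
        \<longrightarrow> ((\<lambda>t. f (cover (c t))) has_real_derivative 0) (at 0))"

section \<open>Agreement with the standard descriptions\<close>

lemma om1_nondeg: "(\<forall>w. om1 u w = 0) \<longleftrightarrow> u = 0"
proof
  assume A: "\<forall>w. om1 u w = 0"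
  obtain x y z t where u: "u = (x,y,z,t)" by (metis prod.exhaust)
  have "om1 u (1,0,0,0) = 0" "om1 u (0,1,0,0) = 0" "om1 u (0,0,1,0) = 0" "om1 u (0,0,0,1) = 0"
    using A by blast+
  thus "u = 0" by (auto simp: u om1_def zero_prod_def)
next
  show "u = 0 \<Longrightarrow> \<forall>w. om1 u w = 0" by (auto simp: om1_def zero_prod_def split: prod.splits)
qed

lemma om_kernel: "(\<forall>w. om A u w = 0) \<longleftrightarrow> proj A u = 0"
proof
  assume A: "\<forall>w. om A u w = 0"
  show "proj A u = 0"
  proof (simp add: vec_eq_iff proj_def, intro allI impI)
    fix k assume k: "k \<in> A"
    have "om1 (u $ k) w = 0" for w
    proof -
      have "om A u (\<chi> j. if j = k then w else 0) = 0" using A by blast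
      moreover have "om A u (\<chi> j. if j = k then w else 0) = (\<Sum>j\<in>A. if j = k then om1 (u $ k) w else 0)"
        unfolding om_def by (rule sum.cong) (auto simp: om1_def zero_prod_def split: prod.splits)
      ultimately show ?thesis using k by simp
    qed
    thus "u $ k = 0" using om1_nondeg by blast
  qed
next
  assume "proj A u = 0"
  hence "\<And>k. k \<in> A \<Longrightarrow> u $ k = 0" by (auto simp: vec_eq_iff proj_def split: if_splits)
  thus "\<forall>w. om A u w = 0" unfolding om_def
    by (auto simp: om1_nondeg intro!: sum.neutral) (metis om1_nondeg)
qed

lemma om1_add: "om1 (u + w) v = om1 u v + om1 w v"
  by (auto simp: om1_def split_beta algebra_simps)
lemma om_add: "om A (u + w) v = om A u v + om A w v"
  by (simp add: om_def om1_add sum.distrib)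

lemma proj_split: "u = proj P u + proj (- P) (u::'a::monoid_add ^ 'k::finite)"
  by (auto simp: vec_eq_iff proj_def)
lemma proj_proj: "proj A (proj B u) = proj (A \<inter> B) u" by (auto simp: vec_eq_iff proj_def)
lemma proj_cover_line:
  assumes "proj P u = 0" shows "proj P (cover (c + t *\<^sub>R u)) = proj P (cover c)"
proof -
  have "u $ k = 0" if "k \<in> P" for k using assms that by (simp add: vec_eq_iff proj_def) metis
  thus ?thesis by (simp add: vec_eq_iff proj_def cover_def)
qed

lemma open_cover_vimage: assumes "\<And>k. open (J k)" shows "open (cover -` phase_space J)"
proof -
  have e: "cover -` phase_space J = (\<Inter>k. (\<lambda>c. fst (snd (c $ k))) -` J k)"
    by (auto simp: phase_space_def phase_space1_def cover_def cover1_def split_beta mem_Times_iff)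
  show ?thesis unfolding e
    by (intro open_INT ballI finite open_vimage assms) (auto intro!: continuous_intros)
qed

text \<open>
  For \<open>lam \<noteq> 0\<close> the \<open>\<lambda>\<close>-Hamiltonian vector field is the Hamiltonian vector field of \<open>F\<close> for the
  form $\omega_0+\lambda\omega_1$.
\<close>

lemma lham_vec_iff_hamiltonian:
  fixes c v :: "'a::finite coord"
  assumes "\<And>k. open (J k)" and "lam \<noteq> 0" and "projects_to J P (\<lambda>x. F x - lam * F1 x)"
    and "cover c \<in> phase_space J"
    and "(F \<circ> cover) differentiable (at c)" and "(F1 \<circ> cover) differentiable (at c)"
  shows "lham_vec P F F1 c v \<longleftrightarrow>
    (\<forall>u. om P u v + lam * om (- P) u v = pd u (F \<circ> cover) c)"
proof -
  obtain D D1 where D: "((F \<circ> cover) has_derivative D) (at c)" "((F1 \<circ> cover) has_derivative D1) (at c)"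
    using assms(5,6) by (auto simp: differentiable_def)
  have pdD: "pd u (F \<circ> cover) c = D u" "pd u (F1 \<circ> cover) c = D1 u" for u
    using frechet_derivative_at[OF D(1)] frechet_derivative_at[OF D(2)] by (auto simp: pd_def)
  have key: "D u = lam * D1 u" if u: "proj P u = 0" for u
  proof -
    obtain g where g: "\<And>x. x \<in> phase_space J \<Longrightarrow> F x - lam * F1 x = g (proj P x)"
      using assms(3) by (auto simp: projects_to_def)
    have G: "((\<lambda>y. F (cover y) - lam * F1 (cover y)) has_derivative (\<lambda>h. D h - lam * D1 h)) (at c)"
      using D by (auto intro!: derivative_eq_intros simp: o_def)
    have L: "((\<lambda>t. c + t *\<^sub>R u) has_derivative (\<lambda>t. t *\<^sub>R u)) (at 0)"
      by (auto intro!: derivative_eq_intros)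
    have C: "((\<lambda>t::real. F (cover (c + t *\<^sub>R u)) - lam * F1 (cover (c + t *\<^sub>R u))) has_derivative
        (\<lambda>t. D (t *\<^sub>R u) - lam * D1 (t *\<^sub>R u))) (at 0)"
      using has_derivative_compose[OF L, of "\<lambda>y. F (cover y) - lam * F1 (cover y)" "\<lambda>h. D h - lam * D1 h"] G
      by simp
    have "open (cover -` phase_space J)" by (rule open_cover_vimage[OF assms(1)])
    moreover have "((\<lambda>t::real. c + t *\<^sub>R u) \<longlongrightarrow> c + 0 *\<^sub>R u) (at 0)" by (intro tendsto_intros)
    ultimately have "\<forall>\<^sub>F t::real in at 0. c + t *\<^sub>R u \<in> cover -` phase_space J"
      using assms(4) by (intro topological_tendstoD) auto
    hence E: "\<forall>\<^sub>F t::real in at 0. F (cover (c + t *\<^sub>R u)) - lam * F1 (cover (c + t *\<^sub>R u)) = g (proj P (cover c))"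
      by eventually_elim (use g proj_cover_line[OF u, of c] in auto)
    have "((\<lambda>t::real. F (cover (c + t *\<^sub>R u)) - lam * F1 (cover (c + t *\<^sub>R u))) has_derivative (\<lambda>t. 0)) (at 0)"
      using assms(4) g[of "cover c"]
      by (intro has_derivative_transform_eventually[OF has_derivative_const[of "g (proj P (cover c))"]])
         (use E in \<open>auto elim: eventually_mono\<close>)
    from has_derivative_unique[OF C this] have "D (1 *\<^sub>R u) - lam * D1 (1 *\<^sub>R u) = 0" by metis
    thus ?thesis by simp
  qed
  have linD: "D (x + y) = D x + D y" for x y using D(1) by (simp add: has_derivative_def bounded_linear.linear linear_add)
  have z: "om A u v = 0" if "proj A u = 0" for A u using that om_kernel by blast
  show ?thesis
  proof
    assume L: "lham_vec P F F1 c v"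
    show "\<forall>u. om P u v + lam * om (- P) u v = pd u (F \<circ> cover) c"
    proof
      fix u :: "'a coord"
      let ?a = "proj P u" and ?b = "proj (- P) u"
      have pa: "proj (- P) ?a = 0" and pb: "proj P ?b = 0" by (auto simp: vec_eq_iff proj_def)
      have "om P ?a v = D ?a" using L pa om_kernel[of "- P" ?a] by (auto simp: lham_vec_def pdD)
      moreover have "om (- P) ?b v = D1 ?b" using L pb by (auto simp: lham_vec_def pdD)
      moreover have "om P u v = om P ?a v + om P ?b v" "om (-P) u v = om (-P) ?a v + om (-P) ?b v"
        using proj_split[of u P] om_add by metis+
      moreover have "D u = D ?a + D ?b" using proj_split[of u P] linD by metis
      ultimately show "om P u v + lam * om (- P) u v = pd u (F \<circ> cover) c"
        using z[OF pa] z[OF pb] key[OF pb] by (simp add: pdD)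
    qed
  next
    assume R: "\<forall>u. om P u v + lam * om (- P) u v = pd u (F \<circ> cover) c"
    show "lham_vec P F F1 c v" unfolding lham_vec_def
    proof (intro conjI allI impI)
      fix u assume "\<forall>w. om (- P) u w = 0"
      thus "om P u v = pd u (F \<circ> cover) c" using R by (metis add.right_neutral mult_zero_right)
    next
      fix u :: "'a coord" assume u: "proj P u = 0"
      have "om P u v + lam * om (- P) u v = D u" using R pdD by simp
      thus "om (- P) u v = pd u (F1 \<circ> cover) c" using z[OF u] key[OF u] assms(2) by (simp add: pdD)
    qed
  qed
qed

lemma line_vector_derivative:
  "((\<lambda>t::real. c + t *\<^sub>R v) has_vector_derivative v) (at t within S)"
  by (auto intro!: derivative_eq_intros simp: has_vector_derivative_def)

text \<open>The circle action is the flow of the pair $I_0+\lambda I_1$, $I_1$.\<close>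

lemma rot_flow:
  assumes "x \<in> phase_space J"
  shows "lham_solution J P (\<lambda>x. (\<Sum>k\<in>P. fst (snd (x $ k))) + lam * (\<Sum>k\<in>-P. fst (snd (x $ k))))
     (\<lambda>x. \<Sum>k\<in>-P. fst (snd (x $ k))) UNIV (\<lambda>t. rot t x)"
proof -
  let ?v = "(\<chi> k. (1,0,0,0)) :: 'a coord"
  have "\<exists>c0. cover c0 = x"
  proof -
    have "\<forall>k. \<exists>y. cover1 y = x $ k"
    proof
      fix k
      obtain z I q p where e: "x $ k = (z,I,q,p)" by (metis prod.exhaust)
      hence "cmod z = 1" using assms by (auto simp: phase_space_def phase_space1_def dest!: spec[of _ k])
      then obtain f where "z = cis f" by (metis rcis_cmod_Arg mult_1 of_real_1 rcis_def)
      thus "\<exists>y. cover1 y = x $ k" using e by (intro exI[of _ "(f,I,q,p)"]) (simp add: cover1_def)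
    qed
    then obtain y where "\<forall>k. cover1 (y k) = x $ k" by metis
    thus ?thesis by (intro exI[of _ "\<chi> k. y k"]) (simp add: cover_def vec_eq_iff)
  qed
  then obtain c0 where c0: "cover c0 = x" ..
  let ?c = "\<lambda>t::real. c0 + t *\<^sub>R ?v"
  have cov: "rot t x = cover (?c t)" for t
    unfolding c0[symmetric] by (auto simp: rot_def cover_def cover1_def vec_eq_iff cis_mult split_beta add.commute zero_prod_def)
  have d: "((\<lambda>c::'a coord. (\<Sum>k\<in>A. fst (snd (cover c $ k)))) has_derivative (\<lambda>u. \<Sum>k\<in>A. fst (snd (u $ k)))) (at c)" for A c
  proof -
    have "bounded_linear (\<lambda>c::'a coord. (\<Sum>k\<in>A. fst (snd (c $ k))))"
      by (intro bounded_linear_sum bounded_linear_compose[OF bounded_linear_fst]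
          bounded_linear_compose[OF bounded_linear_snd] bounded_linear_vec_nth)
    thus ?thesis by (simp add: cover_def cover1_def split_beta bounded_linear_imp_has_derivative)
  qed
  have omv: "om A u ?v = (\<Sum>k\<in>A. fst (snd (u $ k)))" for A u
    by (auto simp: om_def om1_def split_beta)
  show ?thesis unfolding lham_solution_def
  proof (intro exI[of _ ?c] ballI conjI exI[of _ ?v])
    fix t :: real
    show "rot t x = cover (?c t)" by (rule cov)
    show "rot t x \<in> phase_space J" using assms
      by (auto simp: rot_def phase_space_def phase_space1_def split_beta mem_Times_iff norm_mult)
    show "(?c has_vector_derivative ?v) (at t within UNIV)" by (rule line_vector_derivative)
    have 1: "pd u ((\<lambda>x. \<Sum>k\<in>-P. fst (snd (x $ k))) \<circ> cover) c = (\<Sum>k\<in>-P. fst (snd (u $ k)))" for u and c :: "'a coord"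
      using frechet_derivative_at[OF d] by (auto simp: pd_def o_def dest: fun_cong)
    have 2: "pd u ((\<lambda>x. (\<Sum>k\<in>P. fst (snd (x $ k))) + lam * (\<Sum>k\<in>-P. fst (snd (x $ k)))) \<circ> cover) c
       = (\<Sum>k\<in>P. fst (snd (u $ k))) + lam * (\<Sum>k\<in>-P. fst (snd (u $ k)))" for u and c :: "'a coord"
      using frechet_derivative_at[OF has_derivative_add[OF d[of P c] has_derivative_mult_right[OF d[of "-P" c], of lam]]]
      unfolding pd_def o_def by metis
    show "lham_vec P (\<lambda>x. (\<Sum>k\<in>P. fst (snd (x $ k))) + lam * (\<Sum>k\<in>-P. fst (snd (x $ k)))) (\<lambda>x. \<Sum>k\<in>-P. fst (snd (x $ k))) (?c t) ?v"
      unfolding lham_vec_def 1 2 omv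
    proof (intro conjI allI impI refl)
      fix u :: "'a coord" assume A: "\<forall>w. om (-P) u w = 0"
      have "(\<Sum>k\<in>-P. fst (snd (u $ k))) = 0" using A omv[of "-P" u] by metis
      thus "(\<Sum>k\<in>P. fst (snd (u $ k))) = (\<Sum>k\<in>P. fst (snd (u $ k))) + lam * (\<Sum>k\<in>-P. fst (snd (u $ k)))" by simp
    qed
  qed
qed

end

theory Submission
  imports Defs
begin

text \<open>
  With \<open>\<omega>\<^sub>0 = 1\<close> the proof is a first-order computation in the small parameter \<open>\<mu>\<close> at fixed \<open>\<omega>\<close>.

  Only the components of a solution in $M_0$ are examined. As \<open>H\<^sub>1'\<close> does not depend on them and
  $\omega\varepsilon\le\mu\mu_0$, they obey the equations of $\omega(H_0+\mu R_0)$ up to an error which is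
  $\mu$ times something small. Let \<open>x\<close> be such a solution on the universal cover, let \<open>z\<close> be the
  solution of the unperturbed system with the same initial point, and \<open>w = x - z\<close>, so that
  $w=O(\mu)$. Let \<open>u\<close> be a solution of the equation linearised along the solution \<open>g\<close> of the model
  system which \<open>x\<close> follows, with \<open>u(0)\<close> tangent to the level set of the functions \<open>H k\<close>. Two
  evaluations of $\omega_0(u,w)$ at time \<open>T\<close> contradict each other.

  \<^item> The linearised flow is symplectic, therefore the derivative of $\omega_0(u,w)$ is
    $\omega\mu\,dR_0(g)u$ up to $o(\mu)$. Integrated over the period this is
    $\omega\mu T$ times the derivative of the averaged function in the direction \<open>u(0)\<close>. If \<open>\<gamma>\<close>
    contains a point that is not critical, the direction can be chosen so that it does not vanish.

  \<^item> All unperturbed solutions are periodic, with periods that depend continuously on the energy, so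
    each component of \<open>z\<close> returns to its initial point at a time \<open>T - s\<close> with small \<open>s\<close>; and \<open>x\<close> is
    almost \<open>T\<close>-periodic up to a rotation. Near the torus all velocities are close to the direction of
    the angle. Hence each component of \<open>w(T)\<close> is a multiple of that direction, up to
    $o(\mu+|s|)$. Because $w=O(\mu)$, this multiple is $O(\mu)$ and then so is \<open>s\<close>. But
    $\omega_0(u,\partial_\varphi)=0$ for tangent \<open>u\<close>, hence $\omega_0(u(T),w(T))=o(\mu)$.

  The second evaluation is made separately in each factor: the locale \<open>relative_equilibrium\<close> isolates
  what it needs, and its lemma \<open>small_drift\<close> contains the estimates. The lemma \<open>noncritical_point\<close>
  computes the derivative of the averaged function, \<open>no_relative_periodic_curve\<close> puts the two
  evaluations together, and \<open>no_relative_periodic_solutions\<close> shows that a relatively periodic solution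
  in the neighbourhood would give rise to a curve of the excluded kind. The neighbourhood \<open>U\<^sub>0\<close> is a
  tube of constant radius around the torus, which makes it invariant under rotations.
\<close>

section \<open>Partial derivatives and functions of class $C^k$\<close>

lemma pd_eqI: "(f has_derivative D) (at x) \<Longrightarrow> pd u f x = D u"
  unfolding pd_def using frechet_derivative_at by metis

lemma has_derivative_pd: "f differentiable (at x) \<Longrightarrow> (f has_derivative (\<lambda>u. pd u f x)) (at x)"
  unfolding pd_def by (simp add: frechet_derivative_works)

lemma linear_pd: "f differentiable (at x) \<Longrightarrow> linear (\<lambda>u. pd u f x)"
  by (rule has_derivative_linear[OF has_derivative_pd])

lemma pd_Basis_sum:
  assumes "f differentiable (at x)"
  shows "pd u f x = (\<Sum>b\<in>Basis. (u \<bullet> b) * pd b f x)"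
proof -
  interpret linear "\<lambda>u. pd u f x" by (rule linear_pd[OF assms])
  have "pd u f x = pd (\<Sum>b\<in>Basis. (u \<bullet> b) *\<^sub>R b) f x" by (simp add: euclidean_representation)
  thus ?thesis by (simp add: sum scale)
qed

lemma has_derivative_cong_open:
  assumes "open S" "x \<in> S" "\<And>y. y \<in> S \<Longrightarrow> f y = g y"
  shows "(f has_derivative D) (at x) \<longleftrightarrow> (g has_derivative D) (at x)"
  using has_derivative_transform_within_open[of f D x UNIV S g]
    has_derivative_transform_within_open[of g D x UNIV S f] assms by auto

lemma pd_cong_open:
  assumes "open S" "x \<in> S" "\<And>y. y \<in> S \<Longrightarrow> f y = g y"
  shows "pd u f x = pd u g x"
  unfolding pd_def frechet_derivative_def using has_derivative_cong_open[OF assms] by simp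

lemma Ck_on_cong:
  assumes "open S" "\<And>y. y \<in> S \<Longrightarrow> f y = g y" "Ck_on r S f"
  shows "Ck_on r S g"
  using assms(2,3)
proof (induction r arbitrary: f g)
  case 0
  thus ?case by (simp cong: continuous_on_cong)
next
  case (Suc r)
  show ?case unfolding Ck_on.simps
  proof (intro conjI ballI)
    fix x assume "x \<in> S"
    moreover from this have "f differentiable at x" using Suc.prems by simp
    ultimately show "g differentiable at x"
      unfolding differentiable_def using has_derivative_cong_open[of S x f g] assms(1) Suc.prems(1) by blast
  next
    fix u :: 'a assume "u \<in> Basis"
    thus "Ck_on r S (pd u g)"
      using Suc.IH[of "pd u f" "pd u g"] Suc.prems pd_cong_open[OF assms(1)] by (metis Ck_on.simps(2))
  qed
qed

lemma Ck_on_mono: "Ck_on (Suc r) S f \<Longrightarrow> Ck_on r S f"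
proof (induction r arbitrary: f)
  case 0
  hence "f differentiable_on S" by (intro differentiable_at_imp_differentiable_on) simp
  thus ?case using differentiable_imp_continuous_on by simp
next
  case (Suc r)
  thus ?case by (metis Ck_on.simps(2))
qed

lemma Ck_on_subset: "Ck_on r S f \<Longrightarrow> S' \<subseteq> S \<Longrightarrow> Ck_on r S' f"
proof (induction r arbitrary: f)
  case 0
  thus ?case by (auto intro: continuous_on_subset)
next
  case (Suc r)
  thus ?case unfolding Ck_on.simps by blast
qed

lemma Ck_on_const: "Ck_on r S (\<lambda>x. c)"
proof (induction r arbitrary: c)
  case (Suc r)
  have "pd u (\<lambda>x::'a. c) = (\<lambda>x. 0)" for u
    by (rule ext, rule pd_eqI[where D="\<lambda>_. 0"]) simp
  thus ?case using Suc by simp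
qed simp

lemma Ck_on_add:
  assumes "open S" "Ck_on r S f" "Ck_on r S g"
  shows "Ck_on r S (\<lambda>x. f x + g x)"
  using assms(2,3)
proof (induction r arbitrary: f g)
  case 0
  thus ?case by (auto intro: continuous_intros)
next
  case (Suc r)
  have pd: "pd u f x + pd u g x = pd u (\<lambda>x. f x + g x) x" if "x \<in> S" for u x
    by (rule pd_eqI[symmetric], intro derivative_intros has_derivative_pd) (use Suc.prems that in auto)
  have "Ck_on r S (pd u (\<lambda>x. f x + g x))" if "u \<in> Basis" for u
    by (rule Ck_on_cong[OF assms(1) pd]) (use Suc that in auto)
  thus ?case using Suc.prems by auto
qed

lemma Ck_on_cmult:
  assumes "open S" "Ck_on r S f"
  shows "Ck_on r S (\<lambda>x. c * f x)"
  using assms(2)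
proof (induction r arbitrary: f)
  case 0
  thus ?case by (auto intro: continuous_intros)
next
  case (Suc r)
  have pd: "c * pd u f x = pd u (\<lambda>x. c * f x) x" if "x \<in> S" for u x
    by (rule pd_eqI[symmetric], intro derivative_intros has_derivative_pd) (use Suc.prems that in auto)
  have "Ck_on r S (pd u (\<lambda>x. c * f x))" if "u \<in> Basis" for u
    by (rule Ck_on_cong[OF assms(1) pd]) (use Suc that in auto)
  thus ?case using Suc.prems by auto
qed

lemma Ck_on_sum:
  assumes "open S" "finite A" "\<And>i. i \<in> A \<Longrightarrow> Ck_on r S (f i)"
  shows "Ck_on r S (\<lambda>x. \<Sum>i\<in>A. f i x)"
  using assms(2,3) by (induction A rule: finite_induct) (auto intro: Ck_on_add[OF assms(1)] Ck_on_const)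

lemma pd_linear_compose:
  assumes L: "bounded_linear L" and f: "f differentiable (at (L x))"
  shows "pd u (f \<circ> L) x = pd (L u) f (L x)" and "(f \<circ> L) differentiable (at x)"
proof -
  have d: "(f \<circ> L has_derivative (\<lambda>u. pd (L u) f (L x))) (at x)"
    using diff_chain_at[OF bounded_linear_imp_has_derivative[OF L] has_derivative_pd[OF f]]
    by (simp add: o_def)
  show "pd u (f \<circ> L) x = pd (L u) f (L x)" by (rule pd_eqI[OF d])
  show "(f \<circ> L) differentiable (at x)" using d by (auto simp: differentiable_def)
qed

lemma Ck_on_linear_compose:
  assumes L: "bounded_linear L" and S: "open S" and f: "Ck_on r S f"
  shows "Ck_on r (L -` S) (f \<circ> L)"
  using f
proof (induction r arbitrary: f)
  case 0
  have "continuous_on (L -` S) L" by (rule linear_continuous_on[OF L])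
  thus ?case using 0 continuous_on_compose2[of S f "L -` S" L] by (simp add: o_def image_subset_iff)
next
  case (Suc r)
  have O: "open (L -` S)" by (rule open_vimage[OF S linear_continuous_on[OF L]])
  have pd: "(\<Sum>b\<in>Basis. (L u \<bullet> b) * (pd b f \<circ> L) x) = pd u (f \<circ> L) x" if "x \<in> L -` S" for u x
    using pd_linear_compose(1)[OF L, of f x u] pd_Basis_sum[of f "L x" "L u"] Suc.prems that by auto
  have "Ck_on r (L -` S) (pd u (f \<circ> L))" if "u \<in> Basis" for u
  proof (rule Ck_on_cong[OF O])
    show "Ck_on r (L -` S) (\<lambda>x. \<Sum>b\<in>Basis. (L u \<bullet> b) * (pd b f \<circ> L) x)"
      by (intro Ck_on_sum[OF O finite_Basis] Ck_on_cmult[OF O] Suc.IH) (use Suc.prems in auto)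
  qed (rule pd)
  thus ?case using Suc.prems pd_linear_compose(2)[OF L] unfolding Ck_on.simps by blast
qed

lemma pd_linear_combination_continuous:
  assumes "\<And>b. b \<in> Basis \<Longrightarrow> continuous_on S (pd b f)" "\<And>x. x \<in> S \<Longrightarrow> f differentiable (at x)"
    "continuous_on Q g" "continuous_on Q v" "g ` Q \<subseteq> S"
  shows "continuous_on Q (\<lambda>t. pd (v t) f (g t))"
proof -
  have "continuous_on Q (\<lambda>t. pd b f (g t))" if "b \<in> Basis" for b
    by (rule continuous_on_compose2[OF assms(1)[OF that] assms(3) assms(5)])
  hence "continuous_on Q (\<lambda>t. \<Sum>b\<in>Basis. (v t \<bullet> b) * pd b f (g t))"
    by (intro continuous_intros assms)
  thus ?thesis
    by (rule continuous_on_eq) (use assms(2,5) in \<open>auto intro!: pd_Basis_sum[symmetric]\<close>)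
qed

lemma pd_bound:
  fixes c :: real
  assumes "f differentiable (at x)" "\<And>b. b \<in> Basis \<Longrightarrow> \<bar>pd b f x\<bar> \<le> c"
  shows "\<bar>pd (u::'a::euclidean_space) f x\<bar> \<le> DIM('a) * c * norm u"
proof -
  have "\<bar>pd u f x\<bar> \<le> (\<Sum>b\<in>Basis. \<bar>(u \<bullet> b) * pd b f x\<bar>)"
    unfolding pd_Basis_sum[OF assms(1), of u] by (rule sum_abs)
  also have "\<dots> \<le> (\<Sum>b\<in>(Basis::'a set). norm u * c)"
    unfolding abs_mult by (intro sum_mono mult_mono assms(2) Basis_le_norm) auto
  finally show ?thesis by (simp add: algebra_simps)
qed

text \<open>
  The partial derivatives are uniformly continuous on a compact neighbourhood of \<open>K\<close>, so one radius
  serves all points of \<open>K\<close>.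
\<close>

lemma C1_uniform_pd:
  assumes S: "open S" and K: "compact K" "K \<subseteq> S" and g: "Ck_on 1 S (g::'a::euclidean_space \<Rightarrow> real)"
    and \<kappa>: "\<kappa> > 0"
  obtains r where "r > 0" "\<And>x y. x \<in> K \<Longrightarrow> norm (y - x) < r \<Longrightarrow> y \<in> S"
    "\<And>x y u. x \<in> K \<Longrightarrow> norm (y - x) < r \<Longrightarrow> \<bar>pd u g y - pd u g x\<bar> \<le> \<kappa> * norm u"
proof -
  obtain r0 where r0: "r0 > 0" "(\<Union>x\<in>K. cball x r0) \<subseteq> S"
    using compact_subset_open_imp_cball_epsilon_subset[OF K(1) S K(2)] by metis
  let ?K = "(\<Union>x\<in>K. cball x r0)"
  have cK: "compact ?K"
  proof -
    have "?K = {x + y | x y. x \<in> K \<and> y \<in> cball 0 r0}"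
      by (auto simp: dist_norm) (metis add_diff_cancel_left' diff_add_cancel norm_minus_commute add.commute)
    thus ?thesis using compact_sums[OF K(1) compact_cball, of 0 r0] by simp
  qed
  have diff: "g differentiable (at x)" if "x \<in> S" for x using g that by auto
  define k where "k = \<kappa> / DIM('a)"
  have k: "k > 0" using \<kappa> by (simp add: k_def)
  have "\<exists>d>0. \<forall>x\<in>?K. \<forall>y\<in>?K. dist y x < d \<longrightarrow> \<bar>pd b g y - pd b g x\<bar> < k" if b: "b \<in> Basis" for b
  proof -
    have "continuous_on ?K (pd b g)" using g b r0(2) by (auto intro: continuous_on_subset)
    hence "uniformly_continuous_on ?K (pd b g)" using cK by (rule compact_uniformly_continuous)
    thus ?thesis using k unfolding uniformly_continuous_on_def dist_real_def by blast
  qed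
  then obtain d where d: "\<And>b. b \<in> Basis \<Longrightarrow> d b > 0"
    "\<And>b x y. b \<in> Basis \<Longrightarrow> x \<in> ?K \<Longrightarrow> y \<in> ?K \<Longrightarrow> dist y x < d b \<Longrightarrow> \<bar>pd b g y - pd b g x\<bar> < k"
    by metis
  define r where "r = Min (insert r0 (d ` Basis))"
  have "Min (d ` Basis) \<le> d b" if "b \<in> Basis" for b using that by (intro Min_le) auto
  hence r: "r > 0" "r \<le> r0" "\<And>b. b \<in> Basis \<Longrightarrow> r \<le> d b"
    using r0(1) d(1) by (auto simp: r_def Min_gr_iff min_le_iff_disj)
  have in_K: "y \<in> ?K" if "x \<in> K" "norm (y - x) < r" for x y
    using that r by (auto simp: dist_norm norm_minus_commute intro!: bexI[of _ x])
  show ?thesis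
  proof (rule that[OF r(1)])
    fix x y assume xy: "x \<in> K" "norm (y - x) < r"
    show yS: "y \<in> S" using in_K[OF xy] r0 by blast
    fix u
    have xS: "x \<in> S" using xy K by auto
    have "\<bar>pd u g y - pd u g x\<bar> = \<bar>\<Sum>b\<in>Basis. (u \<bullet> b) * (pd b g y - pd b g x)\<bar>"
      unfolding pd_Basis_sum[OF diff[OF yS], of u] pd_Basis_sum[OF diff[OF xS], of u]
      by (simp add: sum_subtractf right_diff_distrib)
    also have "\<dots> \<le> (\<Sum>b\<in>Basis. \<bar>(u \<bullet> b) * (pd b g y - pd b g x)\<bar>)" by (rule sum_abs)
    also have "\<dots> \<le> (\<Sum>b\<in>(Basis::'a set). norm u * k)"
    proof (unfold abs_mult, intro sum_mono mult_mono)
      fix b :: 'a assume b: "b \<in> Basis"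
      show "\<bar>u \<bullet> b\<bar> \<le> norm u" using b by (rule Basis_le_norm)
      have "x \<in> ?K" using in_K[of x x] xy r by auto
      thus "\<bar>pd b g y - pd b g x\<bar> \<le> k" using d(2)[OF b _ in_K[OF xy]] xy r(3)[OF b]
        by (force simp: dist_norm)
    qed auto
    also have "\<dots> = \<kappa> * norm u" by (simp add: k_def)
    finally show "\<bar>pd u g y - pd u g x\<bar> \<le> \<kappa> * norm u" .
  qed
qed

text \<open>
  Functions of class $C^1$ are strictly differentiable: both points \<open>y\<close> and \<open>z\<close> may vary. Thus the
  difference of two solutions that are close to a third one satisfies the equation linearised along
  the third, with an error that is small compared with this difference.
\<close>

lemma C1_strictly_differentiable:
  assumes S: "open S" and K: "compact K" "K \<subseteq> S" and g: "Ck_on 1 S (g::'a::euclidean_space \<Rightarrow> real)"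
    and \<kappa>: "\<kappa> > 0"
  obtains r where "r > 0" "\<And>x y. x \<in> K \<Longrightarrow> norm (y - x) < r \<Longrightarrow> y \<in> S"
    "\<And>x y z. x \<in> K \<Longrightarrow> norm (y - x) < r \<Longrightarrow> norm (z - x) < r
      \<Longrightarrow> \<bar>g y - g z - pd (y - z) g x\<bar> \<le> \<kappa> * norm (y - z)"
proof -
  obtain r where r: "r > 0" "\<And>x y. x \<in> K \<Longrightarrow> norm (y - x) < r \<Longrightarrow> y \<in> S"
    "\<And>x y u. x \<in> K \<Longrightarrow> norm (y - x) < r \<Longrightarrow> \<bar>pd u g y - pd u g x\<bar> \<le> \<kappa> * norm u"
    by (rule C1_uniform_pd[OF assms]) blast
  have diff: "g differentiable (at x)" if "x \<in> S" for x using g that by auto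
  show ?thesis
  proof (rule that[of r])
    show "r > 0" by (rule r(1))
    show "y \<in> S" if "x \<in> K" "norm (y - x) < r" for x y using r(2) that .
    fix x y z assume x: "x \<in> K" and yz: "norm (y - x) < r" "norm (z - x) < r"
    have xS: "x \<in> S" using x K by auto
    have lin: "linear (\<lambda>u. pd u g x)" by (rule linear_pd[OF diff[OF xS]])
    have bl: "bounded_linear (\<lambda>u. pd u g x)"
      by (rule has_derivative_bounded_linear[OF has_derivative_pd[OF diff[OF xS]]])
    have der: "((\<lambda>y. g y - pd y g x) has_derivative (\<lambda>u. pd u g w - pd u g x)) (at w within ball x r)"
      if w: "w \<in> ball x r" for w
    proof -
      have "w \<in> S" using r(2)[OF x, of w] w by (simp add: dist_norm norm_minus_commute)
      hence "(g has_derivative (\<lambda>u. pd u g w)) (at w within ball x r)"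
        by (rule has_derivative_at_withinI[OF has_derivative_pd[OF diff]])
      thus ?thesis by (rule has_derivative_diff[OF _ bounded_linear_imp_has_derivative[OF bl]])
    qed
    have "norm ((g y - pd y g x) - (g z - pd z g x)) \<le> \<kappa> * norm (y - z)"
    proof (rule differentiable_bound[OF convex_ball der])
      fix w assume w: "w \<in> ball x r"
      show "onorm (\<lambda>u. pd u g w - pd u g x) \<le> \<kappa>"
        using r(3)[OF x, of w] w \<kappa> by (intro onorm_bound) (auto simp: dist_norm norm_minus_commute)
    qed (use yz in \<open>auto simp: dist_norm norm_minus_commute\<close>)
    moreover have "pd (y - z) g x = pd y g x - pd z g x" by (rule linear_diff[OF lin])
    ultimately show "\<bar>g y - g z - pd (y - z) g x\<bar> \<le> \<kappa> * norm (y - z)"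
      by (simp add: algebra_simps)
  qed
qed

lemma C1_Lipschitz_near_compact:
  assumes S: "open S" and K: "compact K" "K \<subseteq> S" and g: "Ck_on 1 S (g::'a::euclidean_space \<Rightarrow> real)"
  obtains r l where "r > 0" "l \<ge> 0"
    "\<And>x y. x \<in> K \<Longrightarrow> norm (y - x) < r \<Longrightarrow> \<bar>g y - g x\<bar> \<le> l * norm (y - x)"
proof -
  obtain r where r: "r > 0" "\<And>x y z. x \<in> K \<Longrightarrow> norm (y - x) < r \<Longrightarrow> norm (z - x) < r
      \<Longrightarrow> \<bar>g y - g z - pd (y - z) g x\<bar> \<le> 1 * norm (y - z)"
    by (rule C1_strictly_differentiable[OF assms zero_less_one]) blast
  have "\<exists>c. \<forall>x\<in>K. \<bar>pd b g x\<bar> \<le> c" if "b \<in> Basis" for b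
  proof -
    have "continuous_on K (pd b g)" using g that K(2) by (auto intro: continuous_on_subset)
    hence "bounded (pd b g ` K)" using K(1) compact_continuous_image compact_imp_bounded by blast
    thus ?thesis by (auto simp: bounded_iff)
  qed
  then obtain c where c: "\<And>b x. b \<in> Basis \<Longrightarrow> x \<in> K \<Longrightarrow> \<bar>pd b g x\<bar> \<le> c b" by metis
  define C where "C = (\<Sum>b\<in>Basis. \<bar>c b\<bar>)"
  have C: "\<bar>pd b g x\<bar> \<le> C" if "b \<in> Basis" "x \<in> K" for b x
  proof -
    have "\<bar>c b\<bar> \<le> C" unfolding C_def by (rule member_le_sum) (use that in auto)
    thus ?thesis using c[OF that] by simp
  qed
  have C0: "C \<ge> 0" unfolding C_def by (rule sum_nonneg) simp
  show ?thesis
  proof (rule that[of r "1 + DIM('a) * C"])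
    fix x y assume x: "x \<in> K" and y: "norm (y - x) < r"
    have "g differentiable (at x)" using g K(2) x by auto
    hence "\<bar>pd (y - x) g x\<bar> \<le> DIM('a) * C * norm (y - x)"
      using pd_bound[of g x C "y - x"] C[OF _ x] by blast
    thus "\<bar>g y - g x\<bar> \<le> (1 + DIM('a) * C) * norm (y - x)"
      using r(2)[OF x y, of x] r(1) by (simp add: algebra_simps abs_if split: if_splits)
  qed (use r C0 in auto)
qed

text \<open>
  Both mixed derivatives are limits of the same second difference over \<open>t * t\<close>; by the mean value
  theorem this difference is \<open>t\<close> times a difference of first derivatives, to which strict
  differentiability applies.
\<close>

lemma pd_commute:
  assumes S: "open S" "x \<in> S" and f: "Ck_on 2 S (f::'a::euclidean_space \<Rightarrow> real)"
    and uv: "u \<in> Basis" "v \<in> Basis"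
  shows "pd u (pd v f) x = pd v (pd u f) x"
proof (rule ccontr)
  have diff: "f differentiable (at y)" if "y \<in> S" for y using f that by (simp add: numeral_2_eq_2)
  have C1: "Ck_on 1 S (pd b f)" if "b \<in> Basis" for b using f that by (simp add: numeral_2_eq_2)
  have key: "\<exists>r>0. \<forall>t. 0 < t \<and> t < r \<longrightarrow>
     \<bar>f (x + t *\<^sub>R a + t *\<^sub>R b) - f (x + t *\<^sub>R a) - f (x + t *\<^sub>R b) + f x - t * t * pd b (pd a f) x\<bar> \<le> k * (t * t)"
    if ab: "a \<in> Basis" "b \<in> Basis" and k: "k > 0" for a b k
  proof -
    obtain r where r: "r > 0" "\<And>y. norm (y - x) < r \<Longrightarrow> y \<in> S"
      "\<And>y z. norm (y - x) < r \<Longrightarrow> norm (z - x) < r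
      \<Longrightarrow> \<bar>pd a f y - pd a f z - pd (y - z) (pd a f) x\<bar> \<le> k * norm (y - z)"
      by (rule C1_strictly_differentiable[OF S(1) _ _ C1[OF ab(1)] k, of "{x}"]) (use S(2) in auto)
    show ?thesis
    proof (intro exI[of _ "r/2"] conjI allI impI)
      show "r / 2 > 0" using r by simp
      fix t :: real assume t: "0 < t \<and> t < r / 2"
      have n: "norm (s *\<^sub>R a + c *\<^sub>R b) < r" if "0 \<le> s" "s \<le> t" "0 \<le> c" "c \<le> t" for s c
        using norm_triangle_ineq[of "s *\<^sub>R a" "c *\<^sub>R b"] that t ab by simp
      define \<phi> where "\<phi> = (\<lambda>s. f (x + s *\<^sub>R a + t *\<^sub>R b) - f (x + s *\<^sub>R a))"
      have d: "(\<phi> has_real_derivative (pd a f (x + s *\<^sub>R a + t *\<^sub>R b) - pd a f (x + s *\<^sub>R a))) (at s)"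
        if s: "0 \<le> s" "s \<le> t" for s
      proof -
        have 1: "x + s *\<^sub>R a + t *\<^sub>R b \<in> S" "x + s *\<^sub>R a \<in> S"
          using n[OF s, of t] n[OF s, of 0] t by (auto intro!: r(2) simp: algebra_simps)
        have l: "pd (c *\<^sub>R a) f y = c * pd a f y" if "y \<in> S" for c y
          using linear_cmul[OF linear_pd[OF diff[OF that]], of c a] by simp
        have A: "((\<lambda>s. x + s *\<^sub>R a + t *\<^sub>R b) has_derivative (\<lambda>c. c *\<^sub>R a)) (at s)" "((\<lambda>s. x + s *\<^sub>R a) has_derivative (\<lambda>c. c *\<^sub>R a)) (at s)"
          by (auto intro!: derivative_eq_intros)
        have "(\<phi> has_derivative (\<lambda>c. pd (c *\<^sub>R a) f (x + s *\<^sub>R a + t *\<^sub>R b) - pd (c *\<^sub>R a) f (x + s *\<^sub>R a))) (at s)"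
          unfolding \<phi>_def
          by (intro derivative_intros has_derivative_compose[OF A(1) has_derivative_pd[OF diff]]
                has_derivative_compose[OF A(2) has_derivative_pd[OF diff]] 1)
        thus ?thesis unfolding has_field_derivative_def l[OF 1(1)] l[OF 1(2)]
          by (rule has_derivative_eq_rhs) (auto simp: algebra_simps)
      qed
      obtain s where s: "0 < s" "s < t" "\<phi> t - \<phi> 0 = (t - 0) * (pd a f (x + s *\<^sub>R a + t *\<^sub>R b) - pd a f (x + s *\<^sub>R a))"
        using MVT2[of 0 t \<phi>, OF _ d] t by auto
      have lin: "pd (t *\<^sub>R b) (pd a f) x = t * pd b (pd a f) x"
        using linear_cmul[OF linear_pd[of "pd a f" x], of t b] C1[OF ab(1)] S(2) by simp
      have "\<bar>pd a f (x + s *\<^sub>R a + t *\<^sub>R b) - pd a f (x + s *\<^sub>R a) - t * pd b (pd a f) x\<bar> \<le> k * t"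
        using r(3)[of "x + s *\<^sub>R a + t *\<^sub>R b" "x + s *\<^sub>R a"] n[of s t] n[of s 0] s t ab
        by (simp add: algebra_simps lin)
      hence "t * \<bar>pd a f (x + s *\<^sub>R a + t *\<^sub>R b) - pd a f (x + s *\<^sub>R a) - t * pd b (pd a f) x\<bar> \<le> t * (k * t)"
        using t by (intro mult_left_mono) auto
      moreover have "\<bar>\<phi> t - \<phi> 0 - t * t * pd b (pd a f) x\<bar>
          = t * \<bar>pd a f (x + s *\<^sub>R a + t *\<^sub>R b) - pd a f (x + s *\<^sub>R a) - t * pd b (pd a f) x\<bar>"
        unfolding s(3) using t by (simp add: abs_mult_pos' algebra_simps)
      ultimately show "\<bar>f (x + t *\<^sub>R a + t *\<^sub>R b) - f (x + t *\<^sub>R a) - f (x + t *\<^sub>R b) + f x - t * t * pd b (pd a f) x\<bar> \<le> k * (t * t)"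
        by (simp add: \<phi>_def algebra_simps)
    qed
  qed
  assume ne: "pd u (pd v f) x \<noteq> pd v (pd u f) x"
  define k where "k = \<bar>pd u (pd v f) x - pd v (pd u f) x\<bar> / 3"
  have k: "k > 0" using ne by (simp add: k_def)
  obtain r1 where r1: "r1 > 0" "\<And>t. 0 < t \<and> t < r1 \<Longrightarrow> \<bar>f (x + t *\<^sub>R u + t *\<^sub>R v) - f (x + t *\<^sub>R u) - f (x + t *\<^sub>R v) + f x - t * t * pd v (pd u f) x\<bar> \<le> k * (t * t)"
    using key[OF uv k] by auto
  obtain r2 where r2: "r2 > 0" "\<And>t. 0 < t \<and> t < r2 \<Longrightarrow> \<bar>f (x + t *\<^sub>R v + t *\<^sub>R u) - f (x + t *\<^sub>R v) - f (x + t *\<^sub>R u) + f x - t * t * pd u (pd v f) x\<bar> \<le> k * (t * t)"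
    using key[OF uv(2,1) k] by auto
  define t where "t = min r1 r2 / 2"
  have t: "0 < t \<and> t < r1" "0 < t \<and> t < r2" using r1(1) r2(1) by (auto simp: t_def)
  have "\<bar>t * t * pd u (pd v f) x - t * t * pd v (pd u f) x\<bar> \<le> 2 * k * (t * t)"
    using r1(2)[OF t(1)] r2(2)[OF t(2)] by (simp add: add_ac)
  hence "(t * t) * \<bar>pd u (pd v f) x - pd v (pd u f) x\<bar> \<le> (t * t) * (2 * k)"
    using t by (subst (asm) right_diff_distrib[symmetric]) (auto simp: abs_mult mult.commute)
  hence "\<bar>pd u (pd v f) x - pd v (pd u f) x\<bar> \<le> 2 * k" using t by simp
  thus False using k by (simp add: k_def)
qed

section \<open>Differential inequalities\<close>

text \<open>
  The norm is not differentiable at \<open>0\<close>. The differential inequality is therefore integrated for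
  $\sqrt{|y|^2+k^2}$, and \<open>k\<close> tends to \<open>0\<close> at the end.
\<close>

lemma gronwall:
  fixes y :: "real \<Rightarrow> 'a::real_inner"
  assumes T: "0 \<le> T" and der: "\<And>t. t \<in> {0..T} \<Longrightarrow> (y has_vector_derivative y' t) (at t within {0..T})"
    and bnd: "\<And>t. t \<in> {0..T} \<Longrightarrow> norm (y' t) \<le> L * norm (y t) + b"
    and L: "0 \<le> L" and b: "0 \<le> b" and a: "norm (y 0) \<le> a"
  shows "norm (y T) \<le> (a + b * T) * exp (L * T)"
proof (rule field_le_epsilon)
  fix k0 :: real assume k0: "k0 > 0"
  define k where "k = k0 / exp (L * T)"
  have k: "k > 0" using k0 by (simp add: k_def)
  define g where "g = (\<lambda>t. sqrt (y t \<bullet> y t + k * k))"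
  define f where "f = (\<lambda>t. g t * exp (- (L * t)) - b * t)"
  have pos: "y t \<bullet> y t + k * k > 0" for t using k by (simp add: add_nonneg_pos)
  have cont: "continuous_on {0..T} y"
    unfolding continuous_on_eq_continuous_within using has_vector_derivative_continuous[OF der] by blast
  have "f T \<le> f 0"
  proof (rule DERIV_nonpos_imp_decreasing_open[OF T])
    show "continuous_on {0..T} f" unfolding f_def g_def by (intro continuous_intros cont)
    fix t assume t: "0 < t" "t < T"
    have d: "(y has_vector_derivative y' t) (at t)" using der[of t] t at_within_Icc_at[of 0 t T] by simp
    have gd: "(g has_real_derivative ((y t \<bullet> y' t) / g t)) (at t)"
    proof -
      have "((\<lambda>t. y t \<bullet> y t + k * k) has_real_derivative 2 * (y t \<bullet> y' t)) (at t)"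
        using d unfolding has_vector_derivative_def has_field_derivative_def
        by (auto intro!: derivative_eq_intros simp: inner_commute algebra_simps)
      from DERIV_real_sqrt[OF pos[of t]] this
      have "((\<lambda>t. sqrt (y t \<bullet> y t + k * k)) has_real_derivative (inverse (sqrt (y t \<bullet> y t + k * k)) / 2) * (2 * (y t \<bullet> y' t))) (at t)"
        by (rule DERIV_chain2)
      thus ?thesis unfolding g_def by (simp add: field_simps)
    qed
    have gp: "g t > 0" using pos by (simp add: g_def)
    have ng: "norm (y t) \<le> g t" unfolding g_def norm_eq_sqrt_inner by simp
    have "y t \<bullet> y' t \<le> norm (y t) * norm (y' t)" by (rule norm_cauchy_schwarz)
    also have "\<dots> \<le> g t * (L * g t + b)"
    proof (rule mult_mono[OF ng])
      have "L * norm (y t) \<le> L * g t" using ng L by (rule mult_left_mono)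
      thus "norm (y' t) \<le> L * g t + b" using bnd[of t] t by simp
    qed (use gp in auto)
    finally have "(y t \<bullet> y' t) / g t \<le> L * g t + b" using gp by (simp add: field_simps)
    hence "((y t \<bullet> y' t) / g t - L * g t) * exp (- (L * t)) \<le> b * exp (- (L * t))" by (intro mult_right_mono) auto
    also have "\<dots> \<le> b * 1" using L t b by (intro mult_left_mono) auto
    finally have le: "((y t \<bullet> y' t) / g t - L * g t) * exp (- (L * t)) - b \<le> 0" by simp
    have "(f has_real_derivative ((y t \<bullet> y' t) / g t - L * g t) * exp (- (L * t)) - b) (at t)"
      unfolding f_def by (rule derivative_eq_intros gd refl)+ (simp add: algebra_simps)
    thus "\<exists>y. (f has_real_derivative y) (at t) \<and> y \<le> 0" using le by blast
  qed
  hence "g T * exp (- (L * T)) \<le> g 0 + b * T" by (simp add: f_def)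
  hence "g T \<le> (g 0 + b * T) * exp (L * T)" by (simp add: exp_minus field_simps)
  moreover have "norm (y T) \<le> g T" unfolding g_def norm_eq_sqrt_inner by simp
  moreover have "g 0 \<le> a + k"
  proof -
    have "g 0 \<le> norm (y 0) + k" unfolding g_def norm_eq_sqrt_inner
      using sqrt_add_le_add_sqrt[of "y 0 \<bullet> y 0" "k * k"] k by simp
    thus ?thesis using a by simp
  qed
  hence "(g 0 + b * T) * exp (L * T) \<le> (a + k + b * T) * exp (L * T)" by (intro mult_right_mono) auto
  ultimately show "norm (y T) \<le> (a + b * T) * exp (L * T) + k0" by (simp add: k_def algebra_simps)
qed

text \<open>
  Here the differential inequality is known only as long as \<open>y\<close> stays in the ball of radius \<open>r\<close>.
  At the first time \<open>Inf Z\<close> at which the norm reaches \<open>r\<close> the estimate up to this time would give a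
  norm smaller than \<open>r\<close>.
\<close>

lemma gronwall_local:
  fixes y :: "real \<Rightarrow> 'a::real_inner"
  assumes der: "\<And>t. t \<in> {0..T} \<Longrightarrow> (y has_vector_derivative y' t) (at t within {0..T})"
    and bnd: "\<And>t. t \<in> {0..T} \<Longrightarrow> norm (y t) \<le> r \<Longrightarrow> norm (y' t) \<le> L * norm (y t) + b"
    and L: "0 \<le> L" and b: "0 \<le> b" and a: "norm (y 0) \<le> a"
    and small: "(a + b * T) * exp (L * T) < r" and t: "t \<in> {0..T}"
  shows "norm (y t) \<le> (a + b * T) * exp (L * T)"
proof -
  have a0: "0 \<le> a" using a norm_ge_zero order_trans by blast
  have mono: "(a + b * s) * exp (L * s) \<le> (a + b * T) * exp (L * T)" if "s \<in> {0..T}" for s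
    using that L b a0 by (intro mult_mono add_mono mult_left_mono) (auto intro: mult_left_mono)
  have G: "norm (y s) \<le> (a + b * T) * exp (L * T)"
    if s: "s \<in> {0..T}" and le: "\<And>q. q \<in> {0..s} \<Longrightarrow> norm (y q) \<le> r" for s
  proof -
    have "norm (y s) \<le> (a + b * s) * exp (L * s)"
    proof (rule gronwall[where y = y and y' = y'])
      fix q assume q: "q \<in> {0..s}"
      have "(y has_vector_derivative y' q) (at q within {0..T})" using der q s by auto
      thus "(y has_vector_derivative y' q) (at q within {0..s})"
        by (rule has_vector_derivative_within_subset) (use s in auto)
      show "norm (y' q) \<le> L * norm (y q) + b" using bnd[of q] le[OF q] q s by auto
    qed (use s L b a in auto)
    thus ?thesis using mono[OF s] by simp
  qed
  have "continuous_on {0..T} y"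
    unfolding continuous_on_eq_continuous_within using has_vector_derivative_continuous[OF der] by blast
  hence cont: "continuous_on {0..T} (\<lambda>t. norm (y t))" by (rule continuous_on_norm)
  have all: "norm (y q) \<le> r" if q: "q \<in> {0..T}" for q
  proof (rule ccontr)
    assume n: "\<not> norm (y q) \<le> r"
    define Z where "Z = {s \<in> {0..T}. r \<le> norm (y s)}"
    have "closed Z" unfolding Z_def
      using continuous_closed_preimage[OF cont, of "{r..}"] by (simp add: vimage_def Int_def)
    moreover have "Z \<noteq> {}" "bdd_below Z" using n q by (auto simp: Z_def intro!: bdd_belowI[of _ 0])
    ultimately have inf: "Inf Z \<in> Z" by (intro closed_contains_Inf)
    have lt: "norm (y s) < r" if "s \<in> {0..<Inf Z}" for s
    proof (rule ccontr)
      assume "\<not> norm (y s) < r"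
      hence "s \<in> Z" using that inf by (auto simp: Z_def)
      thus False using cInf_lower[OF _ \<open>bdd_below Z\<close>] that by fastforce
    qed
    have "norm (y 0) < r"
    proof -
      have T0: "0 \<le> T" using q by auto
      have "a * 1 \<le> (a + b * T) * exp (L * T)" using T0 L b a0 by (intro mult_mono) auto
      thus ?thesis using a small by simp
    qed
    have le: "norm (y (Inf Z)) \<le> r"
    proof (rule ccontr)
      assume A: "\<not> norm (y (Inf Z)) \<le> r"
      have c: "continuous_on {0..Inf Z} (\<lambda>t. norm (y t))" using cont inf
        by (auto simp: Z_def intro: continuous_on_subset)
      obtain s where s: "0 \<le> s" "s \<le> Inf Z" "norm (y s) = r"
        using IVT'[of "\<lambda>t. norm (y t)" 0 r "Inf Z", OF _ _ _ c] A \<open>norm (y 0) < r\<close> inf by (auto simp: Z_def)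
      thus False using lt[of s] A by (cases "s = Inf Z") auto
    qed
    have "norm (y s) \<le> r" if "s \<in> {0..Inf Z}" for s
      using lt[of s] le that by (cases "s = Inf Z") auto
    hence "norm (y (Inf Z)) < r" using G[of "Inf Z"] inf small by (force simp: Z_def)
    thus False using inf by (simp add: Z_def)
  qed
  show ?thesis by (rule G[OF t]) (use all t in auto)
qed

lemma vector_mvt_bound:
  fixes g :: "real \<Rightarrow> 'a::real_normed_vector"
  assumes "\<And>t. t \<in> {a..b} \<Longrightarrow> (g has_vector_derivative g' t) (at t within {a..b})"
    and "\<And>t. t \<in> {a..b} \<Longrightarrow> norm (g' t) \<le> k" and "s \<in> {a..b}" "t \<in> {a..b}"
  shows "norm (g s - g t) \<le> k * \<bar>s - t\<bar>"
proof -
  have "norm (g s - g t) \<le> k * norm (s - t)"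
  proof (rule differentiable_bound)
    show "convex {a..b}" by simp
    show "(g has_derivative (\<lambda>h. h *\<^sub>R g' x)) (at x within {a..b})" if "x \<in> {a..b}" for x
      using assms(1)[OF that] by (simp add: has_vector_derivative_def)
    show "onorm (\<lambda>h. h *\<^sub>R g' x) \<le> k" if "x \<in> {a..b}" for x
      using assms(2)[OF that] by (simp add: onorm_scaleR_left onorm_id)
  qed fact+
  thus ?thesis by simp
qed

section \<open>Nearly periodic motion around a relative equilibrium\<close>

text \<open>
  The line through \<open>c\<close> in the direction \<open>e\<close> is the universal cover of a circle of relative equilibria;
  a solution on it moves with velocity \<open>\<nu>\<close>. The linearisation \<open>A\<close> of \<open>X\<close> is the same at all points of
  the line, and it is skew for the symplectic form \<open>B\<close>. The last assumption expresses that nearby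
  solutions are periodic with almost the same period: at a time close to \<open>T\<close> such a solution has
  returned to its initial point, after a whole number of turns in the direction \<open>e\<close>.
\<close>

locale relative_equilibrium =
  fixes X A :: "'a::euclidean_space \<Rightarrow> 'a" and B :: "'a \<Rightarrow> 'a \<Rightarrow> real" and e c :: 'a and \<nu> T :: real
  assumes linear_A: "linear A" and bilinear_B: "bounded_bilinear B"
    and norm_e: "norm e = 1" and nu: "\<nu> \<noteq> 0" and T: "T > 0"
    and strict: "\<And>\<kappa>. \<kappa> > 0 \<Longrightarrow> \<exists>r>0. \<forall>\<theta> y z. norm (y - (c + \<theta> *\<^sub>R e)) < r \<longrightarrow>
      norm (z - (c + \<theta> *\<^sub>R e)) < r \<longrightarrow> norm (X y - X z - A (y - z)) \<le> \<kappa> * norm (y - z)"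
    and equilibrium: "\<And>\<theta>. X (c + \<theta> *\<^sub>R e) = \<nu> *\<^sub>R e"
    and skew: "\<And>u w. B (A u) w + B u (A w) = 0"
    and almost_periodic: "\<And>\<kappa>. \<kappa> > 0 \<Longrightarrow> \<exists>\<rho>>0. \<forall>\<theta> y. norm (y - (c + \<theta> *\<^sub>R e)) < \<rho> \<longrightarrow>
      (\<exists>z s (n::int). (\<forall>t. (z has_vector_derivative X (z t)) (at t)) \<and> z 0 = y \<and> \<bar>s\<bar> \<le> \<kappa> \<and>
         z (T - s) = y + (2 * pi * of_int n) *\<^sub>R e)"
begin

text \<open>
  Any number greater than the norm of \<open>A\<close> is a Lipschitz constant of \<open>X\<close> close to the line.
\<close>

definition L :: real where "L = onorm A + 1"

definition cyl :: "real \<Rightarrow> 'a" where "cyl \<theta> = c + \<theta> *\<^sub>R e"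

lemma bounded_linear_A: "bounded_linear A"
  using linear_A by (simp add: linear_conv_bounded_linear)

lemma L_pos: "L > 0" "L \<ge> 0"
  using onorm_pos_le[OF bounded_linear_A] by (auto simp: L_def)

lemma norm_A_le: "norm (A y) \<le> (L - 1) * norm y"
  using onorm[OF bounded_linear_A] by (simp add: L_def)

lemma cyl_has_vector_derivative [derivative_intros]:
  "((\<lambda>t. cyl (\<theta> + \<nu> * t)) has_vector_derivative \<nu> *\<^sub>R e) (at t within S)"
  unfolding cyl_def by (auto intro!: derivative_eq_intros simp: has_vector_derivative_def algebra_simps)

lemma X_cyl: "X (cyl \<theta>) = \<nu> *\<^sub>R e"
  by (simp add: cyl_def equilibrium)

lemma strict_cyl: "\<kappa> > 0 \<Longrightarrow> \<exists>r>0. \<forall>\<theta> y z. norm (y - cyl \<theta>) < r \<longrightarrow>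
      norm (z - cyl \<theta>) < r \<longrightarrow> norm (X y - X z - A (y - z)) \<le> \<kappa> * norm (y - z)"
  using strict by (simp add: cyl_def)

lemma Lipschitz_near_cyl:
  "\<exists>r>0. \<forall>\<theta> y z. norm (y - cyl \<theta>) < r \<longrightarrow> norm (z - cyl \<theta>) < r \<longrightarrow> norm (X y - X z) \<le> L * norm (y - z)"
proof -
  obtain r where r: "r > 0" "\<And>\<theta> y z. norm (y - cyl \<theta>) < r \<Longrightarrow> norm (z - cyl \<theta>) < r \<Longrightarrow> norm (X y - X z - A (y - z)) \<le> norm (y - z)"
    using strict_cyl[OF zero_less_one] by auto
  have "norm (X y - X z) \<le> L * norm (y - z)" if "norm (y - cyl \<theta>) < r" "norm (z - cyl \<theta>) < r" for \<theta> y z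
    using r(2)[OF that] norm_A_le[of "y - z"] norm_triangle_sub[of "X y - X z" "A (y - z)"]
    by (simp add: algebra_simps)
  thus ?thesis using r(1) by blast
qed

text \<open>
  Gronwall's inequality for the distance to the solution on the line with angle \<open>\<theta>\<close> at time \<open>0\<close>,
  as long as it stays in the neighbourhood where \<open>X\<close> is Lipschitz.
\<close>

lemma stays_near_cyl:
  assumes \<kappa>: "\<kappa> > 0" and R: "R \<ge> 0"
  shows "\<exists>\<rho>>0. \<forall>x x' \<theta>. norm (x 0 - cyl \<theta>) \<le> \<rho> \<and>
      (\<forall>t\<in>{0..R}. (x has_vector_derivative x' t) (at t) \<and> norm (x' t - X (x t)) \<le> \<rho>) \<longrightarrow>
      (\<forall>t\<in>{0..R}. norm (x t - cyl (\<theta> + \<nu> * t)) \<le> \<kappa>)"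
proof -
  obtain r where r: "r > 0" "\<And>\<theta> y z. norm (y - cyl \<theta>) < r \<Longrightarrow> norm (z - cyl \<theta>) < r \<Longrightarrow> norm (X y - X z) \<le> L * norm (y - z)"
    using Lipschitz_near_cyl by metis
  define E where "E = (1 + R) * exp (L * R)"
  have E: "E > 0" using R by (simp add: E_def add_pos_nonneg)
  define \<rho> where "\<rho> = min \<kappa> (r / 2) / (2 * E)"
  have \<rho>: "\<rho> > 0" using \<kappa> r E by (simp add: \<rho>_def)
  have sum: "(\<rho> + \<rho> * R) * exp (L * R) = min \<kappa> (r / 2) / 2"
  proof -
    have "(\<rho> + \<rho> * R) * exp (L * R) = \<rho> * E" by (simp add: E_def algebra_simps)
    thus ?thesis using E by (simp add: \<rho>_def)
  qed
  show ?thesis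
  proof (intro exI[of _ \<rho>] conjI allI impI ballI \<rho>)
    fix x x' :: "real \<Rightarrow> 'a" and \<theta> t
    assume A: "norm (x 0 - cyl \<theta>) \<le> \<rho> \<and>
      (\<forall>t\<in>{0..R}. (x has_vector_derivative x' t) (at t) \<and> norm (x' t - X (x t)) \<le> \<rho>)" and t: "t \<in> {0..R}"
    have "norm (x t - cyl (\<theta> + \<nu> * t)) \<le> (\<rho> + \<rho> * R) * exp (L * R)"
    proof (rule gronwall_local[where y = "\<lambda>t. x t - cyl (\<theta> + \<nu> * t)" and y' = "\<lambda>t. x' t - \<nu> *\<^sub>R e" and r = "r / 2"])
      fix t assume t: "t \<in> {0..R}"
      show "((\<lambda>t. x t - cyl (\<theta> + \<nu> * t)) has_vector_derivative x' t - \<nu> *\<^sub>R e) (at t within {0..R})"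
        using A t by (intro derivative_intros) (auto intro: has_vector_derivative_at_within)
      assume n: "norm (x t - cyl (\<theta> + \<nu> * t)) \<le> r / 2"
      have "norm (X (x t) - X (cyl (\<theta> + \<nu> * t))) \<le> L * norm (x t - cyl (\<theta> + \<nu> * t))"
        using n r(1) by (intro r(2)[of _ "\<theta> + \<nu> * t"]) auto
      moreover have "norm (x' t - X (x t)) \<le> \<rho>" using A t by auto
      moreover have "x' t - \<nu> *\<^sub>R e = (X (x t) - X (cyl (\<theta> + \<nu> * t))) + (x' t - X (x t))"
        by (simp add: X_cyl)
      ultimately show "norm (x' t - \<nu> *\<^sub>R e) \<le> L * norm (x t - cyl (\<theta> + \<nu> * t)) + \<rho>"
        by (metis add_mono norm_triangle_le)
    qed (use A t \<rho> \<kappa> r L_pos in \<open>auto simp: sum\<close>)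
    thus "norm (x t - cyl (\<theta> + \<nu> * t)) \<le> \<kappa>" unfolding sum using \<kappa> r by auto
  qed
qed

text \<open>
  First-order expansion of the flow in the initial point. Gronwall's inequality is applied twice:
  to the distance \<open>y\<close> from the solution on the line, and to \<open>d = y - a u\<close>, which satisfies the
  linearised equation up to an error that is small compared with \<open>y\<close>.
\<close>

lemma linear_approximation:
  "\<exists>C\<ge>0. \<forall>\<kappa>>0. \<exists>\<rho>>0. \<forall>z \<theta> a u. (\<forall>t. (z has_vector_derivative X (z t)) (at t)) \<and>
      norm (z 0 - cyl \<theta>) \<le> \<rho> \<and> (\<forall>t. (u has_vector_derivative A (u t)) (at t)) \<longrightarrow>
     (\<forall>t\<in>{0..T}. norm (z t - cyl (\<theta> + \<nu> * t) - a *\<^sub>R u t)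
        \<le> C * norm (z 0 - cyl \<theta> - a *\<^sub>R u 0) + \<kappa> * norm (z 0 - cyl \<theta>))"
proof (rule exI[of _ "exp (L * T)"], rule conjI, goal_cases)
  case 2
  show ?case
  proof (rule allI, rule impI)
    let ?C = "exp (L * T)"
    fix \<kappa> :: real assume \<kappa>: "\<kappa> > 0"
    define k where "k = \<kappa> / (T * ?C * ?C)"
    have k: "k > 0" using \<kappa> T by (simp add: k_def)
    obtain r1 where r1: "r1 > 0" "\<And>\<theta> y z. norm (y - cyl \<theta>) < r1 \<Longrightarrow> norm (z - cyl \<theta>) < r1 \<Longrightarrow> norm (X y - X z) \<le> L * norm (y - z)"
      using Lipschitz_near_cyl by metis
    obtain r2 where r2: "r2 > 0" "\<And>\<theta> y z. norm (y - cyl \<theta>) < r2 \<Longrightarrow> norm (z - cyl \<theta>) < r2 \<Longrightarrow> norm (X y - X z - A (y - z)) \<le> k * norm (y - z)"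
      using strict_cyl[OF k] by metis
    obtain \<rho> where \<rho>: "\<rho> > 0" "\<And>x x' \<theta>. norm (x 0 - cyl \<theta>) \<le> \<rho> \<and>
        (\<forall>t\<in>{0..T}. (x has_vector_derivative x' t) (at t) \<and> norm (x' t - X (x t)) \<le> \<rho>) \<Longrightarrow>
        (\<forall>t\<in>{0..T}. norm (x t - cyl (\<theta> + \<nu> * t)) \<le> min r1 r2 / 2)"
      using stays_near_cyl[of "min r1 r2 / 2" T] r1(1) r2(1) T by (auto simp del: Ball_def)
    show "\<exists>\<rho>>0. \<forall>z \<theta> a u. (\<forall>t. (z has_vector_derivative X (z t)) (at t)) \<and>
        norm (z 0 - cyl \<theta>) \<le> \<rho> \<and> (\<forall>t. (u has_vector_derivative A (u t)) (at t)) \<longrightarrow>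
       (\<forall>t\<in>{0..T}. norm (z t - cyl (\<theta> + \<nu> * t) - a *\<^sub>R u t)
          \<le> ?C * norm (z 0 - cyl \<theta> - a *\<^sub>R u 0) + \<kappa> * norm (z 0 - cyl \<theta>))"
    proof (intro exI[of _ \<rho>] conjI allI impI ballI \<rho>(1))
      fix z u :: "real \<Rightarrow> 'a" and \<theta> a t
      assume as: "(\<forall>t. (z has_vector_derivative X (z t)) (at t)) \<and>
        norm (z 0 - cyl \<theta>) \<le> \<rho> \<and> (\<forall>t. (u has_vector_derivative A (u t)) (at t))" and t: "t \<in> {0..T}"
      define y where "y = (\<lambda>t. z t - cyl (\<theta> + \<nu> * t))"
      have near: "norm (y q) \<le> min r1 r2 / 2" if "q \<in> {0..T}" for q
        using \<rho>(2)[of z \<theta> "\<lambda>t. X (z t)"] as \<rho>(1) that by (simp add: y_def)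
      have dy: "(y has_vector_derivative X (z q) - \<nu> *\<^sub>R e) (at q within Q)" for q Q
        unfolding y_def using as by (intro derivative_intros) (auto intro: has_vector_derivative_at_within)
      have ybound: "norm (y q) \<le> norm (y 0) * ?C" if q: "q \<in> {0..T}" for q
      proof -
        have "norm (y q) \<le> (norm (y 0) + 0 * q) * exp (L * q)"
        proof (rule gronwall[OF _ dy])
          fix p assume p: "p \<in> {0..q}"
          have "norm (y p) < r1" using near[of p] p q r1(1) r2(1) by auto
          thus "norm (X (z p) - \<nu> *\<^sub>R e) \<le> L * norm (y p) + 0"
            using r1(2)[of "z p" "\<theta> + \<nu> * p" "cyl (\<theta> + \<nu> * p)"] r1(1) by (simp add: y_def X_cyl)
        qed (use q L_pos in auto)
        also have "\<dots> \<le> norm (y 0) * ?C" using q L_pos by (auto intro!: mult_left_mono)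
        finally show ?thesis .
      qed
      define d where "d = (\<lambda>t. y t - a *\<^sub>R u t)"
      have dd: "(d has_vector_derivative X (z q) - \<nu> *\<^sub>R e - a *\<^sub>R A (u q)) (at q within Q)" for q Q
        unfolding d_def using as dy
        by (auto intro!: derivative_eq_intros intro: has_vector_derivative_at_within)
      have "norm (d t) \<le> (norm (d 0) + (k * (norm (y 0) * ?C)) * t) * exp (L * t)"
      proof (rule gronwall[OF _ dd])
        fix q assume q: "q \<in> {0..t}"
        have "norm (y q) < r2" using near[of q] q t r1(1) r2(1) by auto
        hence "norm (X (z q) - X (cyl (\<theta> + \<nu> * q)) - A (y q)) \<le> k * norm (y q)"
          using r2(2)[of "z q" "\<theta> + \<nu> * q" "cyl (\<theta> + \<nu> * q)"] r2(1) by (simp add: y_def)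
        also have "\<dots> \<le> k * (norm (y 0) * ?C)" using ybound[of q] q t k by (intro mult_left_mono) auto
        finally have 1: "norm (X (z q) - X (cyl (\<theta> + \<nu> * q)) - A (y q)) \<le> k * (norm (y 0) * ?C)" .
        have 2: "norm (A (d q)) \<le> L * norm (d q)"
          using order_trans[OF norm_A_le[of "d q"] mult_right_mono[of "L - 1" L "norm (d q)"]] by simp
        have "A (d q) = A (y q) - a *\<^sub>R A (u q)"
          by (simp add: d_def linear_diff[OF linear_A] linear_cmul[OF linear_A])
        hence "X (z q) - \<nu> *\<^sub>R e - a *\<^sub>R A (u q) = A (d q) + (X (z q) - X (cyl (\<theta> + \<nu> * q)) - A (y q))"
          by (simp add: X_cyl)
        thus "norm (X (z q) - \<nu> *\<^sub>R e - a *\<^sub>R A (u q)) \<le> L * norm (d q) + k * (norm (y 0) * ?C)"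
          using 1 2 by (metis add_mono norm_triangle_le)
      qed (use t L_pos k in auto)
      also have "\<dots> \<le> (norm (d 0) + (k * (norm (y 0) * ?C)) * T) * exp (L * T)"
        using t L_pos k by (intro mult_mono add_mono mult_left_mono) auto
      also have "\<dots> = ?C * norm (d 0) + \<kappa> * norm (y 0)" using T by (simp add: k_def field_simps)
      finally show "norm (z t - cyl (\<theta> + \<nu> * t) - a *\<^sub>R u t)
          \<le> ?C * norm (z 0 - cyl \<theta> - a *\<^sub>R u 0) + \<kappa> * norm (z 0 - cyl \<theta>)"
        by (simp add: d_def y_def)
    qed
  qed
qed simp

text \<open>
  Let \<open>z\<close> be the free solution with the initial point of the forced curve \<open>x\<close>, \<open>w = x - z\<close>, and
  \<open>S = B(u,w)\<close>. Skewness cancels the linear part of the derivative of \<open>S\<close> and leaves the work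
  \<open>B(u,f)\<close> of the force, up to an error small compared with \<open>w\<close>, hence with \<open>\<mu>\<close>.
  The end value is small for another reason. Both \<open>x\<close> at time \<open>T'\<close> and \<open>z\<close> at time \<open>T - s\<close> differ from
  the initial point by a multiple of \<open>e\<close>, and all velocities are almost parallel to \<open>e\<close>. So \<open>w\<close> at time
  \<open>T\<close> is \<open>a e\<close> up to an error small compared with $\mu+|s|$, and \<open>B(u,e) = 0\<close>. To see that \<open>s\<close> is itself
  of order \<open>\<mu>\<close>, note that \<open>w\<close>, hence \<open>a\<close>, is of order \<open>\<mu>\<close>, whereas \<open>a\<close> is \<open>- s \<nu>\<close> plus terms of order
  \<open>\<mu>\<close> plus a multiple of $2\pi$; the latter vanishes because everything else is small.
\<close>

lemma small_drift:
  assumes \<eta>: "\<eta> > 0" and D: "D \<ge> 0" and F: "F \<ge> 0" and M: "M \<ge> 0"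
  shows "\<exists>\<rho>>0. \<forall>x f u \<theta> \<mu> T' \<alpha> (m::int).
     0 < \<mu> \<and> \<mu> \<le> \<rho> \<and> norm (x 0 - cyl \<theta>) \<le> \<rho> \<and>
     (\<forall>t. (x has_vector_derivative X (x t) + f t) (at t)) \<and> (\<forall>t. norm (f t) \<le> F * \<mu>) \<and>
     (\<forall>t. (u has_vector_derivative A (u t)) (at t)) \<and> (\<forall>t\<in>{0..T}. norm (u t) \<le> M \<and> B (u t) e = 0) \<and>
     \<bar>T' - T\<bar> \<le> D * \<mu> \<and> \<bar>\<alpha>\<bar> \<le> D * \<mu> \<and> x T' = x 0 + (\<alpha> + 2 * pi * of_int m) *\<^sub>R e \<longrightarrow>
     (\<forall>t\<in>{0..T}. norm (x t - cyl (\<theta> + \<nu> * t)) \<le> \<eta>) \<and>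
     (\<exists>S S'. S 0 = 0 \<and> \<bar>S T\<bar> \<le> \<eta> * \<mu> \<and>
       (\<forall>t\<in>{0..T}. (S has_real_derivative S' t) (at t) \<and> \<bar>S' t - B (u t) (f t)\<bar> \<le> \<eta> * \<mu>))"
proof -
  interpret B: bounded_bilinear B by (rule bilinear_B)
  obtain K where K: "K > 0" "\<And>a b. norm (B a b) \<le> norm a * norm b * K" using B.pos_bounded by blast
  define N where "N = \<bar>\<nu>\<bar>"
  have N: "N > 0" using nu by (simp add: N_def)
  (* C bounds w / mu, C3 bounds s / mu, k bounds the deviation of the velocities from nu e, and k1 is
     the error of the linearisation. *)
  define C where "C = F * (2 * T) * exp (L * (2 * T))"
  have C: "C \<ge> 0" using F T by (simp add: C_def)
  define C3 where "C3 = 2 * (C + 2 * D + D * N) / N"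
  have C3: "C3 \<ge> 0" using C D N by (simp add: C3_def)
  define k where "k = min (min 1 (N / 2)) (\<eta> / (K * M * (D + C3) + 1))"
  have pos1: "K * M * (D + C3) + 1 > 0" using K M D C3 by (intro add_nonneg_pos) auto
  have k: "k > 0" "k \<le> 1" "k \<le> N / 2" "K * M * (D + C3) * k \<le> \<eta>"
  proof -
    show "k > 0" "k \<le> 1" using \<eta> N pos1 by (auto simp: k_def)
    show "k \<le> N / 2" unfolding k_def by (intro min.coboundedI1 min.cobounded2)
    have "k \<le> \<eta> / (K * M * (D + C3) + 1)" by (simp add: k_def)
    hence "(K * M * (D + C3) + 1) * k \<le> \<eta>" using pos1 by (simp add: field_simps)
    thus "K * M * (D + C3) * k \<le> \<eta>" using \<open>k > 0\<close> by (simp add: algebra_simps)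
  qed
  define k1 where "k1 = \<eta> / (K * M * C + 1)"
  have pos2: "K * M * C + 1 > 0" using K M C by (intro add_nonneg_pos) auto
  have k1: "k1 > 0" "K * M * C * k1 \<le> \<eta>"
  proof -
    show "k1 > 0" using \<eta> pos2 by (simp add: k1_def)
    have "(K * M * C + 1) * k1 = \<eta>" using pos2 by (simp add: k1_def)
    thus "K * M * C * k1 \<le> \<eta>" using \<open>k1 > 0\<close> by (simp add: algebra_simps)
  qed
  obtain r1 where r1: "r1 > 0" "\<And>\<theta> y z. norm (y - cyl \<theta>) < r1 \<Longrightarrow> norm (z - cyl \<theta>) < r1 \<Longrightarrow> norm (X y - X z - A (y - z)) \<le> k1 * norm (y - z)"
    using strict_cyl[OF k1(1)] by metis
  obtain rl where rl: "rl > 0" "\<And>\<theta> y z. norm (y - cyl \<theta>) < rl \<Longrightarrow> norm (z - cyl \<theta>) < rl \<Longrightarrow> norm (X y - X z) \<le> L * norm (y - z)"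
    using Lipschitz_near_cyl by metis
  define k2 where "k2 = min (min (r1 / 2) (rl / 2)) (min \<eta> (k / (2 * L)))"
  have k2: "k2 > 0" "k2 < r1" "k2 < rl" "k2 \<le> \<eta>" "L * k2 \<le> k / 2"
  proof -
    show "k2 > 0" "k2 < r1" "k2 < rl" "k2 \<le> \<eta>" using r1(1) rl(1) \<eta> k L_pos by (auto simp: k2_def)
    have "k2 \<le> k / (2 * L)" by (simp add: k2_def)
    thus "L * k2 \<le> k / 2" using L_pos by (simp add: field_simps)
  qed
  obtain \<rho>1 where \<rho>1: "\<rho>1 > 0" "\<And>x x' \<theta>. norm (x 0 - cyl \<theta>) \<le> \<rho>1 \<and>
      (\<forall>t\<in>{0..2*T}. (x has_vector_derivative x' t) (at t) \<and> norm (x' t - X (x t)) \<le> \<rho>1) \<Longrightarrow>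
      (\<forall>t\<in>{0..2*T}. norm (x t - cyl (\<theta> + \<nu> * t)) \<le> k2)"
    using stays_near_cyl[OF k2(1), of "2 * T"] T by (auto simp del: Ball_def)
  (* s must be at most T for T - s to lie in {0..2T}, and s nu at most 1 to exclude a full turn. *)
  define ks where "ks = min T (1 / N)"
  have ks: "ks > 0" "ks \<le> T" "ks * N \<le> 1" using T N by (auto simp: ks_def min_def field_simps)
  obtain \<rho>2 where \<rho>2: "\<rho>2 > 0" "\<And>\<theta> y. norm (y - cyl \<theta>) < \<rho>2 \<Longrightarrow>
      (\<exists>z s (n::int). (\<forall>t. (z has_vector_derivative X (z t)) (at t)) \<and> z 0 = y \<and> \<bar>s\<bar> \<le> ks \<and>
         z (T - s) = y + (2 * pi * of_int n) *\<^sub>R e)"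
    using almost_periodic[OF ks(1)] unfolding cyl_def by metis
  define \<rho> where "\<rho> = min (min (\<rho>1 / (F + 1)) (\<rho>2 / 2)) (min (min (k / (2 * (F + 1))) (T / (D + 1)))
     (min (min (1 / ((D + 1) * (1 + N))) (1 / (C + 1))) \<rho>1))"
  have \<rho>: "\<rho> > 0" using \<rho>1 \<rho>2 F k T D N C by (simp add: \<rho>_def)
  have pp: "p * \<rho> \<le> q" if "\<rho> \<le> q / (p + 1)" "p \<ge> 0" for p q
  proof -
    have "(p + 1) * \<rho> \<le> q" using that by (simp add: field_simps)
    thus ?thesis using \<rho> by (simp add: algebra_simps)
  qed
  have le: "\<rho> \<le> \<rho>1 / (F + 1)" "\<rho> \<le> \<rho>2 / 2" "\<rho> \<le> k / 2 / (F + 1)" "\<rho> \<le> T / (D + 1)"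
    "\<rho> \<le> 1 / (1 + N) / (D + 1)" "\<rho> \<le> 1 / (C + 1)" "\<rho> \<le> \<rho>1"
    by (simp_all add: \<rho>_def mult.commute)
  have \<rho>': "F * \<rho> \<le> \<rho>1" "\<rho> < \<rho>2" "F * \<rho> \<le> k / 2" "D * \<rho> \<le> T" "C * \<rho> \<le> 1" "\<rho> \<le> \<rho>1"
    using pp[OF le(1) F] pp[OF le(3) F] pp[OF le(4) D] pp[OF le(6) C] le(2,7) \<rho>2(1) by simp_all
  have "(1 + N) * (D * \<rho>) \<le> 1" using pp[OF le(5) D] N by (simp add: field_simps)
  hence \<rho>'': "D * \<rho> + D * \<rho> * N \<le> 1" by (simp add: algebra_simps)
  show ?thesis
  proof (intro exI[of _ \<rho>] conjI[OF \<rho>] allI impI)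
    fix x f u :: "real \<Rightarrow> 'a" and \<theta> \<mu> T' \<alpha> and m :: int
    assume as: "0 < \<mu> \<and> \<mu> \<le> \<rho> \<and> norm (x 0 - cyl \<theta>) \<le> \<rho> \<and>
     (\<forall>t. (x has_vector_derivative X (x t) + f t) (at t)) \<and> (\<forall>t. norm (f t) \<le> F * \<mu>) \<and>
     (\<forall>t. (u has_vector_derivative A (u t)) (at t)) \<and> (\<forall>t\<in>{0..T}. norm (u t) \<le> M \<and> B (u t) e = 0) \<and>
     \<bar>T' - T\<bar> \<le> D * \<mu> \<and> \<bar>\<alpha>\<bar> \<le> D * \<mu> \<and> x T' = x 0 + (\<alpha> + 2 * pi * of_int m) *\<^sub>R e"
    hence \<mu>: "0 < \<mu>" "\<mu> \<le> \<rho>" by auto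
    have f: "norm (f t) \<le> F * \<mu>" for t using as by blast
    have dx: "(x has_vector_derivative X (x t) + f t) (at t within Q)" for t Q
      using as by (auto intro: has_vector_derivative_at_within)
    have du: "(u has_vector_derivative A (u t)) (at t)" for t using as by blast
    have u: "norm (u t) \<le> M" "B (u t) e = 0" if "t \<in> {0..T}" for t using as that by auto
    have per: "\<bar>T' - T\<bar> \<le> D * \<mu>" "\<bar>\<alpha>\<bar> \<le> D * \<mu>" "x T' = x 0 + (\<alpha> + 2 * pi * of_int m) *\<^sub>R e"
      using as by auto
    have m: "F * \<mu> \<le> F * \<rho>" "D * \<mu> \<le> D * \<rho>" "C * \<mu> \<le> C * \<rho>" "D * \<mu> * N \<le> D * \<rho> * N"
      using \<mu> F D C N by (auto intro!: mult_left_mono mult_right_mono)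
    have "norm (x 0 - cyl \<theta>) < \<rho>2" using as \<rho>'(2) by auto
    then obtain z s and n :: int where z: "\<And>t. (z has_vector_derivative X (z t)) (at t)" "z 0 = x 0"
      and s: "\<bar>s\<bar> \<le> ks" and zs: "z (T - s) = x 0 + (2 * pi * of_int n) *\<^sub>R e"
      using \<rho>2(2) by metis
    have dz: "(z has_vector_derivative X (z t)) (at t within Q)" for t Q
      using z(1) by (auto intro: has_vector_derivative_at_within)
    have xnear: "norm (x t - cyl (\<theta> + \<nu> * t)) \<le> k2" if "t \<in> {0..2*T}" for t
    proof -
      have "norm (f q) \<le> \<rho>1" for q using f[of q] m \<rho>' by simp
      thus ?thesis using \<rho>1(2)[of x \<theta> "\<lambda>t. X (x t) + f t"] dx as \<rho>'(6) that by auto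
    qed
    have znear: "norm (z t - cyl (\<theta> + \<nu> * t)) \<le> k2" if "t \<in> {0..2*T}" for t
      using \<rho>1(2)[of z \<theta> "\<lambda>t. X (z t)"] dz z(2) as \<rho>'(6) \<rho>1(1) that by auto
    have velocity: "norm (X y - \<nu> *\<^sub>R e) \<le> k / 2" if "norm (y - cyl q) \<le> k2" for y q
    proof -
      have "norm (X y - X (cyl q)) \<le> L * norm (y - cyl q)" using that k2 rl(1) by (intro rl(2)[of _ q]) auto
      also have "\<dots> \<le> L * k2" using that L_pos by (intro mult_left_mono) auto
      finally show ?thesis using k2(5) by (simp add: X_cyl)
    qed
    define w where "w = (\<lambda>t. x t - z t)"
    have dw: "(w has_vector_derivative X (x t) + f t - X (z t)) (at t within Q)" for t Q
      unfolding w_def by (intro derivative_intros dx dz)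
    have w: "norm (w t) \<le> C * \<mu>" if t: "t \<in> {0..2*T}" for t
    proof -
      have "norm (w t) \<le> (0 + (F * \<mu>) * t) * exp (L * t)"
      proof (rule gronwall[OF _ dw])
        fix q assume q: "q \<in> {0..t}"
        have "norm (X (x q) - X (z q)) \<le> L * norm (w q)"
          unfolding w_def using xnear[of q] znear[of q] q t k2 by (intro rl(2)[of _ "\<theta> + \<nu> * q"]) auto
        moreover have "X (x q) + f q - X (z q) = (X (x q) - X (z q)) + f q" by simp
        ultimately show "norm (X (x q) + f q - X (z q)) \<le> L * norm (w q) + F * \<mu>"
          using f[of q] by (metis add_mono norm_triangle_le)
      qed (use t F \<mu> L_pos z(2) in \<open>auto simp: w_def\<close>)
      also have "\<dots> \<le> (0 + (F * \<mu>) * (2 * T)) * exp (L * (2 * T))"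
        using t F \<mu> L_pos by (intro mult_mono add_mono) auto
      finally show ?thesis by (simp add: C_def algebra_simps)
    qed
    define S where "S = (\<lambda>t. B (u t) (w t))"
    define S' where "S' = (\<lambda>t. B (u t) (X (x t) + f t - X (z t)) + B (A (u t)) (w t))"
    have dS: "(S has_real_derivative S' t) (at t)" for t
      unfolding S_def S'_def has_real_derivative_iff_has_vector_derivative
      by (rule B.has_vector_derivative[OF du dw])
    have S'bound: "\<bar>S' t - B (u t) (f t)\<bar> \<le> \<eta> * \<mu>" if t: "t \<in> {0..T}" for t
    proof -
      have "S' t - B (u t) (f t) = B (u t) (X (x t) - X (z t) - A (w t)) + (B (u t) (A (w t)) + B (A (u t)) (w t))"
        by (simp add: S'_def B.add_right B.diff_right)
      also have "\<dots> = B (u t) (X (x t) - X (z t) - A (w t))" using skew[of "u t" "w t"] by simp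
      finally have "\<bar>S' t - B (u t) (f t)\<bar> \<le> norm (u t) * norm (X (x t) - X (z t) - A (w t)) * K"
        using K(2) by (metis real_norm_def)
      also have "\<dots> \<le> M * (k1 * (C * \<mu>)) * K"
      proof (intro mult_right_mono mult_mono)
        have "norm (X (x t) - X (z t) - A (w t)) \<le> k1 * norm (w t)"
          unfolding w_def using xnear[of t] znear[of t] t k2 by (intro r1(2)[of _ "\<theta> + \<nu> * t"]) auto
        also have "\<dots> \<le> k1 * (C * \<mu>)" using w[of t] t k1 by (intro mult_left_mono) auto
        finally show "norm (X (x t) - X (z t) - A (w t)) \<le> k1 * (C * \<mu>)" .
      qed (use u[OF t] M K in auto)
      also have "\<dots> = (K * M * C * k1) * \<mu>" by simp
      also have "\<dots> \<le> \<eta> * \<mu>" using k1 \<mu> by (intro mult_right_mono) auto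
      finally show ?thesis .
    qed
    define e2 where "e2 = x T - x T' - ((T - T') * \<nu>) *\<^sub>R e"
    define e3 where "e3 = z T - z (T - s) - (s * \<nu>) *\<^sub>R e"
    have TT: "T \<in> {0..2*T}" "T' \<in> {0..2*T}" "T - s \<in> {0..2*T}"
      using T per(1) m(2) \<rho>'(4) s ks by auto
    have e2: "norm e2 \<le> k * \<bar>T - T'\<bar>"
    proof -
      have "norm ((x T - (T * \<nu>) *\<^sub>R e) - (x T' - (T' * \<nu>) *\<^sub>R e)) \<le> k * \<bar>T - T'\<bar>"
      proof (rule vector_mvt_bound[OF _ _ TT(1,2)])
        fix q assume q: "q \<in> {0..2*T}"
        show "((\<lambda>q. x q - (q * \<nu>) *\<^sub>R e) has_vector_derivative (X (x q) + f q) - \<nu> *\<^sub>R e) (at q within {0..2*T})"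
          by (intro derivative_intros dx) (auto intro!: derivative_eq_intros simp: has_vector_derivative_def)
        have "X (x q) + f q - \<nu> *\<^sub>R e = (X (x q) - \<nu> *\<^sub>R e) + f q" by simp
        moreover have "norm (X (x q) - \<nu> *\<^sub>R e) \<le> k / 2" by (rule velocity[OF xnear[OF q]])
        moreover have "norm (f q) \<le> k / 2" using f[of q] m \<rho>' by simp
        ultimately show "norm (X (x q) + f q - \<nu> *\<^sub>R e) \<le> k"
          by (metis add_mono field_sum_of_halves norm_triangle_le)
      qed
      thus ?thesis by (simp add: e2_def algebra_simps)
    qed
    have e3: "norm e3 \<le> k * \<bar>s\<bar>"
    proof -
      have "norm ((z T - (T * \<nu>) *\<^sub>R e) - (z (T - s) - ((T - s) * \<nu>) *\<^sub>R e)) \<le> k * \<bar>T - (T - s)\<bar>"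
      proof (rule vector_mvt_bound[OF _ _ TT(1,3)])
        fix q assume q: "q \<in> {0..2*T}"
        show "((\<lambda>q. z q - (q * \<nu>) *\<^sub>R e) has_vector_derivative X (z q) - \<nu> *\<^sub>R e) (at q within {0..2*T})"
          by (intro derivative_intros dz) (auto intro!: derivative_eq_intros simp: has_vector_derivative_def)
        show "norm (X (z q) - \<nu> *\<^sub>R e) \<le> k" using velocity[OF znear[OF q]] k(1) by simp
      qed
      thus ?thesis by (simp add: e3_def algebra_simps)
    qed
    define a where "a = \<alpha> + 2 * pi * of_int (m - n) + (T - T') * \<nu> - s * \<nu>"
    have wT: "w T = a *\<^sub>R e + (e2 - e3)"
      unfolding w_def a_def e2_def e3_def per(3) zs by (simp add: algebra_simps)
    have e23: "norm (e2 - e3) \<le> k * \<bar>T - T'\<bar> + k * \<bar>s\<bar>"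
      using e2 e3 norm_triangle_ineq4[of e2 e3] by simp
    have abs_a: "\<bar>a\<bar> \<le> C * \<mu> + (k * \<bar>T - T'\<bar> + k * \<bar>s\<bar>)"
    proof -
      have "\<bar>a\<bar> = norm (w T - (e2 - e3))" by (simp add: wT norm_e)
      also have "\<dots> \<le> norm (w T) + norm (e2 - e3)" by (rule norm_triangle_ineq4)
      finally show ?thesis using w[OF TT(1)] e23 by simp
    qed
    have dT: "\<bar>T - T'\<bar> \<le> D * \<mu>" using per(1) by simp
    have kT: "k * \<bar>T - T'\<bar> \<le> D * \<mu>" using mult_mono[OF k(2) dT] k D \<mu> by simp
    have ksn: "k * \<bar>s\<bar> \<le> \<bar>s\<bar> * N / 2" using mult_right_mono[OF k(3), of "\<bar>s\<bar>"] by (simp add: mult.commute)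
    have sN: "\<bar>s\<bar> * N \<le> 1" using order_trans[OF mult_right_mono[OF s, of N] ks(3)] N by simp
    have TN: "\<bar>(T - T') * \<nu>\<bar> \<le> D * \<mu> * N" unfolding abs_mult N_def using dT by (intro mult_right_mono) auto
    have sN': "\<bar>s * \<nu>\<bar> = \<bar>s\<bar> * N" by (simp add: abs_mult N_def)
    (* The number a and the terms of its definition other than 2 pi (m - n) add up to less than 6 in
       absolute value, and 2 pi exceeds 6. *)
    have mn: "m = n"
    proof (rule ccontr)
      assume "m \<noteq> n"
      hence "\<bar>real_of_int (m - n)\<bar> \<ge> 1" by linarith
      hence "2 * pi * 1 \<le> 2 * pi * \<bar>real_of_int (m - n)\<bar>" by (intro mult_left_mono) auto
      also have "\<dots> = \<bar>2 * pi * of_int (m - n)\<bar>" by (simp add: abs_mult)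
      finally have "6 < \<bar>2 * pi * of_int (m - n)\<bar>" using pi_gt3 by linarith
      moreover have "2 * pi * of_int (m - n) = a - \<alpha> - (T - T') * \<nu> + s * \<nu>" by (simp add: a_def)
      moreover have "C * \<mu> \<le> 1" "D * \<mu> + D * \<mu> * N \<le> 1" "D * \<mu> * N \<ge> 0" using m \<rho>'(5) \<rho>'' D \<mu> N by auto
      ultimately show False using abs_a kT ksn sN TN sN' per(2) by linarith
    qed
    have sbound: "\<bar>s\<bar> \<le> C3 * \<mu>"
    proof -
      have "s * \<nu> = \<alpha> + (T - T') * \<nu> - a" by (simp add: a_def mn)
      hence "\<bar>s\<bar> * N \<le> D * \<mu> + D * \<mu> * N + (C * \<mu> + (D * \<mu> + \<bar>s\<bar> * N / 2))"
        using abs_a kT ksn TN sN' per(2) by linarith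
      hence "\<bar>s\<bar> * N \<le> 2 * (C + 2 * D + D * N) * \<mu>" by (simp add: algebra_simps)
      thus ?thesis using N by (simp add: C3_def field_simps)
    qed
    have ST: "\<bar>S T\<bar> \<le> \<eta> * \<mu>"
    proof -
      have "T \<in> {0..T}" using T by simp
      note uT = u[OF this]
      have "S T = B (u T) (e2 - e3)" by (simp add: S_def wT B.add_right B.scaleR_right uT(2))
      hence "\<bar>S T\<bar> \<le> norm (u T) * norm (e2 - e3) * K" using K(2) by (metis real_norm_def)
      also have "\<dots> \<le> M * (k * (D * \<mu>) + k * (C3 * \<mu>)) * K"
      proof (intro mult_right_mono mult_mono)
        show "norm (e2 - e3) \<le> k * (D * \<mu>) + k * (C3 * \<mu>)"
          by (rule order_trans[OF e23]) (intro add_mono mult_left_mono dT sbound; use k in simp)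
      qed (use uT M K in auto)
      also have "\<dots> = (K * M * (D + C3) * k) * \<mu>" by (simp add: algebra_simps)
      also have "\<dots> \<le> \<eta> * \<mu>" using k \<mu> by (intro mult_right_mono) auto
      finally show ?thesis .
    qed
    show "(\<forall>t\<in>{0..T}. norm (x t - cyl (\<theta> + \<nu> * t)) \<le> \<eta>) \<and>
     (\<exists>S S'. S 0 = 0 \<and> \<bar>S T\<bar> \<le> \<eta> * \<mu> \<and>
       (\<forall>t\<in>{0..T}. (S has_real_derivative S' t) (at t) \<and> \<bar>S' t - B (u t) (f t)\<bar> \<le> \<eta> * \<mu>))"
    proof (rule conjI[OF _ exI[of _ S, OF exI[of _ S']]], goal_cases)
      case 1
      show ?case
      proof
        fix t assume t: "t \<in> {0..T}"
        show "norm (x t - cyl (\<theta> + \<nu> * t)) \<le> \<eta>" using xnear[of t] t T k2(4) by simp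
      qed
    next
      case 2
      show ?case
      proof (intro conjI ballI)
      fix t assume t: "t \<in> {0..T}"
      show "(S has_real_derivative S' t) (at t)" by (rule dS)
      show "\<bar>S' t - B (u t) (f t)\<bar> \<le> \<eta> * \<mu>" by (rule S'bound[OF t])
      qed (use ST z(2) in \<open>auto simp: S_def w_def B.zero_right\<close>)
    qed
  qed
qed

end

section \<open>One factor of the phase space\<close>

lemma fun1_cover1: "fun1 h \<circ> cover1 = h \<circ> snd"
  by (auto simp: fun1_def cover1_def fun_eq_iff)

lemma Basis_real3: "(Basis :: (real \<times> real \<times> real) set) = {(1,0,0), (0,1,0), (0,0,1)}"
  by (auto simp: Basis_prod_def zero_prod_def image_Un)

lemma Basis_coord1: "(Basis :: coord1 set) = {(1,0,0,0), (0,1,0,0), (0,0,1,0), (0,0,0,1)}"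
  by (auto simp: Basis_prod_def zero_prod_def image_Un)

lemma pd_real3:
  assumes "g differentiable (at (x :: real \<times> real \<times> real))"
  shows "pd (a, b, c) g x = a * pd (1,0,0) g x + b * pd (0,1,0) g x + c * pd (0,0,1) g x"
  unfolding pd_Basis_sum[OF assms, of "(a,b,c)"] Basis_real3 by simp

lemma bounded_bilinear_om1: "bounded_bilinear om1"
  unfolding bilinear_conv_bounded_bilinear[symmetric]
  by (auto simp: bilinear_def om1_def linear_iff split_beta algebra_simps)

definition ham_field :: "(real \<times> real \<times> real \<Rightarrow> real) \<Rightarrow> coord1 \<Rightarrow> coord1" where
  "ham_field h y = (pd (1,0,0) h (snd y), 0, pd (0,0,1) h (snd y), - pd (0,1,0) h (snd y))"

lemma pd_fun1:
  assumes "h differentiable (at (snd y))"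
  shows "pd u (fun1 h \<circ> cover1) y = pd (snd u) h (snd y)"
  unfolding fun1_cover1 by (rule pd_linear_compose(1)[OF bounded_linear_snd assms])

lemma om1_ham_field:
  assumes "h differentiable (at (snd y))"
  shows "om1 u (ham_field h y) = pd u (fun1 h \<circ> cover1) y"
proof -
  obtain a b c d where u: "u = (a, b, c, d)" by (metis prod.exhaust)
  show ?thesis unfolding pd_fun1[OF assms] u
    by (simp add: om1_def ham_field_def pd_real3[OF assms, of b c d] algebra_simps)
qed

lemma om1_eqI:
  assumes "\<And>u. u \<in> Basis \<Longrightarrow> om1 u v = om1 u w" shows "v = w"
proof -
  obtain a b c d where v: "v = (a, b, c, d)" by (metis prod.exhaust)
  obtain a' b' c' d' where w: "w = (a', b', c', d')" by (metis prod.exhaust)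
  show ?thesis using assms[of "(1,0,0,0)"] assms[of "(0,1,0,0)"] assms[of "(0,0,1,0)"] assms[of "(0,0,0,1)"]
    by (simp add: v w om1_def Basis_coord1)
qed

lemma cover1_eq_iff:
  "cover1 x = cover1 y \<longleftrightarrow> (\<exists>n::int. x = y + (2 * pi * of_int n) *\<^sub>R (1,0,0,0))"
proof -
  obtain a p where x: "x = (a, p)" by (rule prod.exhaust)
  obtain b q where y: "y = (b, q)" by (rule prod.exhaust)
  have "cis a = cis b \<longleftrightarrow> (\<exists>n::int. a = b + 2 * pi * of_int n)"
  proof
    assume "cis a = cis b"
    hence "cos a = cos b \<and> sin a = sin b" by (simp add: complex_eq_iff)
    thus "\<exists>n::int. a = b + 2 * pi * of_int n" using sin_cos_eq_iff[of a b] by (auto simp: ac_simps)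
  next
    assume "\<exists>n::int. a = b + 2 * pi * of_int n"
    then obtain n :: int where "a = b + 2 * pi * of_int n" ..
    thus "cis a = cis b" by (simp add: cis_mult[symmetric])
  qed
  thus ?thesis by (cases p; cases q) (auto simp: x y cover1_def)
qed

lemma norm_quadruple_le: "norm (a, b, c, d) \<le> norm a + norm b + norm c + norm d"
  using norm_Pair_le[of a "(b, c, d)"] norm_Pair_le[of b "(c, d)"] norm_Pair_le[of c d] by simp

lemma differentiable_at_of_smooth: "smooth_on S f \<Longrightarrow> x \<in> S \<Longrightarrow> f differentiable (at x)"
  unfolding smooth_on_def by (metis Ck_on.simps(2))

definition ham_domain :: "real set \<Rightarrow> (real \<times> real \<times> real) set" where
  "ham_domain J = J \<times> UNIV \<times> UNIV"

text \<open>
  One factor of the phase space together with a circle of relative equilibria \<open>(I\<^sub>0, 0, 0)\<close>.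
\<close>

locale factor =
  fixes J :: "real set" and h :: "real \<times> real \<times> real \<Rightarrow> real" and \<tau> :: "real \<Rightarrow> real" and I\<^sub>0 :: real
  assumes open_J: "open J" and I0: "I\<^sub>0 \<in> J" and smooth: "smooth_on (J \<times> UNIV \<times> UNIV) h"
    and all_periodic: "all_periodic J h \<tau>" and nondegenerate: "nondegenerate J h \<tau>"
begin

abbreviation "W \<equiv> ham_domain J"
definition "p\<^sub>0 = (I\<^sub>0, 0::real, 0::real)"
definition "hI = pd (1,0,0) h"
definition "hq = pd (0,1,0) h"
definition "hp = pd (0,0,1) h"

lemma open_W: "open W" by (auto simp: ham_domain_def intro: open_Times open_J)
lemma p0_W: "p\<^sub>0 \<in> W" by (simp add: ham_domain_def p\<^sub>0_def I0)
lemma h_diff: "p \<in> W \<Longrightarrow> h differentiable (at p)" using differentiable_at_of_smooth[OF smooth] by (simp add: ham_domain_def)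
lemma h_C2: "Ck_on 2 W h" using smooth by (simp add: smooth_on_def ham_domain_def)
lemma h_C1: "Ck_on 1 W hI" "Ck_on 1 W hq" "Ck_on 1 W hp"
  using h_C2 by (auto simp: numeral_2_eq_2 hI_def hq_def hp_def Basis_real3)
lemma h_diff2: "p \<in> W \<Longrightarrow> hI differentiable (at p)" "p \<in> W \<Longrightarrow> hq differentiable (at p)" "p \<in> W \<Longrightarrow> hp differentiable (at p)"
  using h_C1 by auto

lemma tau_nonzero: "p \<in> W \<Longrightarrow> \<tau> (h p) \<noteq> 0"
  using all_periodic unfolding all_periodic_def
proof -
  assume p: "p \<in> W"
  have f: "fun1 h (1, p) = h p" by (simp add: fun1_def split_beta)
  have "(1, p) \<in> phase_space1 J" using p by (cases p) (auto simp: ham_domain_def phase_space1_def)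
  thus ?thesis using all_periodic f unfolding all_periodic_def by metis
qed

lemma on_cylinder:
  assumes "I \<in> J"
  shows "hI (I, 0, 0) = freq h \<tau> I" "hq (I, 0, 0) = 0" "hp (I, 0, 0) = 0"
    "pd (0,1,0) hq (I,0,0) * pd (0,0,1) hp (I,0,0) - pd (0,1,0) hp (I,0,0) * pd (0,0,1) hq (I,0,0) = (freq h \<tau> I)\<^sup>2"
  using nondegenerate assms unfolding nondegenerate_def Let_def hI_def hq_def hp_def by auto

lemma freq_nonzero: "freq h \<tau> I\<^sub>0 \<noteq> 0"
  using tau_nonzero[OF p0_W] by (simp add: freq_def p\<^sub>0_def)

text \<open>
  The circles of relative equilibria fill a cylinder, on which \<open>hq\<close> and \<open>hp\<close> vanish; this determines
  the mixed second derivatives of \<open>h\<close>.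
\<close>

lemma pd_I_zero:
  assumes "g differentiable (at p\<^sub>0)" "\<And>I. I \<in> J \<Longrightarrow> g (I, 0, 0) = 0"
  shows "pd (1,0,0) g p\<^sub>0 = 0"
proof -
  have d: "((\<lambda>I. (I, 0::real, 0::real)) has_derivative (\<lambda>t. (t, 0, 0))) (at I\<^sub>0)"
    by (auto intro!: derivative_eq_intros simp: zero_prod_def)
  have "((\<lambda>I. g (I, 0, 0)) has_derivative (\<lambda>t. pd (t,0,0) g p\<^sub>0)) (at I\<^sub>0)"
    using has_derivative_compose[OF d has_derivative_pd[of g]] assms(1) by (simp add: p\<^sub>0_def)
  moreover have "((\<lambda>I. g (I, 0, 0)) has_derivative (\<lambda>t. 0)) (at I\<^sub>0)"
    by (subst has_derivative_cong_open[OF open_J I0, where g = "\<lambda>_. 0"]) (auto simp: assms(2))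
  ultimately have "(\<lambda>t. pd (t,0,0) g p\<^sub>0) = (\<lambda>t. 0)" by (rule has_derivative_unique)
  thus ?thesis by meson
qed

lemma second_derivatives:
  "pd (1,0,0) hq p\<^sub>0 = 0" "pd (1,0,0) hp p\<^sub>0 = 0" "pd (0,1,0) hI p\<^sub>0 = 0" "pd (0,0,1) hI p\<^sub>0 = 0"
  "pd (0,0,1) hq p\<^sub>0 = pd (0,1,0) hp p\<^sub>0"
proof -
  show 1: "pd (1,0,0) hq p\<^sub>0 = 0" "pd (1,0,0) hp p\<^sub>0 = 0"
    using pd_I_zero h_diff2 p0_W on_cylinder by auto
  have c: "pd u (pd v h) p\<^sub>0 = pd v (pd u h) p\<^sub>0" if "u \<in> Basis" "v \<in> Basis" for u v
    by (rule pd_commute[OF open_W p0_W h_C2 that])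
  show "pd (0,1,0) hI p\<^sub>0 = 0" "pd (0,0,1) hI p\<^sub>0 = 0"
    using 1 c[of "(0,1,0)" "(1,0,0)"] c[of "(0,0,1)" "(1,0,0)"] by (auto simp: hI_def hq_def hp_def Basis_real3)
  show "pd (0,0,1) hq p\<^sub>0 = pd (0,1,0) hp p\<^sub>0"
    using c[of "(0,0,1)" "(0,1,0)"] by (auto simp: hq_def hp_def Basis_real3)
qed

text \<open>
  The derivative of the Hamiltonian vector field at the points of the circle.
\<close>

definition Lin :: "coord1 \<Rightarrow> coord1" where
  "Lin u = (pd (snd u) hI p\<^sub>0, 0, pd (snd u) hp p\<^sub>0, - pd (snd u) hq p\<^sub>0)"

lemma Lin_eq: "Lin (a, b, c, d) =
   (b * pd (1,0,0) hI p\<^sub>0, 0, c * pd (0,1,0) hp p\<^sub>0 + d * pd (0,0,1) hp p\<^sub>0, - (c * pd (0,1,0) hq p\<^sub>0 + d * pd (0,1,0) hp p\<^sub>0))"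
  unfolding Lin_def
  using pd_real3[OF h_diff2(1)[OF p0_W], of b c d] pd_real3[OF h_diff2(2)[OF p0_W], of b c d]
    pd_real3[OF h_diff2(3)[OF p0_W], of b c d] by (simp add: second_derivatives)

lemma linear_Lin: "linear Lin"
  by (rule linearI) (auto simp: Lin_eq algebra_simps)

lemma skew_Lin: "om1 (Lin u) w + om1 u (Lin w) = 0"
  by (cases u; cases w) (auto simp: Lin_eq om1_def algebra_simps)

text \<open>
  On vectors without \<open>I\<close>-component the linearisation acts in the \<open>(q, p)\<close>-plane as the standard
  symplectic matrix times the Hessian of \<open>h\<close>. This product has trace \<open>0\<close>, and nondegeneracy says that its
  determinant is the square of the frequency of the circle; the Cayley-Hamilton theorem gives the claim.
\<close>

lemma Lin_cube:
  assumes "om1 u (1,0,0,0) = 0"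
  shows "Lin (Lin (Lin u)) = - ((freq h \<tau> I\<^sub>0)\<^sup>2) *\<^sub>R Lin u"
proof -
  obtain a b c d where u: "u = (a, b, c, d)" by (metis prod.exhaust)
  have b: "b = 0" using assms by (simp add: u om1_def)
  have 1: "(freq h \<tau> I\<^sub>0)\<^sup>2 = pd (0,1,0) hq p\<^sub>0 * pd (0,0,1) hp p\<^sub>0 - pd (0,1,0) hp p\<^sub>0 * pd (0,1,0) hp p\<^sub>0"
    using on_cylinder(4)[OF I0] second_derivatives(5) by (simp add: p\<^sub>0_def)
  show ?thesis unfolding 1 u b by (simp add: Lin_eq algebra_simps)
qed

lemma om1_Lin: "om1 (Lin u) (1,0,0,0) = 0"
  by (cases u) (simp add: Lin_eq om1_def)

text \<open>
  The period \<open>\<tau>\<close> is just some function of the energy, but on the cylinder of relative equilibria it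
  equals $2\pi/\partial_Ih$, which is continuous. As \<open>h\<close> is strictly monotone in \<open>I\<close> at \<open>I\<^sub>0\<close>, each
  value of \<open>h\<close> close to \<open>p\<^sub>0\<close> is also attained on a circle of the cylinder near \<open>I\<^sub>0\<close>.
\<close>

lemma period_continuous:
  assumes \<kappa>: "\<kappa> > 0"
  shows "\<exists>\<rho>>0. \<forall>p. norm (p - p\<^sub>0) < \<rho> \<longrightarrow> p \<in> W \<and> \<bar>\<tau> (h p) - \<tau> (h p\<^sub>0)\<bar> \<le> \<kappa>"
proof -
  define k where "k = (\<lambda>I. h (I, 0, 0))"
  have inW: "(I, 0, 0) \<in> W" if "I \<in> J" for I using that by (simp add: ham_domain_def)
  have tau: "\<tau> (k I) = 2 * pi / hI (I, 0, 0)" if "I \<in> J" for I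
    using on_cylinder(1)[OF that] tau_nonzero[OF inW[OF that]] by (simp add: k_def freq_def)
  have "continuous_on W hI" using h_C1(1) Ck_on_mono[of 0 W hI] by simp
  hence "continuous_on J (\<lambda>I. hI (I, 0, 0))"
    by (rule continuous_on_compose2) (auto intro!: continuous_intros inW)
  moreover have "hI (I, 0, 0) \<noteq> 0" if "I \<in> J" for I
    using on_cylinder(1)[OF that] tau_nonzero[OF inW[OF that]] by (simp add: freq_def)
  ultimately have "continuous_on J (\<lambda>I. 2 * pi / hI (I, 0, 0))" by (intro continuous_intros) auto
  hence "continuous_on J (\<lambda>I. \<tau> (k I))" by (rule continuous_on_eq) (simp add: tau)
  hence "\<exists>d>0. \<forall>I\<in>J. dist I I\<^sub>0 < d \<longrightarrow> dist (\<tau> (k I)) (\<tau> (k I\<^sub>0)) < \<kappa>"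
    using I0 \<kappa> unfolding continuous_on_iff by blast
  then obtain d1 where d1: "d1 > 0" "\<And>I. I \<in> J \<Longrightarrow> \<bar>I - I\<^sub>0\<bar> < d1 \<Longrightarrow> \<bar>\<tau> (k I) - \<tau> (k I\<^sub>0)\<bar> < \<kappa>"
    by (auto simp: dist_real_def)
  obtain d2 where d2: "d2 > 0" "cball I\<^sub>0 d2 \<subseteq> J" using open_J I0 open_contains_cball by blast
  define d where "d = min (d1 / 2) d2"
  have d: "d > 0" "d < d1" "d \<le> d2" using d1 d2 by (auto simp: d_def)
  have dJ: "{I\<^sub>0 - d..I\<^sub>0 + d} \<subseteq> J"
    using d2 d by (auto simp: cball_def dist_real_def intro!: subsetD[OF d2(2)])
  have dk: "(k has_real_derivative freq h \<tau> I\<^sub>0) (at I\<^sub>0)"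
  proof -
    have dd: "((\<lambda>I. (I, 0::real, 0::real)) has_derivative (\<lambda>t. (t, 0, 0))) (at I\<^sub>0)"
      by (auto intro!: derivative_eq_intros simp: zero_prod_def)
    have "(k has_derivative (\<lambda>t. pd (t,0,0) h p\<^sub>0)) (at I\<^sub>0)"
      using has_derivative_compose[OF dd has_derivative_pd[of h]] h_diff[OF p0_W] by (simp add: p\<^sub>0_def k_def)
    moreover have "pd (t,0,0) h p\<^sub>0 = freq h \<tau> I\<^sub>0 * t" for t
      using pd_real3[OF h_diff[OF p0_W], of t 0 0] on_cylinder(1)[OF I0] by (simp add: hI_def p\<^sub>0_def)
    ultimately show ?thesis by (simp add: has_field_derivative_def)
  qed
  have "\<exists>I1 I2. I1 \<in> {I\<^sub>0 - d..I\<^sub>0 + d} \<and> I2 \<in> {I\<^sub>0 - d..I\<^sub>0 + d} \<and> k I1 < k I\<^sub>0 \<and> k I\<^sub>0 < k I2"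
  proof (cases "freq h \<tau> I\<^sub>0 > 0")
    case True
    obtain e1 where e1: "e1 > 0" "\<And>t. 0 < t \<Longrightarrow> t < e1 \<Longrightarrow> k I\<^sub>0 < k (I\<^sub>0 + t)"
      using DERIV_pos_inc_right[OF dk True] by auto
    obtain e2 where e2: "e2 > 0" "\<And>t. 0 < t \<Longrightarrow> t < e2 \<Longrightarrow> k (I\<^sub>0 - t) < k I\<^sub>0"
      using DERIV_pos_inc_left[OF dk True] by auto
    define t where "t = min d (min e1 e2 / 2)"
    have "0 < t" "t < e1" "t < e2" "t \<le> d" using d e1 e2 by (auto simp: t_def)
    thus ?thesis using e1(2)[of t] e2(2)[of t] by (intro exI[of _ "I\<^sub>0 - t"] exI[of _ "I\<^sub>0 + t"]) auto
  next
    case False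
    hence neg: "freq h \<tau> I\<^sub>0 < 0" using freq_nonzero by simp
    obtain e1 where e1: "e1 > 0" "\<And>t. 0 < t \<Longrightarrow> t < e1 \<Longrightarrow> k I\<^sub>0 > k (I\<^sub>0 + t)"
      using DERIV_neg_dec_right[OF dk neg] by auto
    obtain e2 where e2: "e2 > 0" "\<And>t. 0 < t \<Longrightarrow> t < e2 \<Longrightarrow> k (I\<^sub>0 - t) > k I\<^sub>0"
      using DERIV_neg_dec_left[OF dk neg] by auto
    define t where "t = min d (min e1 e2 / 2)"
    have "0 < t" "t < e1" "t < e2" "t \<le> d" using d e1 e2 by (auto simp: t_def)
    thus ?thesis using e1(2)[of t] e2(2)[of t] by (intro exI[of _ "I\<^sub>0 + t"] exI[of _ "I\<^sub>0 - t"]) auto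
  qed
  then obtain I1 I2 where I12: "I1 \<in> {I\<^sub>0 - d..I\<^sub>0 + d}" "I2 \<in> {I\<^sub>0 - d..I\<^sub>0 + d}" "k I1 < k I\<^sub>0" "k I\<^sub>0 < k I2"
    by blast
  have conth: "continuous_on W h"
    using h_diff by (intro differentiable_imp_continuous_on differentiable_at_imp_differentiable_on)
  have contk: "continuous_on {I\<^sub>0 - d..I\<^sub>0 + d} k" unfolding k_def
    by (rule continuous_on_compose2[OF conth]) (use dJ inW in \<open>auto intro!: continuous_intros\<close>)
  have conn: "connected (k ` {I\<^sub>0 - d..I\<^sub>0 + d})" by (intro connected_continuous_image contk) simp
  have "open (W \<inter> h -` {k I1<..<k I2})"
    using continuous_open_preimage[OF conth open_W] by simp
  moreover have "p\<^sub>0 \<in> W \<inter> h -` {k I1<..<k I2}" using p0_W I12 by (simp add: k_def p\<^sub>0_def)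
  ultimately obtain \<rho> where \<rho>: "\<rho> > 0" "ball p\<^sub>0 \<rho> \<subseteq> W \<inter> h -` {k I1<..<k I2}"
    using open_contains_ball by blast
  show ?thesis
  proof (intro exI[of _ \<rho>] conjI allI impI \<rho>(1))
    fix p assume "norm (p - p\<^sub>0) < \<rho>"
    hence "p \<in> ball p\<^sub>0 \<rho>" by (simp add: dist_norm norm_minus_commute)
    hence "p \<in> W \<inter> h -` {k I1<..<k I2}" using \<rho>(2) by blast
    hence p: "p \<in> W" "h p \<in> {k I1..k I2}" by auto
    show "p \<in> W" by (rule p)
    have "h p \<in> k ` {I\<^sub>0 - d..I\<^sub>0 + d}"
      using connected_contains_Icc[OF conn, of "k I1" "k I2"] I12 p(2) by blast
    then obtain I where I: "I \<in> {I\<^sub>0 - d..I\<^sub>0 + d}" "h p = k I" by blast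
    have "\<bar>I - I\<^sub>0\<bar> < d1" using I(1) d by auto
    hence "\<bar>\<tau> (k I) - \<tau> (k I\<^sub>0)\<bar> < \<kappa>" using d1(2)[of I] I(1) dJ by blast
    thus "\<bar>\<tau> (h p) - \<tau> (h p\<^sub>0)\<bar> \<le> \<kappa>" using I(2) by (simp add: k_def p\<^sub>0_def)
  qed
qed

text \<open>
  A periodic solution on the factor lifts to the universal cover, where after any number \<open>j\<close> of periods
  it differs from itself by full turns.
\<close>

lemma periodic_solution:
  assumes y: "snd y \<in> W"
  shows "\<exists>z. (\<forall>t. (z has_vector_derivative ham_field h (z t)) (at t)) \<and> z 0 = y \<and> (\<forall>t. snd (z t) \<in> W) \<and>
     (\<forall>t (j::int). \<exists>n::int. z (t + of_int j * \<tau> (h (snd y))) = z t + (2 * pi * of_int n) *\<^sub>R (1,0,0,0))"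
proof -
  define q where "q = \<tau> (h (snd y))"
  have f: "fun1 h (cover1 y) = h (snd y)" using fun_cong[OF fun1_cover1, of h y] by simp
  have "cover1 y \<in> phase_space1 J" using y by (cases y) (auto simp: cover1_def phase_space1_def ham_domain_def)
  then obtain \<gamma> where g: "ham1_solution J h \<gamma>" "\<gamma> 0 = cover1 y" "\<And>t. \<gamma> (t + q) = \<gamma> t"
    using all_periodic unfolding all_periodic_def q_def f[symmetric] by metis
  obtain c where c: "\<And>t. \<gamma> t = cover1 (c t)" "\<And>t. \<gamma> t \<in> phase_space1 J"
    "\<And>t. \<exists>v. (\<forall>u. om1 u v = pd u (fun1 h \<circ> cover1) (c t)) \<and> (c has_vector_derivative v) (at t)"
    using g(1) unfolding ham1_solution_def by metis
  have cW: "snd (c t) \<in> W" for t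
    using c(1,2)[of t] by (cases "c t") (auto simp: cover1_def phase_space1_def ham_domain_def)
  have dc: "(c has_vector_derivative ham_field h (c t)) (at t)" for t
  proof -
    obtain v where v: "\<And>u. om1 u v = pd u (fun1 h \<circ> cover1) (c t)" "(c has_vector_derivative v) (at t)"
      using c(3) by blast
    have "v = ham_field h (c t)"
      by (rule om1_eqI) (simp add: v(1) om1_ham_field[OF h_diff[OF cW]])
    thus ?thesis using v(2) by simp
  qed
  have per: "\<gamma> (t + of_int j * q) = \<gamma> t" for t and j :: int
  proof (induction j rule: int_induct[where k = 0])
    case (step1 i)
    have "\<gamma> (t + of_int (i + 1) * q) = \<gamma> ((t + of_int i * q) + q)" by (simp add: algebra_simps)
    thus ?case using step1 g(3) by simp
  next
    case (step2 i)
    have "\<gamma> (t + of_int (i - 1) * q) = \<gamma> ((t + of_int (i - 1) * q) + q)" using g(3) by simp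
    also have "\<dots> = \<gamma> (t + of_int i * q)" by (simp add: algebra_simps)
    finally show ?case using step2 by simp
  qed simp
  have "cover1 y = cover1 (c 0)" using g(2) c(1) by simp
  then obtain i :: int where i: "y = c 0 + (2 * pi * of_int i) *\<^sub>R (1,0,0,0)" unfolding cover1_eq_iff ..
  define z where "z = (\<lambda>t. c t + (2 * pi * of_int i) *\<^sub>R ((1,0,0,0)::coord1))"
  have sz: "snd (z t) = snd (c t)" for t by (simp add: z_def zero_prod_def[symmetric])
  have "ham_field h (z t) = ham_field h (c t)" for t by (simp add: ham_field_def sz)
  hence "(z has_vector_derivative ham_field h (z t)) (at t)" for t
    unfolding z_def using dc[of t] by (auto intro!: derivative_eq_intros simp: z_def)
  moreover have "\<exists>n::int. z (t + of_int j * q) = z t + (2 * pi * of_int n) *\<^sub>R (1,0,0,0)" for t and j :: int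
  proof -
    have "cover1 (c (t + of_int j * q)) = cover1 (c t)" using per[of t j] c(1) by simp
    thus ?thesis unfolding cover1_eq_iff z_def by (auto simp: algebra_simps)
  qed
  moreover have "z 0 = y" by (simp add: z_def i)
  ultimately show ?thesis using cW sz unfolding q_def[symmetric] by (intro exI[of _ z]) auto
qed

text \<open>
  Up to the factor \<open>\<omega>\<close>, the time \<open>T\<close> is \<open>l\<close> periods of the circle. A nearby solution returns
  after \<open>l\<close> periods of its own, and these periods are almost the same.
\<close>

lemma relative_equilibrium_scaled:
  assumes \<omega>: "\<omega> > 0" and T: "T > 0" and res: "\<omega> * freq h \<tau> I\<^sub>0 * T = 2 * pi * of_int l"
  shows "relative_equilibrium (\<lambda>y. \<omega> *\<^sub>R ham_field h y) (\<lambda>u. \<omega> *\<^sub>R Lin u) om1 (1,0,0,0) (0,I\<^sub>0,0,0)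
     (\<omega> * freq h \<tau> I\<^sub>0) T"
proof (rule relative_equilibrium.intro)
  show "linear (\<lambda>u. \<omega> *\<^sub>R Lin u)" using linear_Lin by (rule linear_compose_scale_right)
  show "norm (1::real,0::real,0::real,0::real) = 1" by (simp add: norm_Pair)
  show "\<omega> * freq h \<tau> I\<^sub>0 \<noteq> 0" using \<omega> freq_nonzero by simp
  show "\<omega> *\<^sub>R ham_field h ((0,I\<^sub>0,0,0) + \<theta> *\<^sub>R (1,0,0,0)) = (\<omega> * freq h \<tau> I\<^sub>0) *\<^sub>R (1,0,0,0)" for \<theta>
    using on_cylinder[OF I0] by (simp add: ham_field_def hI_def hq_def hp_def)
  show "om1 (\<omega> *\<^sub>R Lin u) w + om1 u (\<omega> *\<^sub>R Lin w) = 0" for u w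
  proof -
    interpret bounded_bilinear om1 by (rule bounded_bilinear_om1)
    show ?thesis using skew_Lin[of u w] by (simp add: scaleR_left scaleR_right ring_distribs(1)[symmetric])
  qed
  have snd_near: "norm (snd y - p\<^sub>0) \<le> norm (y - ((0,I\<^sub>0,0,0) + \<theta> *\<^sub>R (1,0,0,0)))" for y \<theta>
  proof -
    have "norm (snd (y - ((0,I\<^sub>0,0,0) + \<theta> *\<^sub>R (1,0,0,0)))) \<le> norm (y - ((0,I\<^sub>0,0,0) + \<theta> *\<^sub>R (1,0,0,0)))"
      by (metis norm_snd_le prod.collapse)
    thus ?thesis by (simp add: p\<^sub>0_def)
  qed
  fix \<kappa> :: real assume \<kappa>: "\<kappa> > 0"
  show "\<exists>r>0. \<forall>\<theta> y z. norm (y - ((0,I\<^sub>0,0,0) + \<theta> *\<^sub>R (1,0,0,0))) < r \<longrightarrow>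
      norm (z - ((0,I\<^sub>0,0,0) + \<theta> *\<^sub>R (1,0,0,0))) < r \<longrightarrow>
      norm (\<omega> *\<^sub>R ham_field h y - \<omega> *\<^sub>R ham_field h z - \<omega> *\<^sub>R Lin (y - z)) \<le> \<kappa> * norm (y - z)"
  proof -
    define k where "k = \<kappa> / (3 * \<omega>)"
    have k: "k > 0" using \<kappa> \<omega> by (simp add: k_def)
    have "\<exists>r>0. \<forall>y z. norm (y - p\<^sub>0) < r \<longrightarrow> norm (z - p\<^sub>0) < r
      \<longrightarrow> \<bar>g y - g z - pd (y - z) g p\<^sub>0\<bar> \<le> k * norm (y - z)" if "Ck_on 1 W g" for g
    proof -
      have "compact {p\<^sub>0}" "{p\<^sub>0} \<subseteq> W" using p0_W by auto
      from C1_strictly_differentiable[OF open_W this that k] show ?thesis by (metis singletonI)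
    qed
    note * = this
    obtain ra where ra: "ra > 0" "\<And>y z. norm (y - p\<^sub>0) < ra \<Longrightarrow> norm (z - p\<^sub>0) < ra
      \<Longrightarrow> \<bar>hI y - hI z - pd (y - z) hI p\<^sub>0\<bar> \<le> k * norm (y - z)" using *[OF h_C1(1)] by blast
    obtain rb where rb: "rb > 0" "\<And>y z. norm (y - p\<^sub>0) < rb \<Longrightarrow> norm (z - p\<^sub>0) < rb
      \<Longrightarrow> \<bar>hq y - hq z - pd (y - z) hq p\<^sub>0\<bar> \<le> k * norm (y - z)" using *[OF h_C1(2)] by blast
    obtain rc where rc: "rc > 0" "\<And>y z. norm (y - p\<^sub>0) < rc \<Longrightarrow> norm (z - p\<^sub>0) < rc
      \<Longrightarrow> \<bar>hp y - hp z - pd (y - z) hp p\<^sub>0\<bar> \<le> k * norm (y - z)" using *[OF h_C1(3)] by blast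
    show ?thesis
    proof (intro exI[of _ "min ra (min rb rc)"] conjI allI impI)
      show "0 < min ra (min rb rc)" using ra rb rc by simp
      fix \<theta> :: real and y z :: coord1
      assume yz: "norm (y - ((0,I\<^sub>0,0,0) + \<theta> *\<^sub>R (1,0,0,0))) < min ra (min rb rc)"
        "norm (z - ((0,I\<^sub>0,0,0) + \<theta> *\<^sub>R (1,0,0,0))) < min ra (min rb rc)"
      define a where "a = hI (snd y) - hI (snd z) - pd (snd y - snd z) hI p\<^sub>0"
      define b where "b = hq (snd y) - hq (snd z) - pd (snd y - snd z) hq p\<^sub>0"
      define c where "c = hp (snd y) - hp (snd z) - pd (snd y - snd z) hp p\<^sub>0"
      have n: "norm (snd y - snd z) \<le> norm (y - z)" by (metis norm_snd_le prod.collapse snd_diff)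
      hence kn: "k * norm (snd y - snd z) \<le> k * norm (y - z)" using k by (intro mult_left_mono) auto
      have abc: "\<bar>a\<bar> \<le> k * norm (y - z)" "\<bar>b\<bar> \<le> k * norm (y - z)" "\<bar>c\<bar> \<le> k * norm (y - z)"
        using order_trans[OF ra(2) kn] order_trans[OF rb(2) kn] order_trans[OF rc(2) kn] yz
          snd_near[of y \<theta>] snd_near[of z \<theta>] by (auto simp: a_def b_def c_def)
      have eq: "ham_field h y - ham_field h z - Lin (y - z) = (a, 0, c, - b)"
        by (simp add: ham_field_def Lin_def a_def b_def c_def hI_def hq_def hp_def)
      have "norm (ham_field h y - ham_field h z - Lin (y - z)) \<le> 3 * (k * norm (y - z))"
        unfolding eq using norm_quadruple_le[of a "0::real" c "- b"] abc unfolding norm_minus_cancel norm_zero real_norm_def by linarith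
      hence "\<omega> * norm (ham_field h y - ham_field h z - Lin (y - z)) \<le> \<omega> * (3 * (k * norm (y - z)))"
        using \<omega> by (intro mult_left_mono) auto
      moreover have "\<omega> *\<^sub>R ham_field h y - \<omega> *\<^sub>R ham_field h z - \<omega> *\<^sub>R Lin (y - z)
         = \<omega> *\<^sub>R (ham_field h y - ham_field h z - Lin (y - z))" by (simp add: algebra_simps)
      ultimately show "norm (\<omega> *\<^sub>R ham_field h y - \<omega> *\<^sub>R ham_field h z - \<omega> *\<^sub>R Lin (y - z)) \<le> \<kappa> * norm (y - z)"
        using \<omega> by (simp add: k_def)
    qed
  qed
  show "\<exists>\<rho>>0. \<forall>\<theta> y. norm (y - ((0,I\<^sub>0,0,0) + \<theta> *\<^sub>R (1,0,0,0))) < \<rho> \<longrightarrow>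
      (\<exists>z s (n::int). (\<forall>t. (z has_vector_derivative \<omega> *\<^sub>R ham_field h (z t)) (at t)) \<and> z 0 = y \<and> \<bar>s\<bar> \<le> \<kappa> \<and>
         z (T - s) = y + (2 * pi * of_int n) *\<^sub>R (1,0,0,0))"
  proof -
    have pos: "\<kappa> * \<omega> / (\<bar>of_int l\<bar> + 1) > 0" using \<kappa> \<omega> by simp
    obtain \<rho> where \<rho>: "\<rho> > 0" "\<And>p. norm (p - p\<^sub>0) < \<rho> \<Longrightarrow> p \<in> W \<and> \<bar>\<tau> (h p) - \<tau> (h p\<^sub>0)\<bar> \<le> \<kappa> * \<omega> / (\<bar>of_int l\<bar> + 1)"
      using period_continuous[OF pos] by blast
    have t0: "\<omega> * T = of_int l * \<tau> (h p\<^sub>0)"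
      using res tau_nonzero[OF p0_W] by (simp add: freq_def p\<^sub>0_def field_simps)
    show ?thesis
    proof (intro exI[of _ \<rho>] conjI allI impI \<rho>(1))
      fix \<theta> :: real and y :: coord1 assume "norm (y - ((0,I\<^sub>0,0,0) + \<theta> *\<^sub>R (1,0,0,0))) < \<rho>"
      hence "norm (snd y - p\<^sub>0) < \<rho>" using snd_near[of y \<theta>] by simp
      from \<rho>(2)[OF this] have y: "snd y \<in> W" and ty: "\<bar>\<tau> (h (snd y)) - \<tau> (h p\<^sub>0)\<bar> \<le> \<kappa> * \<omega> / (\<bar>of_int l\<bar> + 1)" by auto
      obtain z where z: "\<And>t. (z has_vector_derivative ham_field h (z t)) (at t)" "z 0 = y"
        "\<And>t (j::int). \<exists>n::int. z (t + of_int j * \<tau> (h (snd y))) = z t + (2 * pi * of_int n) *\<^sub>R (1,0,0,0)"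
        using periodic_solution[OF y] by blast
      obtain n :: int where n: "z (of_int l * \<tau> (h (snd y))) = y + (2 * pi * of_int n) *\<^sub>R (1,0,0,0)"
        using z(3)[of 0 l] z(2) by auto
      define s where "s = T - of_int l * \<tau> (h (snd y)) / \<omega>"
      have "((\<lambda>t. z (\<omega> * t)) has_vector_derivative \<omega> *\<^sub>R ham_field h (z (\<omega> * t))) (at t)" for t
      proof -
        have "((\<lambda>t. \<omega> * t) has_vector_derivative \<omega>) (at t)" by (auto intro!: derivative_eq_intros)
        from vector_diff_chain_at[OF this z(1)] show ?thesis by (simp add: o_def)
      qed
      moreover have "\<bar>s\<bar> \<le> \<kappa>"
      proof -
        have "s * \<omega> = of_int l * (\<tau> (h p\<^sub>0) - \<tau> (h (snd y)))"
          using \<omega> t0 by (simp add: s_def algebra_simps)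
        hence "\<bar>s\<bar> * \<omega> = \<bar>of_int l\<bar> * \<bar>\<tau> (h (snd y)) - \<tau> (h p\<^sub>0)\<bar>"
          using \<omega> by (metis abs_minus_commute abs_mult abs_of_pos)
        also have "\<dots> \<le> (\<bar>of_int l\<bar> + 1) * (\<kappa> * \<omega> / (\<bar>of_int l\<bar> + 1))" using ty by (intro mult_mono) auto
        also have "\<dots> = \<kappa> * \<omega>" by simp
        finally show ?thesis using \<omega> by simp
      qed
      moreover have "\<omega> * (T - s) = of_int l * \<tau> (h (snd y))" using \<omega> by (simp add: s_def)
      ultimately show "\<exists>z s (n::int). (\<forall>t. (z has_vector_derivative \<omega> *\<^sub>R ham_field h (z t)) (at t)) \<and> z 0 = y \<and> \<bar>s\<bar> \<le> \<kappa> \<and>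
         z (T - s) = y + (2 * pi * of_int n) *\<^sub>R (1,0,0,0)"
        using z(2) n by (intro exI[of _ "\<lambda>t. z (\<omega> * t)"] exI[of _ s] exI[of _ n]) auto
    qed
  qed
qed (use T bounded_bilinear_om1 in auto)

end

text \<open>
  This is $\exp(tA)u$ when $A^3u=-\nu^2Au$.
\<close>

definition osc :: "('a::real_vector \<Rightarrow> 'a) \<Rightarrow> real \<Rightarrow> 'a \<Rightarrow> real \<Rightarrow> 'a" where
  "osc A \<nu> u t = u + (sin (\<nu> * t) / \<nu>) *\<^sub>R A u + ((1 - cos (\<nu> * t)) / \<nu>\<^sup>2) *\<^sub>R A (A u)"

lemma osc_has_vector_derivative:
  fixes A :: "'a::real_normed_vector \<Rightarrow> 'a"
  assumes "linear A" "\<nu> \<noteq> 0" "A (A (A u)) = - (\<nu>\<^sup>2) *\<^sub>R A u"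
  shows "(osc A \<nu> u has_vector_derivative A (osc A \<nu> u t)) (at t)"
proof -
  have "(osc A \<nu> u has_vector_derivative cos (\<nu> * t) *\<^sub>R A u + (sin (\<nu> * t) / \<nu>) *\<^sub>R A (A u)) (at t)"
    unfolding osc_def[abs_def] using assms(2)
    by (auto intro!: derivative_eq_intros simp: has_vector_derivative_def power2_eq_square algebra_simps)
  moreover have "A (osc A \<nu> u t) = cos (\<nu> * t) *\<^sub>R A u + (sin (\<nu> * t) / \<nu>) *\<^sub>R A (A u)"
  proof -
    have "((1 - cos (\<nu> * t)) / \<nu>\<^sup>2) *\<^sub>R A (A (A u)) = (cos (\<nu> * t) - 1) *\<^sub>R A u"
      unfolding assms(3) using assms(2) by (simp add: scaleR_left_diff_distrib)
    thus ?thesis using assms(1) by (simp add: osc_def linear_add linear_cmul algebra_simps)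
  qed
  ultimately show ?thesis by simp
qed

lemma osc_0 [simp]: "osc A \<nu> u 0 = u"
  by (simp add: osc_def)

lemma osc_periodic:
  assumes "\<nu> * T = 2 * pi * of_int l" shows "osc A \<nu> u (t + T) = osc A \<nu> u t"
proof -
  have "\<nu> * (t + T) = \<nu> * t + 2 * pi * of_int l" using assms by (simp add: algebra_simps)
  moreover have "sin (\<nu> * t + 2 * pi * of_int l) = sin (\<nu> * t)" "cos (\<nu> * t + 2 * pi * of_int l) = cos (\<nu> * t)"
    by (simp_all add: sin_add cos_add)
  ultimately show ?thesis by (simp add: osc_def)
qed

section \<open>Uniqueness and symmetry of solutions\<close>

lemma norm_vec_le_sum: "norm x \<le> (\<Sum>k\<in>UNIV. norm (x $ k))"
  unfolding norm_vec_def by (rule L2_set_le_sum) simp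

lemma has_vector_derivative_vec_nth:
  "(c has_vector_derivative v) F \<Longrightarrow> ((\<lambda>t. c t $ k) has_vector_derivative v $ k) F"
  by (rule bounded_linear.has_vector_derivative[OF bounded_linear_vec_nth])

lemma has_vector_derivative_vecI:
  fixes c :: "real \<Rightarrow> ('a::euclidean_space) ^ 'k::finite"
  assumes "\<And>k. ((\<lambda>t. c t $ k) has_vector_derivative v $ k) F"
  shows "(c has_vector_derivative v) F"
proof -
  have l: "bounded_linear (axis k :: 'a \<Rightarrow> 'a ^ 'k)" for k
    unfolding linear_conv_bounded_linear[symmetric] by (auto simp: linear_iff axis_def vec_eq_iff)
  have s: "x = (\<Sum>k\<in>UNIV. axis k (x $ k))" for x :: "'a ^ 'k"
    by (simp add: vec_eq_iff axis_def if_distrib cong: if_cong)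
  have "((\<lambda>t. \<Sum>k\<in>UNIV. axis k (c t $ k)) has_vector_derivative (\<Sum>k\<in>UNIV. axis k (v $ k))) F"
    by (intro has_vector_derivative_sum bounded_linear.has_vector_derivative[OF l] assms)
  thus ?thesis by (simp add: s[symmetric])
qed

abbreviation e\<^sub>\<phi> :: coord1 where "e\<^sub>\<phi> \<equiv> (1, 0, 0, 0)"

lemma cover_eq_iff:
  "cover x = cover y \<longleftrightarrow> (\<exists>n :: 'k::finite \<Rightarrow> int. x = y + (\<chi> k. (2 * pi * of_int (n k)) *\<^sub>R e\<^sub>\<phi>))"
proof -
  have "cover x = cover y \<longleftrightarrow> (\<forall>k. \<exists>n::int. x $ k = y $ k + (2 * pi * of_int n) *\<^sub>R e\<^sub>\<phi>)"
    by (simp add: cover_def vec_eq_iff cover1_eq_iff)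
  thus ?thesis unfolding choice_iff by (simp add: vec_eq_iff)
qed

lemma rot_cover: "rot \<beta> (cover c) = cover (c + (\<chi> k. \<beta> *\<^sub>R e\<^sub>\<phi>))"
  by (auto simp: rot_def cover_def cover1_def vec_eq_iff cis_mult split_beta add.commute zero_prod_def)

lemma rot_rot: "rot \<alpha> (rot \<beta> x) = rot (\<alpha> + \<beta>) x"
  by (auto simp: rot_def vec_eq_iff cis_mult split_beta mult.assoc[symmetric])

lemma rot_0 [simp]: "rot 0 x = x"
  by (auto simp: rot_def vec_eq_iff)

lemma cover_in_phase_space: "cover c \<in> phase_space J \<longleftrightarrow> (\<forall>k. snd (c $ k) \<in> ham_domain (J k))"
  by (auto simp: phase_space_def phase_space1_def cover_def cover1_def ham_domain_def split_beta mem_Times_iff)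

lemma pd_shift: "pd u f (x + a) = pd u (\<lambda>y. f (y + a)) x"
proof -
  have 1: "((\<lambda>y. f (y + a)) has_derivative D) (at x)" if "(f has_derivative D) (at (x + a))" for f :: "'a \<Rightarrow> real" and D x a
  proof -
    have "((\<lambda>y. y + a) has_derivative (\<lambda>h. h)) (at x)"
      by (rule has_derivative_add_const[OF has_derivative_ident])
    from has_derivative_compose[OF this that] show ?thesis .
  qed
  have "(f has_derivative D) (at (x + a)) \<longleftrightarrow> ((\<lambda>y. f (y + a)) has_derivative D) (at x)" for D
    using 1[of f D x a] 1[of "\<lambda>y. f (y + a)" D "x + a" "- a"] by auto
  thus ?thesis unfolding pd_def frechet_derivative_def by simp
qed

lemma om_axis: "om A (axis k b) v = (if k \<in> A then om1 b (v $ k) else 0)"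
proof -
  interpret bounded_bilinear om1 by (rule bounded_bilinear_om1)
  have "om A (axis k b) v = (\<Sum>j\<in>A. if j = k then om1 b (v $ k) else 0)"
    unfolding om_def axis_def by (rule sum.cong) (auto simp: zero_left)
  thus ?thesis by simp
qed

lemma lham_vec_component:
  assumes "lham_vec P F F\<^sub>1 c v"
  shows "om1 b (v $ k) = pd (axis k b) ((if k \<in> P then F else F\<^sub>1) \<circ> cover) c"
proof (cases "k \<in> P")
  case True
  have "\<forall>w. om (- P) (axis k b) w = 0" using True by (simp add: om_axis)
  hence "om P (axis k b) v = pd (axis k b) (F \<circ> cover) c" using assms unfolding lham_vec_def by blast
  thus ?thesis using True by (simp add: om_axis)
next
  case False
  have "proj P (axis k b) = 0" using False by (auto simp: proj_def axis_def vec_eq_iff)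
  hence "om (- P) (axis k b) v = pd (axis k b) (F\<^sub>1 \<circ> cover) c" using assms unfolding lham_vec_def by blast
  thus ?thesis using False by (simp add: om_axis)
qed

lemma norm_le_om1: "norm v \<le> (\<Sum>b\<in>Basis. \<bar>om1 b v\<bar>)"
proof -
  obtain a b c d where v: "v = (a, b, c, d)" by (metis prod.exhaust)
  show ?thesis using norm_quadruple_le[of a b c d] by (simp add: Basis_coord1 v om1_def)
qed

lemma lham_vec_shift:
  assumes "\<And>x. cover (x + a) = cover x"
  shows "lham_vec P F F\<^sub>1 (c + a) v \<longleftrightarrow> lham_vec P F F\<^sub>1 c v"
  unfolding lham_vec_def pd_shift by (simp add: assms o_def)

text \<open>
  Each component of the vector field is a partial derivative of \<open>F\<close> or of \<open>F\<^sub>1\<close> up to sign, hence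
  Lipschitz near the compact trajectory \<open>c1\<close>, and Gronwall's inequality applies with initial value \<open>0\<close>.
\<close>

lemma lham_lift_unique:
  fixes J :: "'k::finite \<Rightarrow> real set" and c1 c2 :: "real \<Rightarrow> 'k coord"
  assumes J: "\<And>k. open (J k)" and F: "Ck_fun 2 J F" and F1: "Ck_fun 2 J F\<^sub>1"
    and s1: "\<And>t. t \<in> {0..S} \<Longrightarrow> cover (c1 t) \<in> phase_space J \<and>
       (\<exists>v. lham_vec P F F\<^sub>1 (c1 t) v \<and> (c1 has_vector_derivative v) (at t within {0..S}))"
    and s2: "\<And>t. t \<in> {0..S} \<Longrightarrow> cover (c2 t) \<in> phase_space J \<and>
       (\<exists>v. lham_vec P F F\<^sub>1 (c2 t) v \<and> (c2 has_vector_derivative v) (at t within {0..S}))"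
    and init: "c1 0 = c2 0" and t: "t \<in> {0..S}"
  shows "c1 t = c2 t"
proof -
  obtain v1 where v1: "\<And>t. t \<in> {0..S} \<Longrightarrow> lham_vec P F F\<^sub>1 (c1 t) (v1 t)"
     "\<And>t. t \<in> {0..S} \<Longrightarrow> (c1 has_vector_derivative v1 t) (at t within {0..S})" using s1 by metis
  obtain v2 where v2: "\<And>t. t \<in> {0..S} \<Longrightarrow> lham_vec P F F\<^sub>1 (c2 t) (v2 t)"
     "\<And>t. t \<in> {0..S} \<Longrightarrow> (c2 has_vector_derivative v2 t) (at t within {0..S})" using s2 by metis
  let ?W = "cover -` phase_space J :: 'k coord set"
  define g where "g = (\<lambda>k b. pd (axis k b) ((if k \<in> P then F else F\<^sub>1) \<circ> cover))"
  have W: "open ?W" by (rule open_cover_vimage[OF J])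
  have "continuous_on {0..S} c1"
    unfolding continuous_on_eq_continuous_within using has_vector_derivative_continuous[OF v1(2)] by blast
  hence K: "compact (c1 ` {0..S})" by (intro compact_continuous_image) auto
  have KW: "c1 ` {0..S} \<subseteq> ?W" using s1 by auto
  define G where "G k b r l \<longleftrightarrow> r > 0 \<and> l \<ge> 0 \<and>
    (\<forall>x\<in>c1 ` {0..S}. \<forall>y. norm (y - x) < r \<longrightarrow> \<bar>g k b y - g k b x\<bar> \<le> l * norm (y - x))" for k b r l
  have "\<exists>r l. G k b r l" if b: "b \<in> Basis" for k b
  proof -
    have "axis k b \<in> (Basis :: 'k coord set)" using b by (auto simp: Basis_vec_def)
    hence "Ck_on 1 ?W (g k b)" using F F1 unfolding g_def Ck_fun_def by (auto simp: numeral_2_eq_2)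
    then obtain r l where "r > 0" "l \<ge> 0"
      "\<And>x y. x \<in> c1 ` {0..S} \<Longrightarrow> norm (y - x) < r \<Longrightarrow> \<bar>g k b y - g k b x\<bar> \<le> l * norm (y - x)"
      using C1_Lipschitz_near_compact[OF W K KW] by blast
    thus ?thesis unfolding G_def by blast
  qed
  hence "\<forall>k b. \<exists>r l. b \<in> Basis \<longrightarrow> G k b r l" by blast
  then obtain r l where rl0: "\<And>k b. b \<in> Basis \<Longrightarrow> G k b (r k b) (l k b)" unfolding choice_iff by blast
  have rl: "\<And>k b. b \<in> Basis \<Longrightarrow> r k b > 0" "\<And>k b. b \<in> Basis \<Longrightarrow> l k b \<ge> 0"
    "\<And>k b x y. b \<in> Basis \<Longrightarrow> x \<in> c1 ` {0..S} \<Longrightarrow> norm (y - x) < r k b \<Longrightarrow> \<bar>g k b y - g k b x\<bar> \<le> l k b * norm (y - x)"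
    using rl0 unfolding G_def by auto
  define q where "q = Min ((\<lambda>(k, b). r k b) ` (UNIV \<times> Basis))"
  define Q where "Q = (\<Sum>k\<in>UNIV. \<Sum>b\<in>Basis. l k b)"
  have ne: "(UNIV :: 'k set) \<times> (Basis :: coord1 set) \<noteq> {}" by auto
  have q: "q > 0" unfolding q_def using ne rl(1) by (subst Min_gr_iff) auto
  have qle: "q \<le> r k b" if "b \<in> Basis" for k b unfolding q_def using that by (intro Min_le) auto
  have Q: "Q \<ge> 0" unfolding Q_def by (intro sum_nonneg rl(2))
  have "norm (c2 t - c1 t) \<le> (0 + 0 * S) * exp (Q * S)"
  proof (rule gronwall_local[where r = "q / 2" and y = "\<lambda>t. c2 t - c1 t" and y' = "\<lambda>t. v2 t - v1 t"])
    fix t assume t: "t \<in> {0..S}"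
    show "((\<lambda>t. c2 t - c1 t) has_vector_derivative v2 t - v1 t) (at t within {0..S})"
      by (intro derivative_intros v1(2) v2(2) t)
    assume n: "norm (c2 t - c1 t) \<le> q / 2"
    have "norm (v2 t - v1 t) \<le> (\<Sum>k\<in>UNIV. norm ((v2 t - v1 t) $ k))" by (rule norm_vec_le_sum)
    also have "\<dots> \<le> (\<Sum>k\<in>UNIV. \<Sum>b\<in>Basis. l k b * norm (c2 t - c1 t))"
    proof (rule sum_mono)
      fix k
      interpret bounded_bilinear om1 by (rule bounded_bilinear_om1)
      have "norm ((v2 t - v1 t) $ k) \<le> (\<Sum>b\<in>Basis. \<bar>om1 b ((v2 t - v1 t) $ k)\<bar>)" by (rule norm_le_om1)
      also have "\<dots> \<le> (\<Sum>b\<in>Basis. l k b * norm (c2 t - c1 t))"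
      proof (rule sum_mono)
        fix b :: coord1 assume b: "b \<in> Basis"
        have "om1 b ((v2 t - v1 t) $ k) = g k b (c2 t) - g k b (c1 t)"
          using lham_vec_component[OF v1(1)[OF t], of b k] lham_vec_component[OF v2(1)[OF t], of b k]
          by (simp add: diff_right g_def)
        moreover have "norm (c2 t - c1 t) < r k b" using n q qle[OF b, of k] by simp
        ultimately show "\<bar>om1 b ((v2 t - v1 t) $ k)\<bar> \<le> l k b * norm (c2 t - c1 t)" using rl(3)[OF b] t by auto
      qed
      finally show "norm ((v2 t - v1 t) $ k) \<le> (\<Sum>b\<in>Basis. l k b * norm (c2 t - c1 t))" .
    qed
    also have "\<dots> = Q * norm (c2 t - c1 t) + 0" by (simp add: Q_def sum_distrib_right)
    finally show "norm (v2 t - v1 t) \<le> Q * norm (c2 t - c1 t) + 0" .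
  qed (use q Q t init in auto)
  thus ?thesis by simp
qed

text \<open>
  Lifts of the same initial point differ by full turns, and shifting a lift by full turns gives another
  lift.
\<close>

lemma lham_solution_unique:
  fixes J :: "'k::finite \<Rightarrow> real set"
  assumes J: "\<And>k. open (J k)" and F: "Ck_fun 2 J F" and F1: "Ck_fun 2 J F\<^sub>1"
    and s1: "lham_solution J P F F\<^sub>1 {0..S} \<delta>1" and s2: "lham_solution J P F F\<^sub>1 {0..S} \<delta>2"
    and init: "\<delta>1 0 = \<delta>2 0" and t: "t \<in> {0..S}"
  shows "\<delta>1 t = \<delta>2 t"
proof -
  obtain c1 where c1: "\<And>t. t \<in> {0..S} \<Longrightarrow> \<delta>1 t = cover (c1 t)"
    "\<And>t. t \<in> {0..S} \<Longrightarrow> cover (c1 t) \<in> phase_space J \<and>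
     (\<exists>v. lham_vec P F F\<^sub>1 (c1 t) v \<and> (c1 has_vector_derivative v) (at t within {0..S}))"
    using s1 unfolding lham_solution_def by fastforce
  obtain c2 where c2: "\<And>t. t \<in> {0..S} \<Longrightarrow> \<delta>2 t = cover (c2 t)"
    "\<And>t. t \<in> {0..S} \<Longrightarrow> cover (c2 t) \<in> phase_space J \<and>
     (\<exists>v. lham_vec P F F\<^sub>1 (c2 t) v \<and> (c2 has_vector_derivative v) (at t within {0..S}))"
    using s2 unfolding lham_solution_def by fastforce
  have "cover (c1 0) = cover (c2 0)" using init c1(1)[of 0] c2(1)[of 0] t by auto
  then obtain n :: "'k \<Rightarrow> int" where n: "c1 0 = c2 0 + (\<chi> k. (2 * pi * of_int (n k)) *\<^sub>R e\<^sub>\<phi>)"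
    unfolding cover_eq_iff ..
  define a :: "'k coord" where "a = (\<chi> k. (2 * pi * of_int (n k)) *\<^sub>R e\<^sub>\<phi>)"
  have a: "cover (x + a) = cover x" for x unfolding cover_eq_iff a_def by blast
  have "c1 t = c2 t + a"
  proof (rule lham_lift_unique[OF J F F1 c1(2) _ _ t])
    fix t assume t: "t \<in> {0..S}"
    show "cover (c2 t + a) \<in> phase_space J \<and>
     (\<exists>v. lham_vec P F F\<^sub>1 (c2 t + a) v \<and> ((\<lambda>t. c2 t + a) has_vector_derivative v) (at t within {0..S}))"
    proof -
      obtain v where v: "lham_vec P F F\<^sub>1 (c2 t) v" "(c2 has_vector_derivative v) (at t within {0..S})"
        using c2(2)[OF t] by blast
      have "((\<lambda>t. c2 t + a) has_vector_derivative v) (at t within {0..S})"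
        using has_vector_derivative_add[OF v(2) has_vector_derivative_const[of a]] by simp
      thus ?thesis using c2(2)[OF t] v(1) unfolding a lham_vec_shift[OF a] by blast
    qed
  qed (use n in \<open>auto simp: a_def\<close>)
  thus ?thesis using c1(1)[OF t] c2(1)[OF t] a by simp
qed

lemma phase_space_rot: "x \<in> phase_space J \<Longrightarrow> rot \<beta> x \<in> phase_space J"
  by (auto simp: rot_def phase_space_def phase_space1_def split_beta mem_Times_iff norm_mult)

lemma pd_invariant:
  assumes J: "\<And>k. open (J k)" and F: "invariant J F" and c: "cover c \<in> phase_space J"
  shows "pd u (F \<circ> cover) (c + (\<chi> k. \<beta> *\<^sub>R e\<^sub>\<phi>)) = pd u (F \<circ> cover) c"
  unfolding pd_shift
proof (rule pd_cong_open[OF open_cover_vimage[OF J]])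
  show "c \<in> cover -` phase_space J" using c by simp
  fix y assume "y \<in> cover -` phase_space J"
  thus "(F \<circ> cover) (y + (\<chi> k. \<beta> *\<^sub>R e\<^sub>\<phi>)) = (F \<circ> cover) y"
    using F unfolding o_def rot_cover[symmetric] by (simp add: invariant_def)
qed

lemma lham_solution_rot:
  assumes J: "\<And>k. open (J k)" and F: "invariant J F" and F1: "invariant J F\<^sub>1"
    and s: "lham_solution J P F F\<^sub>1 S \<delta>"
  shows "lham_solution J P F F\<^sub>1 S (\<lambda>t. rot \<beta> (\<delta> t))"
proof -
  obtain c where c: "\<And>t. t \<in> S \<Longrightarrow> \<delta> t = cover (c t) \<and> \<delta> t \<in> phase_space J \<and>
     (\<exists>v. lham_vec P F F\<^sub>1 (c t) v \<and> (c has_vector_derivative v) (at t within S))"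
    using s unfolding lham_solution_def by blast
  let ?b = "(\<chi> k. \<beta> *\<^sub>R e\<^sub>\<phi>) :: 'a coord"
  show ?thesis unfolding lham_solution_def
  proof (intro exI[of _ "\<lambda>t. c t + ?b"] ballI)
    fix t assume t: "t \<in> S"
    obtain v where v: "lham_vec P F F\<^sub>1 (c t) v" "(c has_vector_derivative v) (at t within S)" using c[OF t] by blast
    have ps: "cover (c t) \<in> phase_space J" using c[OF t] by metis
    have "lham_vec P F F\<^sub>1 (c t + ?b) v" using v(1)
      unfolding lham_vec_def pd_invariant[OF J F ps] pd_invariant[OF J F1 ps] .
    moreover have "((\<lambda>t. c t + ?b) has_vector_derivative v) (at t within S)"
      using has_vector_derivative_add[OF v(2) has_vector_derivative_const[of ?b]] by simp
    moreover have "rot \<beta> (\<delta> t) = cover (c t + ?b)" using c[OF t] rot_cover[of \<beta> "c t"] by simp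
    moreover have "rot \<beta> (\<delta> t) \<in> phase_space J" using c[OF t] phase_space_rot by blast
    ultimately show "rot \<beta> (\<delta> t) = cover (c t + ?b) \<and> rot \<beta> (\<delta> t) \<in> phase_space J \<and>
      (\<exists>v. lham_vec P F F\<^sub>1 (c t + ?b) v \<and> ((\<lambda>t. c t + ?b) has_vector_derivative v) (at t within S))"
      by blast
  qed
qed

text \<open>
  Relative periodicity refers to the flow at one time only. Rotating the solution provided by
  \<open>flow_rel\<close> gives a solution that starts at the initial point of \<open>\<delta>\<close>; by uniqueness it is \<open>\<delta>\<close>.
\<close>

lemma rel_periodic_solution_shift:
  fixes J :: "'k::finite \<Rightarrow> real set"
  assumes J: "\<And>k. open (J k)" and F: "Ck_fun 2 J F" "invariant J F" and F1: "Ck_fun 2 J F\<^sub>1" "invariant J F\<^sub>1"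
    and per: "rel_periodic_solution J P F F\<^sub>1 T \<alpha> \<delta>" and T: "T > 0"
  shows "\<delta> T = rot \<alpha> (\<delta> 0)"
proof -
  have sol: "lham_solution J P F F\<^sub>1 UNIV \<delta>" and "flow_rel J P F F\<^sub>1 T (rot (- \<alpha>) (\<delta> 0)) (\<delta> 0)"
    using per unfolding rel_periodic_solution_def by auto
  then obtain \<delta>2 where d2: "lham_solution J P F F\<^sub>1 {0..T} \<delta>2" "\<delta>2 0 = rot (- \<alpha>) (\<delta> 0)" "\<delta>2 T = \<delta> 0"
    using T unfolding flow_rel_def closed_segment_eq_real_ivl by force
  have s1: "lham_solution J P F F\<^sub>1 {0..T} \<delta>"
  proof -
    obtain c where c: "\<And>t. \<delta> t = cover (c t) \<and> \<delta> t \<in> phase_space J \<and>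
      (\<exists>v. lham_vec P F F\<^sub>1 (c t) v \<and> (c has_vector_derivative v) (at t))"
      using sol unfolding lham_solution_def by blast
    show ?thesis unfolding lham_solution_def
    proof (intro exI[of _ c] ballI conjI)
      fix t
      show "\<delta> t = cover (c t)" "\<delta> t \<in> phase_space J" using c[of t] by blast+
      show "\<exists>v. lham_vec P F F\<^sub>1 (c t) v \<and> (c has_vector_derivative v) (at t within {0..T})"
        using c[of t] has_vector_derivative_at_within by blast
    qed
  qed
  have s2: "lham_solution J P F F\<^sub>1 {0..T} (\<lambda>t. rot \<alpha> (\<delta>2 t))"
    by (rule lham_solution_rot[OF J F(2) F1(2) d2(1)])
  have init: "\<delta> 0 = rot \<alpha> (\<delta>2 0)" by (simp add: d2 rot_rot)
  have "\<delta> T = rot \<alpha> (\<delta>2 T)"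
    using lham_solution_unique[OF J F(1) F1(1) s1 s2 init, of T] T by simp
  thus ?thesis by (simp add: d2)
qed

section \<open>The model system\<close>

lemma sum_ham_cover: "sum_ham H A \<circ> cover = (\<lambda>c. \<Sum>k\<in>A. H k (snd (c $ k)))"
  by (auto simp: sum_ham_def lift_ham_def fun1_def cover_def cover1_def split_beta fun_eq_iff)

text \<open>
  The model system near the torus \<open>I\<^sub>0\<close>. For \<open>k \<in> P\<close> the solution in the factor \<open>k\<close>, slowed down by
  \<open>\<omega>\<close>, makes \<open>l k\<close> turns in the time \<open>T\<close>. Only functions lifted from $M_0$ will be averaged, so these
  are the factors whose return counts.
\<close>

locale model_system =
  fixes J :: "'k::finite \<Rightarrow> real set" and P :: "'k set" and H :: "'k \<Rightarrow> real \<times> real \<times> real \<Rightarrow> real"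
    and \<tau> :: "'k \<Rightarrow> real \<Rightarrow> real" and I\<^sub>0 :: "'k \<Rightarrow> real" and \<omega> T :: real and l :: "'k \<Rightarrow> int"
  assumes open_J: "\<And>k. open (J k)" and smooth_H: "\<And>k. smooth_on (J k \<times> UNIV \<times> UNIV) (H k)"
    and periodic_H: "\<And>k. all_periodic (J k) (H k) (\<tau> k)"
    and nondegenerate_H: "\<And>k. nondegenerate (J k) (H k) (\<tau> k)"
    and I0_J: "\<And>k. I\<^sub>0 k \<in> J k" and \<omega>: "\<omega> > 0" and T: "T > 0"
    and resonance: "\<And>k. k \<in> P \<Longrightarrow> \<omega> * freq (H k) (\<tau> k) (I\<^sub>0 k) * T = 2 * pi * of_int (l k)"
begin

lemma fac: "factor (J k) (H k) (\<tau> k) (I\<^sub>0 k)"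
  by (rule factor.intro[OF open_J I0_J smooth_H periodic_H nondegenerate_H])

definition \<nu> where "\<nu> k = \<omega> * freq (H k) (\<tau> k) (I\<^sub>0 k)"
definition A where "A k u = \<omega> *\<^sub>R factor.Lin (H k) (I\<^sub>0 k) u"

abbreviation "F \<equiv> (\<lambda>x. \<omega> * sum_ham H P x)"
abbreviation "F\<^sub>1 \<equiv> sum_ham H (- P)"
abbreviation "W \<equiv> cover -` phase_space J :: 'k coord set"

lemma open_W: "open W" by (rule open_cover_vimage[OF open_J])

lemma relative_equilibrium_component:
  assumes "k \<in> P"
  shows "relative_equilibrium (\<lambda>y. \<omega> *\<^sub>R ham_field (H k) y) (A k) om1 e\<^sub>\<phi> (0, I\<^sub>0 k, 0, 0) (\<nu> k) T"
  using factor.relative_equilibrium_scaled[OF fac \<omega> T resonance[OF assms]] unfolding A_def[abs_def] \<nu>_def .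

lemma nu_T: "k \<in> P \<Longrightarrow> \<nu> k * T = 2 * pi * of_int (l k)"
  using resonance by (simp add: \<nu>_def)

lemma H_diff: "c \<in> W \<Longrightarrow> H k differentiable (at (snd (c $ k)))"
  using factor.h_diff[OF fac] by (simp add: cover_in_phase_space)

lemma sum_ham_has_derivative:
  assumes "c \<in> W"
  shows "((sum_ham H B \<circ> cover) has_derivative (\<lambda>u. \<Sum>k\<in>B. pd (snd (u $ k)) (H k) (snd (c $ k)))) (at c)"
  unfolding sum_ham_cover
proof (rule has_derivative_sum)
  fix k
  have "bounded_linear (\<lambda>c::'k coord. snd (c $ k))"
    by (intro bounded_linear_compose[OF bounded_linear_snd] bounded_linear_vec_nth)
  thus "((\<lambda>c. H k (snd (c $ k))) has_derivative (\<lambda>u. pd (snd (u $ k)) (H k) (snd (c $ k)))) (at c)"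
    using has_derivative_compose[where f = "\<lambda>c. snd (c $ k)" and g = "H k" and s = UNIV,
        OF bounded_linear_imp_has_derivative has_derivative_pd[OF H_diff[OF assms, of k]]] by simp
qed

lemma sum_ham_Ck: "Ck_fun r J (sum_ham H B)"
  unfolding Ck_fun_def sum_ham_cover
proof (rule Ck_on_sum[OF open_W])
  fix k
  have L: "bounded_linear (\<lambda>c::'k coord. snd (c $ k))"
    by (intro bounded_linear_compose[OF bounded_linear_snd] bounded_linear_vec_nth)
  have "Ck_on r (ham_domain (J k)) (H k)"
    using smooth_H by (simp add: smooth_on_def ham_domain_def)
  from Ck_on_linear_compose[OF L factor.open_W[OF fac] this]
  have "Ck_on r ((\<lambda>c::'k coord. snd (c $ k)) -` ham_domain (J k)) (\<lambda>c. H k (snd (c $ k)))" by (simp add: o_def)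
  moreover have "W \<subseteq> (\<lambda>c. snd (c $ k)) -` ham_domain (J k)" by (auto simp: cover_in_phase_space)
  ultimately show "Ck_on r W (\<lambda>c. H k (snd (c $ k)))" by (rule Ck_on_subset)
qed simp

lemma model_Ck: "Ck_fun r J F" "Ck_fun r J F\<^sub>1"
  using sum_ham_Ck[of r P] sum_ham_Ck[of r "- P"] Ck_on_cmult[OF open_W, of r "sum_ham H P \<circ> cover" \<omega>]
  by (auto simp: Ck_fun_def o_def)

definition field where
  "field c = (\<chi> k. (if k \<in> P then \<omega> else 1) *\<^sub>R ham_field (H k) (c $ k))"

lemma om_field:
  assumes "c \<in> W"
  shows "om P u (field c) = \<omega> * pd u (sum_ham H P \<circ> cover) c" "om (- P) u (field c) = pd u (sum_ham H (- P) \<circ> cover) c"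
proof -
  interpret bounded_bilinear om1 by (rule bounded_bilinear_om1)
  have k: "om1 w (ham_field (H k) (c $ k)) = pd (snd w) (H k) (snd (c $ k))" for k w
    using om1_ham_field[OF H_diff[OF assms]] pd_fun1[OF H_diff[OF assms]] by simp
  show "om P u (field c) = \<omega> * pd u (sum_ham H P \<circ> cover) c" "om (- P) u (field c) = pd u (sum_ham H (- P) \<circ> cover) c"
    unfolding pd_eqI[OF sum_ham_has_derivative[OF assms]]
    by (simp_all add: om_def field_def scaleR_right k sum_distrib_left)
qed

lemma lham_vec_field:
  assumes c: "c \<in> W"
  shows "lham_vec P F F\<^sub>1 c (field c)"
proof -
  have "pd u (F \<circ> cover) c = \<omega> * pd u (sum_ham H P \<circ> cover) c" for u
  proof -
    have "((\<lambda>x. \<omega> * (sum_ham H P \<circ> cover) x) has_derivative (\<lambda>u. \<omega> * pd u (sum_ham H P \<circ> cover) c)) (at c)"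
    proof (intro derivative_intros has_derivative_pd)
      show "sum_ham H P \<circ> cover differentiable at c"
        using sum_ham_has_derivative[OF c, of P] unfolding differentiable_def by blast
    qed
    thus ?thesis using pd_eqI by (auto simp: o_def)
  qed
  thus ?thesis unfolding lham_vec_def using om_field[OF c] by simp
qed

lemma lham_vec_unique:
  assumes "c \<in> W" "lham_vec P F F\<^sub>1 c v" shows "v = field c"
  unfolding vec_eq_iff
  using lham_vec_component[OF assms(2)] lham_vec_component[OF lham_vec_field[OF assms(1)]]
  by (intro allI om1_eqI) simp

lemma flow_exists:
  assumes c: "c \<in> W"
  shows "\<exists>z. z 0 = c \<and> (\<forall>t. z t \<in> W) \<and> (\<forall>t. (z has_vector_derivative field (z t)) (at t))"
proof -
  have "\<exists>z. (\<forall>t. (z has_vector_derivative ham_field (H k) (z t)) (at t)) \<and> z 0 = c $ k \<and> (\<forall>t. snd (z t) \<in> ham_domain (J k))" for k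
    using factor.periodic_solution[OF fac, of "c $ k" k] c unfolding vimage_eq cover_in_phase_space by blast
  then obtain z where z: "\<And>k t. (z k has_vector_derivative ham_field (H k) (z k t)) (at t)" "\<And>k. z k 0 = c $ k"
     "\<And>k t. snd (z k t) \<in> ham_domain (J k)" by metis
  define w where "w k = (if k \<in> P then \<omega> else 1)" for k
  define y where "y = (\<lambda>t. \<chi> k. z k (w k * t))"
  have "(y has_vector_derivative field (y t)) (at t)" for t
  proof (rule has_vector_derivative_vecI)
    fix k
    have "((\<lambda>t. w k * t) has_vector_derivative w k) (at t)" by (auto intro!: derivative_eq_intros)
    from vector_diff_chain_at[OF this z(1)[of k]]
    show "((\<lambda>t. y t $ k) has_vector_derivative field (y t) $ k) (at t)"
      by (simp add: y_def o_def field_def w_def)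
  qed
  moreover have "y 0 = c" by (simp add: y_def z(2))
  ultimately show ?thesis using z(3) by (intro exI[of _ y]) (auto simp: cover_in_phase_space y_def)
qed

lemma flow_eq:
  assumes z: "\<And>t. z t \<in> W" "\<And>t. (z has_vector_derivative field (z t)) (at t)" and t: "t \<ge> 0"
  shows "lham_flow J P F F\<^sub>1 t (cover (z 0)) = cover (z t)"
proof -
  have seg: "closed_segment 0 t = {0..t}" using t by (simp add: closed_segment_eq_real_ivl)
  have sol: "lham_solution J P F F\<^sub>1 {0..t} (\<lambda>t. cover (z t))"
    unfolding lham_solution_def
  proof (intro exI[of _ z] ballI conjI)
    fix t
    show "cover (z t) = cover (z t)" "cover (z t) \<in> phase_space J" using z(1)[of t] by auto
    show "\<exists>v. lham_vec P F F\<^sub>1 (z t) v \<and> (z has_vector_derivative v) (at t within {0..q})" for q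
      using lham_vec_field[OF z(1)] has_vector_derivative_at_within[OF z(2)] by blast
  qed
  show ?thesis unfolding lham_flow_def
  proof (rule the_equality)
    show "flow_rel J P F F\<^sub>1 t (cover (z 0)) (cover (z t))"
      unfolding flow_rel_def seg using sol by blast
    fix y assume "flow_rel J P F F\<^sub>1 t (cover (z 0)) y"
    then obtain d where d: "lham_solution J P F F\<^sub>1 {0..t} d" "d 0 = cover (z 0)" "d t = y"
      unfolding flow_rel_def seg by blast
    show "y = cover (z t)"
    proof -
      have "d t = (\<lambda>t. cover (z t)) t"
        by (rule lham_solution_unique[OF open_J model_Ck d(1) sol]) (use d(2) t in auto)
      thus ?thesis using d(3) by simp
    qed
  qed
qed

end

section \<open>The derivative of the averaged function\<close>

text \<open>
  The increment of an antiderivative over a period does not depend on where the period begins, since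
  its derivative \<open>h(s + T) - h(s)\<close> vanishes.
\<close>

lemma periodic_antiderivative:
  fixes h :: "real \<Rightarrow> real"
  assumes h: "continuous_on UNIV h" "\<And>t. h (t + T) = h t" and T: "T > 0"
  obtains K where "\<And>t. t \<in> {0..2*T} \<Longrightarrow> (K has_real_derivative h t) (at t)"
    "\<And>s. s \<in> {0..T} \<Longrightarrow> K (s + T) - K s = integral {0..T} h"
proof
  define K where "K = (\<lambda>t. integral {-1..t} h)"
  have K: "(K has_real_derivative h t) (at t)" if "-1 < t" "t < 2 * T + 1" for t
  proof -
    have "(K has_real_derivative h t) (at t within {-1..2 * T + 1})"
      unfolding K_def using that by (intro integral_has_real_derivative continuous_on_subset[OF h(1)]) auto
    thus ?thesis using that by (simp add: at_within_Icc_at)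
  qed
  show "(K has_real_derivative h t) (at t)" if "t \<in> {0..2*T}" for t using that by (intro K) auto
  have "K T - K 0 = integral {0..T} h"
    using Henstock_Kurzweil_Integration.integral_combine[of "-1" 0 T h] T continuous_on_subset[OF h(1), of "{-1..T}"]
    unfolding K_def by (simp add: integrable_continuous_real)
  moreover have "K (s + T) - K s = K (0 + T) - K 0" if s: "s \<in> {0..T}" for s
  proof (cases "s = 0")
    case False
    have d: "((\<lambda>s. K (s + T) - K s) has_real_derivative 0) (at q)" if "q \<in> {0..T}" for q
    proof -
      have "((\<lambda>s. K (s + T)) has_real_derivative h (q + T)) (at q)"
        using K[of "q + T"] that T by (simp add: DERIV_shift)
      moreover have "(K has_real_derivative h q) (at q)" using that T by (intro K) auto
      ultimately have "((\<lambda>s. K (s + T) - K s) has_real_derivative h (q + T) - h q) (at q)" by (rule DERIV_diff)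
      thus ?thesis by (simp add: h(2))
    qed
    have "continuous_on {0..s} (\<lambda>s. K (s + T) - K s)"
      by (rule DERIV_continuous_on[where D = "\<lambda>_. 0"]) (use d s in \<open>auto intro: has_field_derivative_at_within\<close>)
    from DERIV_isconst_end[OF _ this] show ?thesis using d s False by auto
  qed simp
  ultimately show "K (s + T) - K s = integral {0..T} h" if "s \<in> {0..T}" for s using that by simp
qed

context model_system
begin

lemma om1_e: "om1 u e\<^sub>\<phi> = fst (snd u)"
  by (cases u) (simp add: om1_def)

text \<open>
  A lift of the model solution through the point \<open>c\<^sub>0\<close> of the torus, with the components outside \<open>P\<close>
  kept fixed, as functions lifted from $M_0$ are constant in them.
\<close>

definition reference :: "'k coord \<Rightarrow> real \<Rightarrow> 'k coord" where
  "reference c\<^sub>0 t = (\<chi> k. if k \<in> P then c\<^sub>0 $ k + (\<nu> k * t) *\<^sub>R e\<^sub>\<phi> else c\<^sub>0 $ k)"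

text \<open>
  The solution of the equation linearised along \<open>reference c\<^sub>0\<close> with initial value \<open>v\<close>.
\<close>

definition variation :: "'k coord \<Rightarrow> real \<Rightarrow> 'k coord" where
  "variation v t = (\<chi> k. if k \<in> P then osc (A k) (\<nu> k) (v $ k) t else 0)"

definition on_torus :: "'k coord \<Rightarrow> bool" where
  "on_torus c\<^sub>0 \<longleftrightarrow> c\<^sub>0 \<in> W \<and> (\<forall>k\<in>P. snd (c\<^sub>0 $ k) = (I\<^sub>0 k, 0, 0))"

text \<open>
  On the torus the differential of \<open>H k\<close> is a multiple of \<open>dI\<close>, so the vectors tangent to the common
  level set are those without \<open>I\<close>-components.
\<close>

definition tangent :: "'k coord \<Rightarrow> bool" where
  "tangent v \<longleftrightarrow> (\<forall>k\<in>P. om1 (v $ k) e\<^sub>\<phi> = 0)"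

lemma reference_W: "c\<^sub>0 \<in> W \<Longrightarrow> reference c\<^sub>0 t \<in> W"
  by (auto simp: cover_in_phase_space reference_def zero_prod_def[symmetric])

lemma reference_continuous: "continuous_on S (reference c\<^sub>0)"
proof -
  have "continuous_on S (\<lambda>t. if k \<in> P then c\<^sub>0 $ k + (\<nu> k * t) *\<^sub>R e\<^sub>\<phi> else c\<^sub>0 $ k)" for k
    by (cases "k \<in> P") (auto intro!: continuous_intros)
  thus ?thesis unfolding reference_def[abs_def] by (intro continuous_on_vec_lambda)
qed

lemma osc_solution:
  assumes "k \<in> P" "om1 u e\<^sub>\<phi> = 0"
  shows "(osc (A k) (\<nu> k) u has_vector_derivative A k (osc (A k) (\<nu> k) u t)) (at t)"
    "om1 (osc (A k) (\<nu> k) u t) e\<^sub>\<phi> = 0"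
proof -
  interpret relative_equilibrium "\<lambda>y. \<omega> *\<^sub>R ham_field (H k) y" "A k" om1 e\<^sub>\<phi> "(0, I\<^sub>0 k, 0, 0)" "\<nu> k" T
    by (rule relative_equilibrium_component[OF assms(1)])
  have "A k (A k (A k u)) = - ((\<nu> k)\<^sup>2) *\<^sub>R A k u"
  proof -
    have s: "factor.Lin (H k) (I\<^sub>0 k) (a *\<^sub>R w) = a *\<^sub>R factor.Lin (H k) (I\<^sub>0 k) w" for a w
      by (rule linear_cmul[OF factor.linear_Lin[OF fac]])
    show ?thesis unfolding A_def s factor.Lin_cube[OF fac assms(2)]
      by (simp add: \<nu>_def power2_eq_square power3_eq_cube mult_ac)
  qed
  thus "(osc (A k) (\<nu> k) u has_vector_derivative A k (osc (A k) (\<nu> k) u t)) (at t)"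
    by (intro osc_has_vector_derivative linear_A nu)
  have "om1 (A k w) e\<^sub>\<phi> = 0" for w
    using factor.om1_Lin[OF fac, of k w] by (simp add: A_def om1_e)
  thus "om1 (osc (A k) (\<nu> k) u t) e\<^sub>\<phi> = 0" using assms(2) by (simp add: osc_def om1_e)
qed

lemma variation_continuous: assumes "tangent v" shows "continuous_on S (variation v)"
proof -
  have "continuous_on S (\<lambda>t. if k \<in> P then osc (A k) (\<nu> k) (v $ k) t else 0)" for k
  proof (cases "k \<in> P")
    case True
    hence "om1 (v $ k) e\<^sub>\<phi> = 0" using assms by (simp add: tangent_def)
    from osc_solution(1)[OF True this] have "continuous (at t) (osc (A k) (\<nu> k) (v $ k))" for t
      by (rule has_vector_derivative_continuous)
    thus ?thesis using True by (simp add: continuous_at_imp_continuous_on)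
  qed simp
  thus ?thesis unfolding variation_def[abs_def] by (intro continuous_on_vec_lambda)
qed

lemma variation_periodic: "variation v (t + T) = variation v t"
  by (simp add: variation_def vec_eq_iff osc_periodic[OF nu_T])

lemma variation_bounded:
  assumes "tangent v" obtains M where "M > 0" "\<And>t. t \<in> {0..2*T} \<Longrightarrow> norm (variation v t) \<le> M"
proof -
  have "bounded (variation v ` {0..2*T})"
    by (intro compact_imp_bounded compact_continuous_image variation_continuous assms) auto
  thus ?thesis using that unfolding bounded_pos by auto
qed

text \<open>
  The variation along a differentiable curve of initial points: \<open>linear_approximation\<close> with \<open>a = s\<close>,
  where both \<open>c s - c 0\<close> and the remainder \<open>c s - c 0 - s v\<close> are controlled by $|s|$.
\<close>

lemma component_expansion:
  assumes k: "k \<in> P" and c: "(c has_vector_derivative v) (at 0)" and c0: "snd (c 0 $ k) = (I\<^sub>0 k, 0, 0)"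
    and v: "om1 (v $ k) e\<^sub>\<phi> = 0" and \<kappa>: "\<kappa> > 0"
  shows "\<forall>\<^sub>F s in nhds 0. \<forall>z. z 0 = c s $ k \<and> (\<forall>t. (z has_vector_derivative \<omega> *\<^sub>R ham_field (H k) (z t)) (at t)) \<longrightarrow>
    (\<forall>t\<in>{0..T}. norm (z t - (c 0 $ k + (\<nu> k * t) *\<^sub>R e\<^sub>\<phi>) - s *\<^sub>R osc (A k) (\<nu> k) (v $ k) t) \<le> \<kappa> * \<bar>s\<bar>)"
proof -
  interpret relative_equilibrium "\<lambda>y. \<omega> *\<^sub>R ham_field (H k) y" "A k" om1 e\<^sub>\<phi> "(0, I\<^sub>0 k, 0, 0)" "\<nu> k" T
    by (rule relative_equilibrium_component[OF k])
  define \<theta> where "\<theta> = fst (c 0 $ k)"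
  have cyl: "cyl (\<theta> + a) = c 0 $ k + a *\<^sub>R e\<^sub>\<phi>" for a
    unfolding cyl_def \<theta>_def using c0 by (cases "c 0 $ k") (simp add: scaleR_add_left)
  define V where "V = norm (v $ k) + 1"
  have V: "V > 0" by (simp add: V_def add_nonneg_pos)
  obtain C where C: "C \<ge> 0" and C': "\<And>\<kappa>. \<kappa> > 0 \<Longrightarrow> \<exists>\<rho>>0. \<forall>z \<theta> a u. (\<forall>t. (z has_vector_derivative \<omega> *\<^sub>R ham_field (H k) (z t)) (at t)) \<and>
      norm (z 0 - cyl \<theta>) \<le> \<rho> \<and> (\<forall>t. (u has_vector_derivative A k (u t)) (at t)) \<longrightarrow>
     (\<forall>t\<in>{0..T}. norm (z t - cyl (\<theta> + \<nu> k * t) - a *\<^sub>R u t)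
        \<le> C * norm (z 0 - cyl \<theta> - a *\<^sub>R u 0) + \<kappa> * norm (z 0 - cyl \<theta>))"
    using linear_approximation by blast
  define k2 where "k2 = \<kappa> / (2 * V)"
  have k2: "k2 > 0" using \<kappa> V by (simp add: k2_def)
  obtain \<rho> where \<rho>: "\<rho> > 0" "\<And>z \<theta> a u. (\<forall>t. (z has_vector_derivative \<omega> *\<^sub>R ham_field (H k) (z t)) (at t)) \<Longrightarrow>
      norm (z 0 - cyl \<theta>) \<le> \<rho> \<Longrightarrow> (\<forall>t. (u has_vector_derivative A k (u t)) (at t)) \<Longrightarrow>
     (\<forall>t\<in>{0..T}. norm (z t - cyl (\<theta> + \<nu> k * t) - a *\<^sub>R u t)
        \<le> C * norm (z 0 - cyl \<theta> - a *\<^sub>R u 0) + k2 * norm (z 0 - cyl \<theta>))"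
    using C'[OF k2] by blast
  define q where "q = min 1 (\<kappa> / (2 * (C + 1)))"
  have q: "q > 0" "q \<le> 1" "C * q \<le> \<kappa> / 2"
  proof -
    show "q > 0" "q \<le> 1" using \<kappa> C by (auto simp: q_def)
    have "q \<le> \<kappa> / (2 * (C + 1))" by (simp add: q_def)
    hence "(C + 1) * q \<le> \<kappa> / 2" using C by (simp add: field_simps)
    thus "C * q \<le> \<kappa> / 2" using \<open>q > 0\<close> by (simp add: algebra_simps)
  qed
  have "((\<lambda>s. c s $ k) has_vector_derivative v $ k) (at 0)" by (rule has_vector_derivative_vec_nth[OF c])
  then obtain d where d: "d > 0" "\<And>s. \<bar>s\<bar> < d \<Longrightarrow> norm (c s $ k - c 0 $ k - s *\<^sub>R v $ k) \<le> q * \<bar>s\<bar>"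
    unfolding has_vector_derivative_def has_derivative_within_alt using q(1) by auto
  have "norm (z t - (c 0 $ k + (\<nu> k * t) *\<^sub>R e\<^sub>\<phi>) - s *\<^sub>R osc (A k) (\<nu> k) (v $ k) t) \<le> \<kappa> * \<bar>s\<bar>"
    if s: "\<bar>s\<bar> < min d (\<rho> / V)" and z: "z 0 = c s $ k" "\<forall>t. (z has_vector_derivative \<omega> *\<^sub>R ham_field (H k) (z t)) (at t)"
      and t: "t \<in> {0..T}" for s z t
  proof -
    have 1: "norm (z 0 - cyl \<theta> - s *\<^sub>R osc (A k) (\<nu> k) (v $ k) 0) \<le> q * \<bar>s\<bar>"
      using d(2)[of s] s z(1) cyl[of 0] by (simp add: zero_prod_def[symmetric])
    have "norm (z 0 - cyl \<theta>) \<le> norm (z 0 - cyl \<theta> - s *\<^sub>R v $ k) + norm (s *\<^sub>R v $ k)"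
      using norm_triangle_ineq[of "z 0 - cyl \<theta> - s *\<^sub>R v $ k" "s *\<^sub>R v $ k"] by simp
    also have "\<dots> \<le> q * \<bar>s\<bar> + \<bar>s\<bar> * norm (v $ k)" using 1 by simp
    also have "\<dots> \<le> 1 * \<bar>s\<bar> + \<bar>s\<bar> * norm (v $ k)" using q(2) by (intro add_right_mono mult_right_mono) auto
    also have "\<dots> = V * \<bar>s\<bar>" by (simp add: V_def algebra_simps)
    finally have 2: "norm (z 0 - cyl \<theta>) \<le> V * \<bar>s\<bar>" .
    have "V * \<bar>s\<bar> \<le> \<rho>" using s V by (simp add: field_simps)
    hence 3: "norm (z 0 - cyl \<theta>) \<le> \<rho>" using 2 by simp
    have "norm (z t - cyl (\<theta> + \<nu> k * t) - s *\<^sub>R osc (A k) (\<nu> k) (v $ k) t)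
        \<le> C * norm (z 0 - cyl \<theta> - s *\<^sub>R osc (A k) (\<nu> k) (v $ k) 0) + k2 * norm (z 0 - cyl \<theta>)"
      using \<rho>(2)[OF z(2) 3, of "osc (A k) (\<nu> k) (v $ k)" s] osc_solution(1)[OF k v] t by blast
    also have "\<dots> \<le> C * (q * \<bar>s\<bar>) + k2 * (V * \<bar>s\<bar>)" using 1 2 C k2 by (intro add_mono mult_left_mono) auto
    also have "\<dots> = C * q * \<bar>s\<bar> + \<kappa> / 2 * \<bar>s\<bar>" using V by (simp add: k2_def)
    also have "\<dots> \<le> \<kappa> / 2 * \<bar>s\<bar> + \<kappa> / 2 * \<bar>s\<bar>" using q(3) by (intro add_right_mono mult_right_mono) auto
    finally show ?thesis by (simp add: cyl)
  qed
  moreover have "min d (\<rho> / V) > 0" using d \<rho> V by simp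
  ultimately show ?thesis unfolding eventually_nhds_metric
    by (intro exI[of _ "min d (\<rho> / V)"]) (auto simp: dist_real_def)
qed

definition combine :: "'k coord \<Rightarrow> 'k coord \<Rightarrow> 'k coord" where
  "combine x y = (\<chi> k. if k \<in> P then x $ k else y $ k)"

lemma flow_expansion:
  assumes c: "(c has_vector_derivative v) (at 0)" and c0: "on_torus (c 0)" and v: "tangent v" and \<kappa>: "\<kappa> > 0"
  shows "\<forall>\<^sub>F s in nhds 0. \<forall>z. z 0 = c s \<and> (\<forall>t. (z has_vector_derivative field (z t)) (at t)) \<longrightarrow>
    (\<forall>t\<in>{0..T}. norm (combine (z t) (c 0) - reference (c 0) t - s *\<^sub>R variation v t) \<le> \<kappa> * \<bar>s\<bar>)"
proof -
  define N where "N = real CARD('k)"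
  have N: "N > 0" by (simp add: N_def)
  have "\<forall>\<^sub>F s in nhds 0. \<forall>k\<in>P. \<forall>z. z 0 = c s $ k \<and> (\<forall>t. (z has_vector_derivative \<omega> *\<^sub>R ham_field (H k) (z t)) (at t)) \<longrightarrow>
    (\<forall>t\<in>{0..T}. norm (z t - (c 0 $ k + (\<nu> k * t) *\<^sub>R e\<^sub>\<phi>) - s *\<^sub>R osc (A k) (\<nu> k) (v $ k) t) \<le> \<kappa> / N * \<bar>s\<bar>)"
    by (intro eventually_ball_finite ballI component_expansion c)
       (use c0 v \<kappa> N in \<open>auto simp: on_torus_def tangent_def\<close>)
  thus ?thesis
  proof eventually_elim
    case (elim s)
    show ?case
    proof (intro allI impI ballI)
      fix z t assume z: "z 0 = c s \<and> (\<forall>t. (z has_vector_derivative field (z t)) (at t))" and t: "t \<in> {0..T}"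
      have "norm ((combine (z t) (c 0) - reference (c 0) t - s *\<^sub>R variation v t) $ k) \<le> \<kappa> / N * \<bar>s\<bar>" for k
      proof (cases "k \<in> P")
        case True
        have "((\<lambda>t. z t $ k) has_vector_derivative \<omega> *\<^sub>R ham_field (H k) (z t $ k)) (at t)" for t
          using has_vector_derivative_vec_nth[of z "field (z t)" "at t" k] z True by (simp add: field_def)
        moreover have "z 0 $ k = c s $ k" using z by simp
        ultimately have "norm (z t $ k - (c 0 $ k + (\<nu> k * t) *\<^sub>R e\<^sub>\<phi>) - s *\<^sub>R osc (A k) (\<nu> k) (v $ k) t) \<le> \<kappa> / N * \<bar>s\<bar>"
          using elim[rule_format, OF True, of "\<lambda>t. z t $ k" t] t by simp
        thus ?thesis using True by (simp add: combine_def reference_def variation_def)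
      next
        case False
        thus ?thesis using \<kappa> N by (simp add: combine_def reference_def variation_def)
      qed
      hence "(\<Sum>k\<in>UNIV. norm ((combine (z t) (c 0) - reference (c 0) t - s *\<^sub>R variation v t) $ k)) \<le> (\<Sum>k\<in>(UNIV::'k set). \<kappa> / N * \<bar>s\<bar>)"
        by (intro sum_mono)
      also have "\<dots> = \<kappa> * \<bar>s\<bar>" using N by (simp add: N_def)
      finally show "norm (combine (z t) (c 0) - reference (c 0) t - s *\<^sub>R variation v t) \<le> \<kappa> * \<bar>s\<bar>"
        using norm_vec_le_sum order_trans by blast
    qed
  qed
qed

lemma projects_combine:
  assumes "projects_to J P R" "x \<in> W" "y \<in> W"
  shows "combine x y \<in> W" "R (cover (combine x y)) = R (cover x)"
proof -
  show W: "combine x y \<in> W" using assms by (auto simp: cover_in_phase_space combine_def)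
  have "proj P (cover (combine x y)) = proj P (cover x)"
    by (simp add: proj_def cover_def combine_def vec_eq_iff)
  thus "R (cover (combine x y)) = R (cover x)"
    using assms W unfolding projects_to_def by (metis vimageE)
qed

text \<open>
  First-order expansion in \<open>s\<close> of \<open>R\<close> along the solution starting at \<open>c s\<close>, uniformly on the period.
  The error consists of the error of the flow, multiplied by the gradient of \<open>R\<close> on the reference
  solution, and of the error of strict differentiability of \<open>R\<close>.
\<close>

lemma perturbation_expansion:
  assumes c: "(c has_vector_derivative v) (at 0)" and cW: "\<And>s. c s \<in> W" and c0: "on_torus (c 0)" and v: "tangent v" and \<kappa>: "\<kappa> > 0"
    and R: "Ck_fun 1 J R"
  shows "\<forall>\<^sub>F s in nhds 0. \<forall>z. z 0 = c s \<and> (\<forall>t. (z has_vector_derivative field (z t)) (at t)) \<longrightarrow>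
    (\<forall>t\<in>{0..T}. \<bar>(R \<circ> cover) (combine (z t) (c 0)) - (R \<circ> cover) (reference (c 0) t) - s * pd (variation v t) (R \<circ> cover) (reference (c 0) t)\<bar> \<le> \<kappa> * \<bar>s\<bar>)"
proof -
  define g where "g = R \<circ> cover"
  have g: "Ck_on 1 W g" using R by (simp add: g_def Ck_fun_def)
  have gd: "g differentiable (at x)" if "x \<in> W" for x using g that by auto
  obtain M where M: "M > 0" "\<And>t. t \<in> {0..2*T} \<Longrightarrow> norm (variation v t) \<le> M" using variation_bounded[OF v] by metis
  let ?K = "reference (c 0) ` {0..T}"
  have K: "compact ?K" by (intro compact_continuous_image reference_continuous) auto
  have KW: "?K \<subseteq> W" using reference_W[OF cW] by blast
  have "bounded (\<Union>b\<in>Basis. pd b g ` ?K)"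
    using g KW by (intro bounded_UN finite_Basis ballI compact_imp_bounded compact_continuous_image K)
      (auto intro: continuous_on_subset)
  then obtain G where G: "G > 0" "\<And>b x. b \<in> Basis \<Longrightarrow> x \<in> ?K \<Longrightarrow> \<bar>pd b g x\<bar> \<le> G"
    unfolding bounded_pos by fastforce
  define G' where "G' = DIM('k coord) * G"
  have G': "G' > 0" using G by (simp add: G'_def)
  define k1 where "k1 = \<kappa> / (2 * (M + 1))"
  have k1: "k1 > 0" using \<kappa> M by (simp add: k1_def)
  define k2 where "k2 = min 1 (\<kappa> / (2 * G'))"
  have k2: "k2 > 0" "k2 \<le> 1" "G' * k2 \<le> \<kappa> / 2"
  proof -
    show "k2 > 0" "k2 \<le> 1" using \<kappa> G' by (auto simp: k2_def)
    have "k2 \<le> \<kappa> / (2 * G')" by (simp add: k2_def)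
    thus "G' * k2 \<le> \<kappa> / 2" using G' by (simp add: field_simps)
  qed
  obtain r where r: "r > 0" "\<And>x y z. x \<in> ?K \<Longrightarrow> norm (y - x) < r \<Longrightarrow> norm (z - x) < r
      \<Longrightarrow> \<bar>g y - g z - pd (y - z) g x\<bar> \<le> k1 * norm (y - z)"
    by (rule C1_strictly_differentiable[OF open_W K KW g k1]) blast
  have "r / (M + 1) > 0" using r M by simp
  hence "\<forall>\<^sub>F s in nhds (0::real). \<bar>s\<bar> < r / (M + 1)" unfolding eventually_nhds_metric by (auto simp: dist_real_def)
  with flow_expansion[OF c c0 v k2(1)] show ?thesis
  proof eventually_elim
    case (elim s)
    show ?case unfolding g_def[symmetric]
    proof (intro allI impI ballI)
      fix z t assume z: "z 0 = c s \<and> (\<forall>t. (z has_vector_derivative field (z t)) (at t))" and t: "t \<in> {0..T}"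
      let ?y = "combine (z t) (c 0)" and ?x = "reference (c 0) t" and ?u = "variation v t"
      have x: "?x \<in> ?K" using t by blast
      have xW: "?x \<in> W" using x KW by blast
      have 1: "norm (?y - ?x - s *\<^sub>R ?u) \<le> k2 * \<bar>s\<bar>" using elim(1) z t by blast
      have Mt: "norm ?u \<le> M" using t T by (intro M(2)) auto
      have "norm (?y - ?x) \<le> norm (?y - ?x - s *\<^sub>R ?u) + norm (s *\<^sub>R ?u)"
        using norm_triangle_ineq[of "?y - ?x - s *\<^sub>R ?u" "s *\<^sub>R ?u"] by simp
      also have "\<dots> \<le> 1 * \<bar>s\<bar> + \<bar>s\<bar> * M"
        using order_trans[OF 1 mult_right_mono[OF k2(2), of "\<bar>s\<bar>"]] mult_left_mono[OF Mt, of "\<bar>s\<bar>"] by simp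
      finally have 2: "norm (?y - ?x) \<le> (M + 1) * \<bar>s\<bar>" by (simp add: algebra_simps)
      also have "\<dots> < r" using elim(2) M by (simp add: field_simps)
      finally have "\<bar>g ?y - g ?x - pd (?y - ?x) g ?x\<bar> \<le> k1 * norm (?y - ?x)" using r(2)[OF x, of ?y ?x] r(1) by simp
      also have "\<dots> \<le> k1 * ((M + 1) * \<bar>s\<bar>)" using 2 k1 by (intro mult_left_mono) auto
      also have "\<dots> = \<kappa> / 2 * \<bar>s\<bar>" using M by (simp add: k1_def field_simps)
      finally have 3: "\<bar>g ?y - g ?x - pd (?y - ?x) g ?x\<bar> \<le> \<kappa> / 2 * \<bar>s\<bar>" .
      have "\<bar>pd (?y - ?x - s *\<^sub>R ?u) g ?x\<bar> \<le> G' * norm (?y - ?x - s *\<^sub>R ?u)"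
        unfolding G'_def by (rule pd_bound[OF gd[OF xW] G(2)[OF _ x]])
      also have "\<dots> \<le> G' * (k2 * \<bar>s\<bar>)" using 1 G' by (intro mult_left_mono) auto
      also have "\<dots> \<le> \<kappa> / 2 * \<bar>s\<bar>" using mult_right_mono[OF k2(3), of "\<bar>s\<bar>"] by (simp add: mult.assoc)
      finally have 4: "\<bar>pd (?y - ?x - s *\<^sub>R ?u) g ?x\<bar> \<le> \<kappa> / 2 * \<bar>s\<bar>" .
      have "pd (?y - ?x - s *\<^sub>R ?u) g ?x = pd (?y - ?x) g ?x - s * pd ?u g ?x"
        using linear_diff[OF linear_pd[OF gd[OF xW]], of "?y - ?x" "s *\<^sub>R ?u"]
          linear_cmul[OF linear_pd[OF gd[OF xW]], of s ?u] by simp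
      thus "\<bar>g ?y - g ?x - s * pd ?u g ?x\<bar> \<le> \<kappa> * \<bar>s\<bar>" using 3 4 by linarith
    qed
  qed
qed

lemma pd_reference_continuous:
  assumes "c\<^sub>0 \<in> W" "tangent v" "Ck_fun 1 J R"
  shows "continuous_on S (\<lambda>t. pd (variation v t) (R \<circ> cover) (reference c\<^sub>0 t))"
  by (rule pd_linear_combination_continuous[of W, OF _ _ reference_continuous variation_continuous[OF assms(2)]])
    (use assms(3) reference_W[OF assms(1)] in \<open>auto simp: Ck_fun_def\<close>)

text \<open>
  Differentiation under the integral. The expansion at \<open>s = 0\<close> has no error, which identifies the
  value of the average at \<open>c 0\<close>.
\<close>

lemma average_derivative:
  assumes c: "(c has_vector_derivative v) (at 0)" and cW: "\<And>s. c s \<in> W" and c0: "on_torus (c 0)" and v: "tangent v"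
    and R: "Ck_fun 1 J R" "projects_to J P R"
  shows "((\<lambda>s. average J P F F\<^sub>1 T R (cover (c s))) has_real_derivative
     (1 / T) * integral {0..T} (\<lambda>t. pd (variation v t) (R \<circ> cover) (reference (c 0) t))) (at 0)"
proof -
  define g where "g = R \<circ> cover"
  define p where "p = (\<lambda>t. pd (variation v t) g (reference (c 0) t))"
  define a where "a = (\<lambda>s. integral {0..T} (\<lambda>t. R (lham_flow J P F F\<^sub>1 t (cover (c s)))))"
  have gc: "continuous_on W g"
    using R(1) Ck_on_mono[of 0 W g] by (simp add: g_def Ck_fun_def)
  have pc: "continuous_on {0..T} p" unfolding p_def g_def by (rule pd_reference_continuous[OF cW v R(1)])
  have ggc: "continuous_on {0..T} (\<lambda>t. g (reference (c 0) t))"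
    by (rule continuous_on_compose2[OF gc reference_continuous]) (use reference_W[OF cW] in auto)
  have key: "\<forall>\<^sub>F s in nhds 0. \<bar>a s - integral {0..T} (\<lambda>t. g (reference (c 0) t)) - s * integral {0..T} p\<bar> \<le> \<kappa> * \<bar>s\<bar>"
    if \<kappa>: "\<kappa> > 0" for \<kappa>
  proof -
    have "\<kappa> / T > 0" using \<kappa> T by simp
    from perturbation_expansion[OF c cW c0 v this R(1)] show ?thesis
    proof eventually_elim
      case (elim s)
      obtain z where z: "z 0 = c s" "\<And>t. z t \<in> W" "\<And>t. (z has_vector_derivative field (z t)) (at t)"
        using flow_exists[OF cW[of s]] by blast
      define y where "y = (\<lambda>t. g (combine (z t) (c 0)))"
      have Ry: "R (lham_flow J P F F\<^sub>1 t (cover (c s))) = y t" if "t \<in> {0..T}" for t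
        using flow_eq[OF z(2,3), of t] that projects_combine(2)[OF R(2) z(2)[of t] cW[of 0]]
        by (simp add: z(1) y_def g_def)
      have zc: "continuous_on {0..T} z"
        using z(3) by (meson continuous_at_imp_continuous_on has_vector_derivative_continuous)
      have "continuous_on {0..T} (\<lambda>t. g (z t))" by (rule continuous_on_compose2[OF gc zc]) (use z(2) in auto)
      moreover have "g (z t) = y t" for t
        unfolding y_def g_def o_def using projects_combine(2)[OF R(2) z(2)[of t] cW[of 0]] by simp
      ultimately have yc: "continuous_on {0..T} y" by simp
      have bound: "\<bar>y t - g (reference (c 0) t) - s * p t\<bar> \<le> \<kappa> / T * \<bar>s\<bar>" if "t \<in> {0..T}" for t
        using elim z(1,3) that unfolding y_def g_def p_def by blast
      have "a s = integral {0..T} y" unfolding a_def by (rule integral_cong) (rule Ry)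
      moreover from this have "a s - integral {0..T} (\<lambda>t. g (reference (c 0) t)) - s * integral {0..T} p
         = integral {0..T} (\<lambda>t. y t - g (reference (c 0) t) - s * p t)"
      proof -
        have "integral {0..T} (\<lambda>t. y t - g (reference (c 0) t) - s * p t)
           = integral {0..T} (\<lambda>t. y t - g (reference (c 0) t)) - integral {0..T} (\<lambda>t. s * p t)"
          by (intro integral_diff integrable_continuous_real continuous_intros yc ggc pc)
        also have "integral {0..T} (\<lambda>t. y t - g (reference (c 0) t)) = integral {0..T} y - integral {0..T} (\<lambda>t. g (reference (c 0) t))"
          by (intro integral_diff integrable_continuous_real yc ggc)
        finally show ?thesis using \<open>a s = integral {0..T} y\<close> by simp
      qed
      moreover have "norm (integral {0..T} (\<lambda>t. y t - g (reference (c 0) t) - s * p t)) \<le> \<kappa> / T * \<bar>s\<bar> * (T - 0)"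
        using T bound by (intro integral_bound continuous_intros yc ggc pc) auto
      ultimately show ?case using T by simp
    qed
  qed
  have a0: "a 0 = integral {0..T} (\<lambda>t. g (reference (c 0) t))"
    using eventually_nhds_x_imp_x[OF key[OF zero_less_one]] by simp
  have "(a has_real_derivative integral {0..T} p) (at 0)"
    unfolding has_field_derivative_def has_derivative_within_alt
  proof (intro conjI allI impI)
    show "bounded_linear ((*) (integral {0..T} p))" by (rule bounded_linear_mult_right)
    fix \<kappa> :: real assume "\<kappa> > 0"
    from key[OF this] obtain d where "d > 0" "\<And>s. \<bar>s\<bar> < d \<Longrightarrow>
      \<bar>a s - integral {0..T} (\<lambda>t. g (reference (c 0) t)) - s * integral {0..T} p\<bar> \<le> \<kappa> * \<bar>s\<bar>"
      unfolding eventually_nhds_metric by (auto simp: dist_real_def)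
    thus "\<exists>d>0. \<forall>y\<in>UNIV. norm (y - 0) < d \<longrightarrow> norm (a y - a 0 - integral {0..T} p * (y - 0)) \<le> \<kappa> * norm (y - 0)"
      by (intro exI[of _ d]) (auto simp: a0 mult.commute)
  qed
  from DERIV_cmult[OF this, of "1 / T"] show ?thesis
    unfolding average_def a_def p_def g_def .
qed

text \<open>
  Along a curve in the level set the energies \<open>H k\<close> are constant, so its velocity is \<open>tangent\<close> and
  \<open>average_derivative\<close> applies.
\<close>

lemma noncritical_point:
  assumes x: "x \<in> cyl_torus I\<^sub>0" and R: "Ck_fun 1 J R" "projects_to J P R"
    and nc: "\<not> critical_point_on (level_set J P H I\<^sub>0) (average J P F F\<^sub>1 T R) x"
  shows "\<exists>c\<^sub>0 v. cover c\<^sub>0 = x \<and> on_torus c\<^sub>0 \<and> tangent v \<and>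
    integral {0..T} (\<lambda>t. pd (variation v t) (R \<circ> cover) (reference c\<^sub>0 t)) \<noteq> 0"
proof -
  have xs: "\<exists>z. x $ k = (z, I\<^sub>0 k, 0, 0) \<and> z \<in> sphere 0 1" for k
  proof -
    have "x $ k \<in> sphere 0 1 \<times> {I\<^sub>0 k} \<times> {0} \<times> {0}" using x by (simp add: cyl_torus_def)
    thus ?thesis by (cases "x $ k") auto
  qed
  have "x $ k \<in> phase_space1 (J k)" "lift_ham H k x = H k (I\<^sub>0 k, 0, 0)" for k
    using xs[of k] I0_J[of k] by (auto simp: phase_space1_def lift_ham_def fun1_def)
  hence "x \<in> level_set J P H I\<^sub>0" unfolding level_set_def phase_space_def by blast
  then obtain c v where c: "cover (c 0) = x" "\<And>t. cover (c t) \<in> level_set J P H I\<^sub>0" "(c has_vector_derivative v) (at 0)"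
    "\<not> ((\<lambda>t. average J P F F\<^sub>1 T R (cover (c t))) has_real_derivative 0) (at 0)"
    using nc unfolding critical_point_on_def by blast
  have cW: "c s \<in> W" for s using c(2)[of s] by (auto simp: level_set_def)
  have sc: "snd (c 0 $ k) = (I\<^sub>0 k, 0, 0)" for k
  proof -
    have "x $ k = cover1 (c 0 $ k)" by (simp add: c(1)[symmetric] cover_def)
    thus ?thesis using xs[of k] by (cases "c 0 $ k") (auto simp: cover1_def)
  qed
  have ot: "on_torus (c 0)" using cW sc by (simp add: on_torus_def)
  have tan: "tangent v" unfolding tangent_def om1_e
  proof
    fix k assume k: "k \<in> P"
    have Hc: "H k (snd (c t $ k)) = H k (I\<^sub>0 k, 0, 0)" for t
      using c(2)[of t] k by (auto simp: level_set_def lift_ham_def fun1_def cover_def cover1_def split_beta)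
    have d: "H k differentiable (at (snd (c 0 $ k)))" by (rule H_diff[OF cW])
    have "((\<lambda>t. snd (c t $ k)) has_vector_derivative snd (v $ k)) (at 0)"
      by (intro bounded_linear.has_vector_derivative[OF bounded_linear_snd] has_vector_derivative_vec_nth c(3))
    hence "((\<lambda>t. H k (snd (c t $ k))) has_derivative (\<lambda>h. pd (h *\<^sub>R snd (v $ k)) (H k) (snd (c 0 $ k)))) (at 0)"
      unfolding has_vector_derivative_def
      by (rule has_derivative_compose[where f = "\<lambda>t. snd (c t $ k)" and g = "H k", OF _ has_derivative_pd[OF d]])
    moreover have "((\<lambda>t. H k (snd (c t $ k))) has_derivative (\<lambda>h. 0)) (at 0)" unfolding Hc by simp
    ultimately have "(\<lambda>h. pd (h *\<^sub>R snd (v $ k)) (H k) (snd (c 0 $ k))) = (\<lambda>h. 0)" by (rule has_derivative_unique)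
    from fun_cong[OF this, of 1] have z: "pd (snd (v $ k)) (H k) (I\<^sub>0 k, 0, 0) = 0" by (simp add: sc)
    obtain q i b p where vk: "v $ k = (q, i, b, p)" by (metis prod.exhaust)
    have "i * freq (H k) (\<tau> k) (I\<^sub>0 k) = 0"
      using z pd_real3[OF d, of i b p] factor.on_cylinder[OF fac I0_J]
      by (simp add: vk sc factor.hI_def[OF fac] factor.hq_def[OF fac] factor.hp_def[OF fac])
    thus "fst (snd (v $ k)) = 0" using factor.freq_nonzero[OF fac] by (simp add: vk)
  qed
  have "integral {0..T} (\<lambda>t. pd (variation v t) (R \<circ> cover) (reference (c 0) t)) \<noteq> 0"
    using average_derivative[OF c(3) cW ot tan R] c(4) by auto
  thus ?thesis using c(1) ot tan by blast
qed

section \<open>Forced curves near the torus\<close>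

text \<open>
  The conclusion of \<open>small_drift\<close> for the factor \<open>k\<close> with the threshold \<open>\<rho>\<close>.
\<close>

definition drift_controlled :: "'k \<Rightarrow> real \<Rightarrow> real \<Rightarrow> real \<Rightarrow> real \<Rightarrow> real \<Rightarrow> bool" where
  "drift_controlled k \<eta> D G M \<rho> \<longleftrightarrow> (\<forall>x f u \<theta> \<mu> T' \<alpha> (m::int).
     0 < \<mu> \<and> \<mu> \<le> \<rho> \<and> norm (x 0 - (\<theta>, I\<^sub>0 k, 0, 0)) \<le> \<rho> \<and>
     (\<forall>t. (x has_vector_derivative \<omega> *\<^sub>R ham_field (H k) (x t) + f t) (at t)) \<and> (\<forall>t. norm (f t) \<le> G * \<mu>) \<and>
     (\<forall>t. (u has_vector_derivative A k (u t)) (at t)) \<and> (\<forall>t\<in>{0..T}. norm (u t) \<le> M \<and> om1 (u t) e\<^sub>\<phi> = 0) \<and>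
     \<bar>T' - T\<bar> \<le> D * \<mu> \<and> \<bar>\<alpha>\<bar> \<le> D * \<mu> \<and> x T' = x 0 + (\<alpha> + 2 * pi * of_int m) *\<^sub>R e\<^sub>\<phi> \<longrightarrow>
     (\<forall>t\<in>{0..T}. norm (x t - (\<theta> + \<nu> k * t, I\<^sub>0 k, 0, 0)) \<le> \<eta>) \<and>
     (\<exists>S S'. S 0 = 0 \<and> \<bar>S T\<bar> \<le> \<eta> * \<mu> \<and>
       (\<forall>t\<in>{0..T}. (S has_real_derivative S' t) (at t) \<and> \<bar>S' t - om1 (u t) (f t)\<bar> \<le> \<eta> * \<mu>)))"

lemma component_drift:
  assumes k: "k \<in> P" and \<eta>: "\<eta> > 0" and D: "D \<ge> 0" and G: "G \<ge> 0" and M: "M \<ge> 0"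
  shows "\<exists>\<rho>>0. drift_controlled k \<eta> D G M \<rho>"
proof -
  interpret relative_equilibrium "\<lambda>y. \<omega> *\<^sub>R ham_field (H k) y" "A k" om1 e\<^sub>\<phi> "(0, I\<^sub>0 k, 0, 0)" "\<nu> k" T
    by (rule relative_equilibrium_component[OF k])
  have "cyl \<theta> = (\<theta>, I\<^sub>0 k, 0, 0)" for \<theta> by (simp add: cyl_def)
  thus ?thesis using small_drift[OF \<eta> D G M] by (simp add: drift_controlled_def)
qed

lemma shifted_variation:
  assumes k: "k \<in> P" and v: "tangent v"
  shows "((\<lambda>t. variation v (s + t) $ k) has_vector_derivative A k (variation v (s + t) $ k)) (at t)"
    "om1 (variation v (s + t) $ k) e\<^sub>\<phi> = 0"
proof -
  have vk: "om1 (v $ k) e\<^sub>\<phi> = 0" using v k by (simp add: tangent_def)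
  have "((\<lambda>t. s + t) has_vector_derivative 1) (at t)" by (auto intro!: derivative_eq_intros)
  from vector_diff_chain_at[OF this osc_solution(1)[OF k vk]]
  show "((\<lambda>t. variation v (s + t) $ k) has_vector_derivative A k (variation v (s + t) $ k)) (at t)"
    using k by (simp add: variation_def o_def)
  show "om1 (variation v (s + t) $ k) e\<^sub>\<phi> = 0" using osc_solution(2)[OF k vk] k by (simp add: variation_def)
qed

lemma pd_reference_periodic: "pd (variation v (t + T)) (R \<circ> cover) (reference c\<^sub>0 (t + T)) = pd (variation v t) (R \<circ> cover) (reference c\<^sub>0 t)"
proof -
  define a :: "'k coord" where "a = (\<chi> k. (2 * pi * of_int (if k \<in> P then l k else 0)) *\<^sub>R e\<^sub>\<phi>)"
  have "reference c\<^sub>0 (t + T) = reference c\<^sub>0 t + a"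
    using nu_T by (simp add: reference_def a_def vec_eq_iff distrib_left zero_prod_def[symmetric])
  moreover have "cover (y + a) = cover y" for y
    unfolding cover_eq_iff a_def by (rule exI[of _ "\<lambda>k. if k \<in> P then l k else 0"]) (rule refl)
  ultimately show ?thesis by (simp add: pd_shift variation_periodic o_def)
qed

text \<open>
  The angles of \<open>x\<close> turned back by \<open>b\<close>, and the components outside \<open>P\<close> replaced by those of \<open>c\<^sub>0\<close>.
  The shift \<open>b\<close> accounts for the rotation and the full turns by which a curve close to \<open>\<gamma>\<close> differs from
  one close to \<open>reference c\<^sub>0\<close>.
\<close>

definition unshift :: "'k coord \<Rightarrow> ('k \<Rightarrow> real) \<Rightarrow> 'k coord \<Rightarrow> 'k coord" where
  "unshift c\<^sub>0 b x = (\<chi> k. if k \<in> P then x $ k - b k *\<^sub>R e\<^sub>\<phi> else c\<^sub>0 $ k)"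

lemma reference_component:
  assumes "on_torus c\<^sub>0" "k \<in> P"
  shows "c\<^sub>0 $ k + a *\<^sub>R e\<^sub>\<phi> = (fst (c\<^sub>0 $ k) + a, I\<^sub>0 k, 0, 0)"
proof -
  have "snd (c\<^sub>0 $ k) = (I\<^sub>0 k, 0, 0)" using assms by (simp add: on_torus_def)
  thus ?thesis by (cases "c\<^sub>0 $ k") simp
qed

lemma norm_unshift_reference_le:
  fixes \<eta> :: real
  assumes "\<And>k. k \<in> P \<Longrightarrow> norm (x $ k - (c\<^sub>0 $ k + (\<nu> k * t + b k) *\<^sub>R e\<^sub>\<phi>)) \<le> \<eta>"
  shows "norm (unshift c\<^sub>0 b x - reference c\<^sub>0 t) \<le> card P * \<eta>"
proof -
  have "norm (unshift c\<^sub>0 b x - reference c\<^sub>0 t) \<le> (\<Sum>k\<in>UNIV. norm ((unshift c\<^sub>0 b x - reference c\<^sub>0 t) $ k))"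
    by (rule norm_vec_le_sum)
  also have "\<dots> = (\<Sum>k\<in>P. norm ((unshift c\<^sub>0 b x - reference c\<^sub>0 t) $ k))"
    by (rule sum.mono_neutral_right) (auto simp: unshift_def reference_def)
  also have "\<dots> \<le> (\<Sum>k\<in>P. \<eta>)"
  proof (rule sum_mono)
    fix k assume k: "k \<in> P"
    have "(unshift c\<^sub>0 b x - reference c\<^sub>0 t) $ k = x $ k - (c\<^sub>0 $ k + (\<nu> k * t + b k) *\<^sub>R e\<^sub>\<phi>)"
      using k by (simp add: unshift_def reference_def scaleR_add_left del: scaleR_Pair)
    thus "norm ((unshift c\<^sub>0 b x - reference c\<^sub>0 t) $ k) \<le> \<eta>" using assms[OF k] by simp
  qed
  finally show ?thesis by simp
qed

text \<open>
  The $M_0$-component of a relatively periodic solution of the perturbed system, as far as it matters: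
  the curve \<open>x\<close> starts near the point \<open>reference c\<^sub>0 s\<close> turned by \<open>b\<close>, the force \<open>f\<close> is of order \<open>\<mu>\<close>, and
  up to \<open>\<rho> \<mu>\<close> it is the Hamiltonian vector field of $\omega\mu R$. The term \<open>m k\<close> counts the full turns in
  the factor \<open>k\<close>.
\<close>

definition perturbed_curve where
  "perturbed_curve R c\<^sub>0 G D \<rho> x f s b \<mu> T' \<alpha> (m :: 'k \<Rightarrow> int) \<longleftrightarrow> 0 < \<mu> \<and> \<mu> \<le> \<rho> \<and> s \<in> {0..T} \<and>
    (\<forall>k\<in>P. norm (x 0 $ k - (c\<^sub>0 $ k + (\<nu> k * s + b k) *\<^sub>R e\<^sub>\<phi>)) \<le> \<rho>) \<and>
    (\<forall>k\<in>P. \<forall>t. ((\<lambda>t. x t $ k) has_vector_derivative \<omega> *\<^sub>R ham_field (H k) (x t $ k) + f t k) (at t) \<and> norm (f t k) \<le> G * \<mu>) \<and>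
    \<bar>T' - T\<bar> \<le> D * \<mu> \<and> \<bar>\<alpha>\<bar> \<le> D * \<mu> \<and> (\<forall>k\<in>P. x T' $ k = x 0 $ k + (\<alpha> + 2 * pi * of_int (m k)) *\<^sub>R e\<^sub>\<phi>) \<and>
    (\<forall>t u. (\<forall>k. k \<notin> P \<longrightarrow> u $ k = 0) \<longrightarrow>
       \<bar>(\<Sum>k\<in>P. om1 (u $ k) (f t k)) - \<omega> * \<mu> * pd u (R \<circ> cover) (unshift c\<^sub>0 b (x t))\<bar> \<le> \<rho> * \<mu> * norm u)"

text \<open>
  Sum the functions \<open>S\<close> of \<open>small_drift\<close> over the factors in \<open>P\<close>. The end value of the sum is small
  compared with \<open>\<mu>\<close>; its derivative is $\omega\mu$ times the derivative of \<open>R\<close> along the reference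
  solution in the direction of the variation, up to an error small compared with \<open>\<mu>\<close>. The integral of
  the latter over the period starting at \<open>s\<close> equals the integral over \<open>{0..T}\<close>, which is not \<open>0\<close>.
\<close>

lemma no_relative_periodic_curve:
  assumes c0: "on_torus c\<^sub>0" and v: "tangent v" and R: "Ck_fun 1 J R"
    and ne: "integral {0..T} (\<lambda>t. pd (variation v t) (R \<circ> cover) (reference c\<^sub>0 t)) \<noteq> 0" and D: "D \<ge> 0" and G: "G \<ge> 0"
  shows "\<exists>\<rho>>0. \<forall>x f s b \<mu> T' \<alpha> m. \<not> perturbed_curve R c\<^sub>0 G D \<rho> x f s b \<mu> T' \<alpha> m"
proof -
  define g where "g = R \<circ> cover"
  define h where "h = (\<lambda>t. pd (variation v t) g (reference c\<^sub>0 t))"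
  define kap where "kap = integral {0..T} h"
  define q where "q = \<omega> * \<bar>kap\<bar>"
  have q: "q > 0" using ne \<omega> by (simp add: q_def kap_def h_def g_def)
  have c0W: "c\<^sub>0 \<in> W" using c0 by (simp add: on_torus_def)
  obtain M where M: "M > 0" "\<And>t. t \<in> {0..2*T} \<Longrightarrow> norm (variation v t) \<le> M" using variation_bounded[OF v] by metis
  (* The constants eta1, eta and rho0 make three error terms at most q / 4 each, so that they cannot
     add up to q. *)
  define \<eta>1 where "\<eta>1 = q / (4 * T * \<omega> * M)"
  have \<eta>1: "\<eta>1 > 0" using q T \<omega> M by (simp add: \<eta>1_def)
  let ?K = "reference c\<^sub>0 ` {0..2*T}"
  have K: "compact ?K" by (intro compact_continuous_image reference_continuous) auto
  have KW: "?K \<subseteq> W" using reference_W[OF c0W] by blast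
  have g: "Ck_on 1 W g" using R by (simp add: g_def Ck_fun_def)
  obtain r where r: "r > 0" "\<And>x y u. x \<in> ?K \<Longrightarrow> norm (y - x) < r \<Longrightarrow> \<bar>pd u g y - pd u g x\<bar> \<le> \<eta>1 * norm u"
    by (rule C1_uniform_pd[OF open_W K KW g \<eta>1]) blast
  define N where "N = real (card P) + 1"
  have N: "N > 0" "real (card P) \<le> N" by (simp_all add: N_def add_nonneg_pos)
  define \<eta> where "\<eta> = min (r / (2 * N)) (q / (4 * N * (1 + T)))"
  have \<eta>: "\<eta> > 0" "N * \<eta> < r" "N * \<eta> * (1 + T) \<le> q / 4"
  proof -
    show "\<eta> > 0" using r q N T by (simp add: \<eta>_def)
    have "N * \<eta> \<le> N * (r / (2 * N))" using N by (intro mult_left_mono) (auto simp: \<eta>_def)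
    also have "\<dots> < r" using N r by simp
    finally show "N * \<eta> < r" .
    have "\<eta> \<le> q / (4 * N * (1 + T))" by (simp add: \<eta>_def)
    hence "N * (1 + T) * \<eta> \<le> N * (1 + T) * (q / (4 * N * (1 + T)))" using N T by (intro mult_left_mono) auto
    also have "\<dots> = q / 4"
    proof -
      define z where "z = N * (1 + T)"
      have "z \<noteq> 0" "4 * N * (1 + T) = 4 * z" using N T by (simp_all add: z_def)
      thus ?thesis unfolding z_def[symmetric] by simp
    qed
    finally show "N * \<eta> * (1 + T) \<le> q / 4" by (simp add: mult_ac)
  qed
  define \<rho>0 where "\<rho>0 = q / (4 * T * M)"
  have \<rho>0: "\<rho>0 > 0" "T * \<rho>0 * M = q / 4" using q T M by (auto simp: \<rho>0_def)
  have "\<forall>k\<in>P. \<exists>\<rho>>0. drift_controlled k \<eta> D G M \<rho>"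
    using component_drift[OF _ \<eta>(1) D G] M(1) by simp
  then obtain rk where rk: "\<And>k. k \<in> P \<Longrightarrow> rk k > 0" "\<And>k. k \<in> P \<Longrightarrow> drift_controlled k \<eta> D G M (rk k)" by metis
  define \<rho> where "\<rho> = Min (insert \<rho>0 (rk ` P))"
  have \<rho>: "\<rho> > 0" "\<rho> \<le> \<rho>0" "\<And>k. k \<in> P \<Longrightarrow> \<rho> \<le> rk k"
  proof -
    show "\<rho> > 0" unfolding \<rho>_def using \<rho>0 rk(1) by (subst Min_gr_iff) auto
    show "\<rho> \<le> \<rho>0" "\<And>k. k \<in> P \<Longrightarrow> \<rho> \<le> rk k" unfolding \<rho>_def by (auto intro!: Min_le)
  qed
  have hc: "continuous_on UNIV h" unfolding h_def g_def by (rule pd_reference_continuous[OF c0W v R])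
  have hp: "h (t + T) = h t" for t unfolding h_def g_def by (rule pd_reference_periodic)
  obtain Kd where Kd: "\<And>t. t \<in> {0..2*T} \<Longrightarrow> (Kd has_real_derivative h t) (at t)"
    "\<And>s. s \<in> {0..T} \<Longrightarrow> Kd (s + T) - Kd s = kap"
    unfolding kap_def by (rule periodic_antiderivative[OF hc hp T]) blast
  show ?thesis
  proof (intro exI[of _ \<rho>] conjI[OF \<rho>(1)] allI notI)
    fix x :: "real \<Rightarrow> 'k coord" and f s b \<mu> T' \<alpha> and m :: "'k \<Rightarrow> int"
    assume "perturbed_curve R c\<^sub>0 G D \<rho> x f s b \<mu> T' \<alpha> m"
    note as = this[unfolded perturbed_curve_def]
    have \<mu>: "0 < \<mu>" "\<mu> \<le> \<rho>" and s: "s \<in> {0..T}" using as by blast+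
    have init: "norm (x 0 $ k - (c\<^sub>0 $ k + (\<nu> k * s + b k) *\<^sub>R e\<^sub>\<phi>)) \<le> \<rho>" if "k \<in> P" for k using as that by blast
    have dx: "((\<lambda>t. x t $ k) has_vector_derivative \<omega> *\<^sub>R ham_field (H k) (x t $ k) + f t k) (at t)" "norm (f t k) \<le> G * \<mu>"
      if "k \<in> P" for k t using as that by blast+
    have per: "\<bar>T' - T\<bar> \<le> D * \<mu>" "\<bar>\<alpha>\<bar> \<le> D * \<mu>" using as by blast+
    have xT: "x T' $ k = x 0 $ k + (\<alpha> + 2 * pi * of_int (m k)) *\<^sub>R e\<^sub>\<phi>" if "k \<in> P" for k using as that by blast
    have force: "\<bar>(\<Sum>k\<in>P. om1 (u $ k) (f t k)) - \<omega> * \<mu> * pd u g (unshift c\<^sub>0 b (x t))\<bar> \<le> \<rho> * \<mu> * norm u"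
      if "\<And>k. k \<notin> P \<Longrightarrow> u $ k = 0" for t u using as that unfolding g_def by blast
    have linM: "norm (variation v (s + t)) \<le> M" if "t \<in> {0..T}" for t using that s by (intro M(2)) auto
    have "\<forall>k\<in>P. \<exists>S S'. (\<forall>t\<in>{0..T}. norm (x t $ k - (c\<^sub>0 $ k + (\<nu> k * (s + t) + b k) *\<^sub>R e\<^sub>\<phi>)) \<le> \<eta>) \<and>
       S 0 = 0 \<and> \<bar>S T\<bar> \<le> \<eta> * \<mu> \<and>
       (\<forall>t\<in>{0..T}. (S has_real_derivative S' t) (at t) \<and> \<bar>S' t - om1 (variation v (s + t) $ k) (f t k)\<bar> \<le> \<eta> * \<mu>)"
    proof
      fix k assume k: "k \<in> P"
      define \<theta> where "\<theta> = fst (c\<^sub>0 $ k) + (\<nu> k * s + b k)"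
      have 1: "(\<theta> + \<nu> k * t, I\<^sub>0 k, 0, 0) = c\<^sub>0 $ k + (\<nu> k * (s + t) + b k) *\<^sub>R e\<^sub>\<phi>" for t
        unfolding reference_component[OF c0 k] \<theta>_def by (simp add: algebra_simps)
      have 2: "norm (x 0 $ k - (\<theta>, I\<^sub>0 k, 0, 0)) \<le> rk k"
        using init[OF k] \<rho>(3)[OF k] 1[of 0] by simp
      have 3: "norm (variation v (s + t) $ k) \<le> M" if "t \<in> {0..T}" for t
        using linM[OF that] Finite_Cartesian_Product.norm_nth_le order_trans by blast
      have "\<mu> \<le> rk k" using \<mu> \<rho>(3)[OF k] by simp
      note controlled = rk(2)[OF k, unfolded drift_controlled_def, THEN spec[of _ "\<lambda>t. x t $ k"],
          THEN spec[of _ "\<lambda>t. f t k"], THEN spec[of _ "\<lambda>t. variation v (s + t) $ k"], THEN spec[of _ \<theta>],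
          THEN spec[of _ \<mu>], THEN spec[of _ T'], THEN spec[of _ \<alpha>], THEN spec[of _ "m k"], THEN mp]
      have "(\<forall>t\<in>{0..T}. norm (x t $ k - (\<theta> + \<nu> k * t, I\<^sub>0 k, 0, 0)) \<le> \<eta>) \<and>
         (\<exists>S S'. S 0 = 0 \<and> \<bar>S T\<bar> \<le> \<eta> * \<mu> \<and>
         (\<forall>t\<in>{0..T}. (S has_real_derivative S' t) (at t) \<and> \<bar>S' t - om1 (variation v (s + t) $ k) (f t k)\<bar> \<le> \<eta> * \<mu>))"
        by (rule controlled) (use \<mu>(1) \<open>\<mu> \<le> rk k\<close> 2 dx[OF k] shifted_variation[OF k v] 3 per xT[OF k] in blast)
      thus "\<exists>S S'. (\<forall>t\<in>{0..T}. norm (x t $ k - (c\<^sub>0 $ k + (\<nu> k * (s + t) + b k) *\<^sub>R e\<^sub>\<phi>)) \<le> \<eta>) \<and>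
       S 0 = 0 \<and> \<bar>S T\<bar> \<le> \<eta> * \<mu> \<and>
       (\<forall>t\<in>{0..T}. (S has_real_derivative S' t) (at t) \<and> \<bar>S' t - om1 (variation v (s + t) $ k) (f t k)\<bar> \<le> \<eta> * \<mu>)"
        unfolding 1 by blast
    qed
    then obtain S where "\<forall>k\<in>P. \<exists>S'. (\<forall>t\<in>{0..T}. norm (x t $ k - (c\<^sub>0 $ k + (\<nu> k * (s + t) + b k) *\<^sub>R e\<^sub>\<phi>)) \<le> \<eta>) \<and>
       S k 0 = 0 \<and> \<bar>S k T\<bar> \<le> \<eta> * \<mu> \<and>
       (\<forall>t\<in>{0..T}. (S k has_real_derivative S' t) (at t) \<and> \<bar>S' t - om1 (variation v (s + t) $ k) (f t k)\<bar> \<le> \<eta> * \<mu>)"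
      unfolding bchoice_iff by blast
    then obtain S' where SS: "\<forall>k\<in>P. (\<forall>t\<in>{0..T}. norm (x t $ k - (c\<^sub>0 $ k + (\<nu> k * (s + t) + b k) *\<^sub>R e\<^sub>\<phi>)) \<le> \<eta>) \<and>
       S k 0 = 0 \<and> \<bar>S k T\<bar> \<le> \<eta> * \<mu> \<and>
       (\<forall>t\<in>{0..T}. (S k has_real_derivative S' k t) (at t) \<and> \<bar>S' k t - om1 (variation v (s + t) $ k) (f t k)\<bar> \<le> \<eta> * \<mu>)"
      unfolding bchoice_iff by blast
    (* E is the difference of the two evaluations of the symplectic form. *)
    define E where "E = (\<lambda>t. (\<Sum>k\<in>P. S k t) - \<omega> * \<mu> * (Kd (s + t) - Kd s))"
    define E' where "E' = (\<lambda>t. (\<Sum>k\<in>P. S' k t) - \<omega> * \<mu> * h (s + t))"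
    have cardN: "real (card P) * (\<eta> * \<mu>) \<le> N * (\<eta> * \<mu>)" using N \<eta> \<mu> by (intro mult_right_mono) auto
    have dE: "(E has_vector_derivative E' t) (at t within {0..T})" if t: "t \<in> {0..T}" for t
    proof -
      have "(Kd has_real_derivative h (t + s)) (at (t + s))" using t s by (intro Kd(1)) auto
      hence "((\<lambda>t. Kd (t + s)) has_real_derivative h (t + s)) (at t)" by (simp only: DERIV_shift)
      hence "((\<lambda>t. Kd (s + t)) has_real_derivative h (s + t)) (at t)" by (simp only: add.commute[of s])
      hence "(E has_real_derivative (\<Sum>k\<in>P. S' k t) - \<omega> * \<mu> * (h (s + t) - 0)) (at t)"
        unfolding E_def
      proof (intro DERIV_diff[OF DERIV_sum DERIV_cmult[OF DERIV_diff[OF _ DERIV_const]]])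
        show "(S k has_real_derivative S' k t) (at t)" if "k \<in> P" for k using SS that t by blast
      qed
      thus ?thesis unfolding E'_def has_real_derivative_iff_has_vector_derivative[symmetric]
        by (auto intro: has_field_derivative_at_within)
    qed
    define B where "B = N * \<eta> + \<rho> * M + \<omega> * (\<eta>1 * M)"
    have E'B: "norm (E' t) \<le> B * \<mu>" if t: "t \<in> {0..T}" for t
    proof -
      let ?u = "variation v (s + t)" and ?y = "unshift c\<^sub>0 b (x t)"
      have "\<bar>(\<Sum>k\<in>P. S' k t) - (\<Sum>k\<in>P. om1 (?u $ k) (f t k))\<bar> \<le> (\<Sum>k\<in>P. \<bar>S' k t - om1 (?u $ k) (f t k)\<bar>)"
        unfolding sum_subtractf[symmetric] by (rule sum_abs)
      also have "\<dots> \<le> (\<Sum>k\<in>P. \<eta> * \<mu>)" using SS t by (intro sum_mono) blast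
      finally have a: "\<bar>(\<Sum>k\<in>P. S' k t) - (\<Sum>k\<in>P. om1 (?u $ k) (f t k))\<bar> \<le> N * (\<eta> * \<mu>)" using cardN by simp
      have "\<bar>(\<Sum>k\<in>P. om1 (?u $ k) (f t k)) - \<omega> * \<mu> * pd ?u g ?y\<bar> \<le> \<rho> * \<mu> * norm ?u"
        by (rule force) (simp add: variation_def)
      also have "\<dots> \<le> \<rho> * \<mu> * M" using linM[OF t] \<rho> \<mu> by (intro mult_left_mono) auto
      finally have b: "\<bar>(\<Sum>k\<in>P. om1 (?u $ k) (f t k)) - \<omega> * \<mu> * pd ?u g ?y\<bar> \<le> \<rho> * \<mu> * M" .
      have "norm (?y - reference c\<^sub>0 (s + t)) \<le> card P * \<eta>" using SS t by (intro norm_unshift_reference_le) blast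
      also have "\<dots> \<le> N * \<eta>" using N \<eta> by (intro mult_right_mono) auto
      also have "\<dots> < r" by (rule \<eta>(2))
      finally have "\<bar>pd ?u g ?y - pd ?u g (reference c\<^sub>0 (s + t))\<bar> \<le> \<eta>1 * norm ?u"
        using s t by (intro r(2)) auto
      also have "\<dots> \<le> \<eta>1 * M" using linM[OF t] \<eta>1 by (intro mult_left_mono) auto
      finally have "\<omega> * \<mu> * \<bar>pd ?u g ?y - h (s + t)\<bar> \<le> \<omega> * \<mu> * (\<eta>1 * M)"
        using \<omega> \<mu> unfolding h_def by (intro mult_left_mono) auto
      hence c: "\<bar>\<omega> * \<mu> * pd ?u g ?y - \<omega> * \<mu> * h (s + t)\<bar> \<le> \<omega> * \<mu> * (\<eta>1 * M)"
        using \<omega> \<mu> by (simp add: right_diff_distrib[symmetric] abs_mult)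
      have "B * \<mu> = N * (\<eta> * \<mu>) + \<rho> * \<mu> * M + \<omega> * \<mu> * (\<eta>1 * M)" by (simp add: B_def algebra_simps)
      thus ?thesis using a b c unfolding E'_def real_norm_def by linarith
    qed
    have "norm (E T - E 0) \<le> B * \<mu> * \<bar>T - 0\<bar>"
      by (rule vector_mvt_bound[OF dE E'B]) (use T in auto)
    moreover have "E 0 = 0" using SS by (simp add: E_def)
    moreover have "E T = (\<Sum>k\<in>P. S k T) - \<omega> * \<mu> * kap" using Kd(2)[OF s] by (simp add: E_def)
    moreover have "\<bar>\<Sum>k\<in>P. S k T\<bar> \<le> N * (\<eta> * \<mu>)"
    proof -
      have "\<bar>\<Sum>k\<in>P. S k T\<bar> \<le> (\<Sum>k\<in>P. \<bar>S k T\<bar>)" by (rule sum_abs)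
      also have "\<dots> \<le> (\<Sum>k\<in>P. \<eta> * \<mu>)" using SS by (intro sum_mono) blast
      finally show ?thesis using cardN by simp
    qed
    moreover have "\<bar>\<omega> * \<mu> * kap\<bar> = q * \<mu>" using \<omega> \<mu> by (simp add: q_def abs_mult)
    ultimately have "q * \<mu> \<le> N * (\<eta> * \<mu>) + B * \<mu> * T" using T by simp
    hence "q * \<mu> \<le> (N * \<eta> + B * T) * \<mu>" by (simp add: algebra_simps)
    hence "q \<le> N * \<eta> + B * T" using \<mu> by simp
    also have "\<dots> = N * \<eta> * (1 + T) + T * \<rho> * M + T * \<omega> * \<eta>1 * M" by (simp add: B_def algebra_simps)
    also have "T * \<omega> * \<eta>1 * M = q / 4" using T \<omega> M by (simp add: \<eta>1_def)
    also have "T * \<rho> * M \<le> T * \<rho>0 * M" using \<rho>(2) T M by (intro mult_right_mono mult_left_mono) auto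
    also have "T * \<rho>0 * M = q / 4" by (rule \<rho>0(2))
    finally show False using \<eta>(3) q by simp
  qed
qed

end

section \<open>Solutions close to the torus\<close>

text \<open>
  The principal argument is continuous at \<open>1\<close>.
\<close>

lemma cis_close:
  assumes "r > 0"
  shows "\<exists>d>0. \<forall>a b. dist (cis a) (cis b) < d \<longrightarrow> (\<exists>n::int. \<bar>a - b - 2 * pi * of_int n\<bar> < r)"
proof -
  have "continuous (at 1) Arg" by (rule continuous_at_Arg) (simp add: complex_nonpos_Reals_iff)
  then obtain d where d: "d > 0" "\<And>z. dist z 1 < d \<Longrightarrow> dist (Arg z) (Arg 1) < r"
    using assms unfolding continuous_at_eps_delta by blast
  show ?thesis
  proof (intro exI[of _ d] conjI allI impI d(1))
    fix a b assume "dist (cis a) (cis b) < d"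
    moreover have "dist (cis (a - b)) 1 = dist (cis a) (cis b)"
    proof -
      have "cis a - cis b = (cis (a - b) - 1) * cis b" by (simp add: cis_mult left_diff_distrib)
      thus ?thesis by (simp add: dist_norm norm_mult)
    qed
    ultimately have A: "\<bar>Arg (cis (a - b))\<bar> < r" using d(2)[of "cis (a - b)"] by (simp add: dist_real_def)
    have "cis (Arg (cis (a - b))) = cis (a - b)" by (simp add: cis_Arg sgn_div_norm)
    hence "cover1 (a - b, 0, 0, 0) = cover1 (Arg (cis (a - b)), 0, 0, 0)" by (simp add: cover1_def)
    then obtain n :: int where "a - b = Arg (cis (a - b)) + 2 * pi * of_int n" unfolding cover1_eq_iff by auto
    thus "\<exists>n::int. \<bar>a - b - 2 * pi * of_int n\<bar> < r" using A by (intro exI[of _ n]) simp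
  qed
qed

lemma dist_rot: "dist (rot \<beta> x) (rot \<beta> y) = dist x y"
proof -
  have "dist (rot \<beta> x $ k) (rot \<beta> y $ k) = dist (x $ k) (y $ k)" for k
    by (simp add: rot_def split_beta dist_prod_def dist_norm norm_mult right_diff_distrib[symmetric])
  thus ?thesis by (simp add: dist_vec_def)
qed

lemma rot_proj: "rot \<beta> (proj P x) = proj P (rot \<beta> x)"
  by (auto simp: rot_def proj_def vec_eq_iff split_beta zero_prod_def)

lemma rot_phase_orbit: "g \<in> phase_orbit \<sigma> \<Longrightarrow> rot \<beta> g \<in> phase_orbit \<sigma>"
  unfolding phase_orbit_def by (force simp: rot_rot)

lemma C2_norm_fun_bound:
  assumes "C2_norm_fun U f \<le> ennreal B" "B \<ge> 0" "cover x \<in> U" "b \<in> Basis"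
  shows "\<bar>pd b (f \<circ> cover) x\<bar> \<le> B"
proof -
  have "ennreal \<bar>pd b (f \<circ> cover) x\<bar> \<le> C2_norm_fun U f"
    unfolding C2_norm_fun_def C2_norm_def by (rule Sup_upper) (use assms(3,4) in auto)
  also have "\<dots> \<le> ennreal B" by (rule assms(1))
  finally show ?thesis using assms(2) by simp
qed

lemma pd_translate:
  assumes "open S" "x \<in> S" "\<And>z. z \<in> S \<Longrightarrow> f (z + a) = f z"
  shows "pd u f (x + a) = pd u f x"
  unfolding pd_shift by (rule pd_cong_open[OF assms])

lemma pd_zero_direction:
  assumes "open S" "x \<in> S" "f differentiable (at x)" "\<And>t. x + t *\<^sub>R u \<in> S \<Longrightarrow> f (x + t *\<^sub>R u) = f x"
  shows "pd u f x = 0"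
proof -
  have 1: "((\<lambda>t. x + t *\<^sub>R u) has_derivative (\<lambda>t. t *\<^sub>R u)) (at 0)" by (auto intro!: derivative_eq_intros)
  have "(f has_derivative (\<lambda>u. pd u f x)) (at (x + 0 *\<^sub>R u))" using has_derivative_pd[OF assms(3)] by simp
  from has_derivative_compose[OF 1 this]
  have d: "((\<lambda>t. f (x + t *\<^sub>R u)) has_derivative (\<lambda>t. pd (t *\<^sub>R u) f x)) (at 0)" .
  have o: "open ((\<lambda>t. x + t *\<^sub>R u) -` S)" by (rule open_vimage[OF assms(1)]) (intro continuous_intros)
  have "((\<lambda>t. f (x + t *\<^sub>R u)) has_derivative (\<lambda>t. 0)) (at 0)"
    by (subst has_derivative_cong_open[OF o, where g = "\<lambda>_. f x"]) (use assms in auto)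
  with d have "(\<lambda>t. pd (t *\<^sub>R u) f x) = (\<lambda>t. 0)" by (rule has_derivative_unique)
  from fun_cong[OF this, of 1] show ?thesis by simp
qed

context model_system
begin

text \<open>
  On the torus the vector field of the model system is the constant \<open>\<nu> k\<close> in the direction of the
  angle.
\<close>

lemma model_solution_lift:
  assumes sol: "lham_solution J P F F\<^sub>1 UNIV \<sigma>" and torus: "\<And>t. \<sigma> t \<in> cyl_torus I\<^sub>0"
  shows "\<exists>c. \<forall>t. \<sigma> t = cover (c t) \<and> (\<forall>k\<in>P. c t $ k = c 0 $ k + (\<nu> k * t) *\<^sub>R e\<^sub>\<phi>)"
proof -
  obtain c where c: "\<And>t. \<sigma> t = cover (c t)" "\<And>t. \<sigma> t \<in> phase_space J"
    "\<And>t. \<exists>v. lham_vec P F F\<^sub>1 (c t) v \<and> (c has_vector_derivative v) (at t)"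
    using sol unfolding lham_solution_def by blast
  have cW: "c t \<in> W" for t using c(2)[of t] unfolding c(1)[of t] by simp
  have sc: "snd (c t $ k) = (I\<^sub>0 k, 0, 0)" for t k
  proof -
    have "cover1 (c t $ k) \<in> sphere 0 1 \<times> {I\<^sub>0 k} \<times> {0} \<times> {0}"
      using torus[of t] unfolding c(1)[of t] cyl_torus_def cover_def by simp
    thus ?thesis by (cases "c t $ k") (simp add: cover1_def)
  qed
  have "c t $ k = c 0 $ k + (\<nu> k * t) *\<^sub>R e\<^sub>\<phi>" if k: "k \<in> P" for k t
  proof -
    have d: "((\<lambda>t. c t $ k - (t * \<nu> k) *\<^sub>R e\<^sub>\<phi>) has_vector_derivative 0) (at q within UNIV)" for q
    proof -
      obtain w where w: "lham_vec P F F\<^sub>1 (c q) w" "(c has_vector_derivative w) (at q)" using c(3) by blast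
      have "w $ k = \<nu> k *\<^sub>R e\<^sub>\<phi>"
        using k factor.on_cylinder[OF fac I0_J, of k]
        unfolding lham_vec_unique[OF cW w(1)] field_def ham_field_def
        by (simp add: sc \<nu>_def factor.hI_def[OF fac] factor.hq_def[OF fac] factor.hp_def[OF fac])
      hence 1: "((\<lambda>t. c t $ k) has_vector_derivative \<nu> k *\<^sub>R e\<^sub>\<phi>) (at q)"
        using has_vector_derivative_vec_nth[OF w(2), of k] by simp
      have 2: "((\<lambda>t. (t * \<nu> k) *\<^sub>R e\<^sub>\<phi>) has_vector_derivative \<nu> k *\<^sub>R e\<^sub>\<phi>) (at q)"
        unfolding has_vector_derivative_def by (auto intro!: derivative_eq_intros simp: zero_prod_def)
      show ?thesis using has_vector_derivative_diff[OF 1 2] by simp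
    qed
    obtain C where C': "\<And>t. t \<in> UNIV \<Longrightarrow> c t $ k - (t * \<nu> k) *\<^sub>R e\<^sub>\<phi> = C"
    proof (rule has_vector_derivative_zero_constant[OF convex_UNIV d])
      fix C assume "\<And>t. t \<in> UNIV \<Longrightarrow> c t $ k - (t * \<nu> k) *\<^sub>R e\<^sub>\<phi> = C"
      thus thesis by (rule that)
    qed
    have C: "c t $ k - (t * \<nu> k) *\<^sub>R e\<^sub>\<phi> = C" for t by (rule C'[OF UNIV_I])
    have "c 0 $ k = C" using C[of 0] by (simp add: zero_prod_def[symmetric])
    thus ?thesis using C[of t] by (simp add: algebra_simps del: scaleR_Pair)
  qed
  thus ?thesis using c(1) by blast
qed

text \<open>
  A point near \<open>\<gamma>\<close> is close to some \<open>rot \<beta> (\<sigma> t)\<close>. Relative to the base point \<open>c\<^sub>0\<close> its angles are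
  shifted by a time \<open>s\<close> and a common rotation \<open>b\<close>; the time can be reduced modulo \<open>T\<close> because of the
  resonance, at the cost of full turns \<open>n k\<close>.
\<close>

lemma tube_lift:
  assumes sol: "lham_solution J P F F\<^sub>1 UNIV \<sigma>" and torus: "\<And>t. \<sigma> t \<in> cyl_torus I\<^sub>0"
    and c0: "cover c\<^sub>0 \<in> phase_orbit \<sigma>" and r: "r > 0"
  shows "\<exists>\<rho>>0. \<forall>x g. g \<in> phase_orbit \<sigma> \<and> dist (proj P g) (proj P (cover x)) < \<rho> \<longrightarrow>
     (\<exists>s\<in>{0..T}. \<exists>b. \<exists>n :: 'k \<Rightarrow> int. \<forall>k\<in>P. norm (x $ k - (c\<^sub>0 $ k + (\<nu> k * s + (b + 2 * pi * of_int (n k))) *\<^sub>R e\<^sub>\<phi>)) \<le> r)"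
proof -
  obtain c where c: "\<And>t. \<sigma> t = cover (c t)" "\<And>t k. k \<in> P \<Longrightarrow> c t $ k = c 0 $ k + (\<nu> k * t) *\<^sub>R e\<^sub>\<phi>"
    using model_solution_lift[OF sol torus] by blast
  have orbit: "\<exists>t b. g = cover (c t + (\<chi> k. b *\<^sub>R e\<^sub>\<phi>))" if "g \<in> phase_orbit \<sigma>" for g
    using that unfolding phase_orbit_def c(1) rot_cover by blast
  obtain t0 b0 where "cover c\<^sub>0 = cover (c t0 + (\<chi> k. b0 *\<^sub>R e\<^sub>\<phi>))" using orbit[OF c0] by blast
  then obtain j :: "'k \<Rightarrow> int" where j: "c\<^sub>0 = c t0 + (\<chi> k. b0 *\<^sub>R e\<^sub>\<phi>) + (\<chi> k. (2 * pi * of_int (j k)) *\<^sub>R e\<^sub>\<phi>)"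
    unfolding cover_eq_iff by blast
  have "r / 2 > 0" using r by simp
  from cis_close[OF this] obtain d where d: "d > 0"
    "\<And>a b. dist (cis a) (cis b) < d \<Longrightarrow> \<exists>n::int. \<bar>a - b - 2 * pi * of_int n\<bar> < r / 2" by blast
  show ?thesis
  proof (intro exI[of _ "min d (r / 2)"] conjI allI impI)
    show "min d (r / 2) > 0" using d r by simp
    fix x g assume g: "g \<in> phase_orbit \<sigma> \<and> dist (proj P g) (proj P (cover x)) < min d (r / 2)"
    then obtain t1 b1 where g1: "g = cover (c t1 + (\<chi> k. b1 *\<^sub>R e\<^sub>\<phi>))" using orbit by blast
    define i where "i = \<lfloor>(t1 - t0) / T\<rfloor>"
    define s where "s = t1 - t0 - of_int i * T"
    have s: "s \<in> {0..T}"
    proof -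
      have "of_int i \<le> (t1 - t0) / T" "(t1 - t0) / T < of_int i + 1" unfolding i_def by linarith+
      thus ?thesis using T by (simp add: s_def field_simps)
    qed
    have "\<exists>n::int. norm (x $ k - (c\<^sub>0 $ k + (\<nu> k * s + ((b1 - b0) + 2 * pi * of_int n)) *\<^sub>R e\<^sub>\<phi>)) \<le> r" if k: "k \<in> P" for k
    proof -
      define y where "y = c t1 $ k + b1 *\<^sub>R e\<^sub>\<phi>"
      have "dist (proj P g $ k) (proj P (cover x) $ k) < min d (r / 2)"
        using g dist_vec_nth_le order_le_less_trans by blast
      hence dd: "dist (cover1 y) (cover1 (x $ k)) < min d (r / 2)"
        using k by (simp add: proj_def g1 cover_def y_def del: scaleR_Pair)
      have c1: "cover1 z = (cis (fst z), snd z)" for z by (simp add: cover1_def split_beta)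
      have "dist (cis (fst y)) (cis (fst (x $ k))) \<le> dist (cover1 y) (cover1 (x $ k))"
        "dist (snd y) (snd (x $ k)) \<le> dist (cover1 y) (cover1 (x $ k))"
        using dist_fst_le[of "cover1 y" "cover1 (x $ k)"] dist_snd_le[of "cover1 y" "cover1 (x $ k)"] by (simp_all add: c1)
      hence 1: "dist (cis (fst (x $ k))) (cis (fst y)) < d" and 2: "norm (snd (x $ k) - snd y) < r / 2"
        using dd by (simp_all add: dist_commute dist_norm norm_minus_commute)
      obtain n :: int where n: "\<bar>fst (x $ k) - fst y - 2 * pi * of_int n\<bar> < r / 2" using d(2)[OF 1] by blast
      have "x $ k - (y + (2 * pi * of_int n) *\<^sub>R e\<^sub>\<phi>) = (fst (x $ k) - fst y - 2 * pi * of_int n, snd (x $ k) - snd y)"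
        by (simp add: prod_eq_iff zero_prod_def[symmetric])
      hence 3: "norm (x $ k - (y + (2 * pi * of_int n) *\<^sub>R e\<^sub>\<phi>)) \<le> r"
        using norm_Pair_le[of "fst (x $ k) - fst y - 2 * pi * of_int n" "snd (x $ k) - snd y"] n 2 by simp
      have "\<nu> k * (of_int i * T) = 2 * pi * of_int (l k * i)" using nu_T[OF k] by (simp add: algebra_simps)
      hence eq: "\<nu> k * t1 + b1 + 2 * pi * of_int n = (\<nu> k * t0 + b0 + 2 * pi * of_int (j k))
          + (\<nu> k * s + ((b1 - b0) + 2 * pi * of_int (n - j k + l k * i)))"
        by (simp add: s_def algebra_simps)
      have "y + (2 * pi * of_int n) *\<^sub>R e\<^sub>\<phi> = c 0 $ k + (\<nu> k * t1 + b1 + 2 * pi * of_int n) *\<^sub>R e\<^sub>\<phi>"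
        unfolding y_def c(2)[OF k, of t1] by (simp only: scaleR_add_left add.assoc)
      also have "\<dots> = c\<^sub>0 $ k + (\<nu> k * s + ((b1 - b0) + 2 * pi * of_int (n - j k + l k * i))) *\<^sub>R e\<^sub>\<phi>"
        unfolding eq j c(2)[OF k, of t0] vector_add_component vec_lambda_beta by (simp only: scaleR_add_left add.assoc)
      finally show ?thesis using 3 by metis
    qed
    hence "\<exists>n :: 'k \<Rightarrow> int. \<forall>k\<in>P. norm (x $ k - (c\<^sub>0 $ k + (\<nu> k * s + ((b1 - b0) + 2 * pi * of_int (n k))) *\<^sub>R e\<^sub>\<phi>)) \<le> r"
      by (intro bchoice) blast
    thus "\<exists>s\<in>{0..T}. \<exists>b. \<exists>n :: 'k \<Rightarrow> int. \<forall>k\<in>P. norm (x $ k - (c\<^sub>0 $ k + (\<nu> k * s + (b + 2 * pi * of_int (n k))) *\<^sub>R e\<^sub>\<phi>)) \<le> r"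
      using s by blast
  qed
qed

lemma gradient_bound:
  assumes c0: "c\<^sub>0 \<in> W" and R: "Ck_fun 1 J R"
  obtains r G where "r > 0" "G \<ge> 0"
    "\<And>y s b. s \<in> {0..T} \<Longrightarrow> norm (y - reference c\<^sub>0 s) < r \<Longrightarrow> b \<in> Basis \<Longrightarrow> \<bar>pd b (R \<circ> cover) y\<bar> \<le> G"
proof -
  let ?K = "reference c\<^sub>0 ` {0..T}"
  have K: "compact ?K" by (intro compact_continuous_image reference_continuous) auto
  have KW: "?K \<subseteq> W" using reference_W[OF c0] by blast
  have g: "Ck_on 1 W (R \<circ> cover)" using R by (simp add: Ck_fun_def)
  obtain r where r: "r > 0" "\<And>x y u. x \<in> ?K \<Longrightarrow> norm (y - x) < r \<Longrightarrow> \<bar>pd u (R \<circ> cover) y - pd u (R \<circ> cover) x\<bar> \<le> 1 * norm u"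
    by (rule C1_uniform_pd[OF open_W K KW g zero_less_one]) blast
  have "bounded (\<Union>b\<in>Basis. pd b (R \<circ> cover) ` ?K)"
    using g KW by (intro bounded_UN finite_Basis ballI compact_imp_bounded compact_continuous_image K)
      (auto intro: continuous_on_subset)
  then obtain G where G: "G > 0" "\<And>b x. b \<in> Basis \<Longrightarrow> x \<in> ?K \<Longrightarrow> \<bar>pd b (R \<circ> cover) x\<bar> \<le> G"
    unfolding bounded_pos by fastforce
  show ?thesis
  proof (rule that[of r "G + 1"])
    fix y s b assume *: "s \<in> {0..T}" "norm (y - reference c\<^sub>0 s) < r" "b \<in> (Basis :: 'k coord set)"
    thus "\<bar>pd b (R \<circ> cover) y\<bar> \<le> G + 1"
      using r(2)[of "reference c\<^sub>0 s" y b] G(2)[of b "reference c\<^sub>0 s"] by force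
  qed (use r G in auto)
qed

text \<open>
  The function \<open>R'\<close> is rotation invariant, but \<open>R\<close> need not be. So the derivative of \<open>R'\<close> is first
  carried from \<open>x\<close> to the point \<open>y\<close> with angles turned back by the rotation, which still lies in the
  neighbourhood since \<open>U\<^sub>0\<close> is rotation invariant; there it is compared with that of \<open>R\<close>. The
  components outside \<open>P\<close> can be exchanged afterwards, \<open>R\<close> being lifted from $M_0$.
\<close>

lemma derivative_transfer:
  fixes B :: real
  assumes R: "Ck_fun 1 J R" "projects_to J P R" and R': "Ck_fun 1 J R'" "projects_to J P R'" "invariant J R'"
    and B: "C2_norm_fun (product_set J P U\<^sub>0 U\<^sub>1) (\<lambda>x. R' x - R x) \<le> ennreal B" "B \<ge> 0"
    and rot: "\<And>x \<beta>. x \<in> U\<^sub>0 \<Longrightarrow> rot \<beta> x \<in> U\<^sub>0"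
    and x: "cover x \<in> product_set J P U\<^sub>0 U\<^sub>1" and c0: "c\<^sub>0 \<in> W"
  shows "\<bar>pd u (R' \<circ> cover) x - pd u (R \<circ> cover) (unshift c\<^sub>0 (\<lambda>k. b + 2 * pi * of_int (n k)) x)\<bar>
    \<le> DIM('k coord) * B * norm u"
proof -
  have diff: "(f \<circ> cover) differentiable (at z)" if "Ck_fun 1 J f" "z \<in> W" for f z
    using that by (simp add: Ck_fun_def)
  let ?b = "\<lambda>k. b + 2 * pi * of_int (n k)"
  define a :: "'k coord" where "a = (\<chi> k. if k \<in> P then - ?b k *\<^sub>R e\<^sub>\<phi> else 0)"
  define y where "y = x + a"
  define z where "z = unshift c\<^sub>0 ?b x"
  have xW: "x \<in> W" using x by (simp add: product_set_def)
  have aW: "q + a \<in> W" if "q \<in> W" for q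
    using that by (auto simp: cover_in_phase_space a_def zero_prod_def[symmetric])
  have cov: "proj P (cover (q + a)) = rot (- b) (proj P (cover q))" for q
  proof -
    have "cis (fst (q $ k) - (b + 2 * pi * of_int (n k))) = cis (- b) * cis (fst (q $ k))" for k
    proof -
      have "fst (q $ k) - (b + 2 * pi * of_int (n k)) = (- b + fst (q $ k)) + 2 * pi * of_int (- n k)" by simp
      hence "cover1 (fst (q $ k) - (b + 2 * pi * of_int (n k)), 0, 0, 0) = cover1 (- b + fst (q $ k), 0, 0, 0)"
        unfolding cover1_eq_iff by (intro exI[of _ "- n k"]) simp
      thus ?thesis by (simp add: cover1_def cis_mult)
    qed
    hence "cis (fst (q $ k) + (- b - 2 * pi * of_int (n k))) = cis (- b) * cis (fst (q $ k))" for k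
      by (simp only: diff_add_eq_diff_diff_swap diff_conv_add_uminus minus_add_distrib add.assoc)
    thus ?thesis by (auto simp: proj_def cover_def cover1_def rot_def a_def vec_eq_iff split_beta zero_prod_def)
  qed
  have cov': "proj (- P) (cover (q + a)) = proj (- P) (cover q)" for q
    by (auto simp: proj_def cover_def a_def vec_eq_iff)
  have yU: "cover y \<in> product_set J P U\<^sub>0 U\<^sub>1"
    using x aW[OF xW] rot unfolding y_def product_set_def by (simp add: cov cov')
  have yW: "y \<in> W" using aW[OF xW] by (simp add: y_def)
  have zW: "z \<in> W" using xW c0 by (auto simp: z_def unshift_def cover_in_phase_space zero_prod_def[symmetric])
  obtain h' where h': "\<And>q. q \<in> phase_space J \<Longrightarrow> R' q = h' (proj P q)" using R'(2) unfolding projects_to_def by blast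
  obtain h where h: "\<And>q. q \<in> phase_space J \<Longrightarrow> R q = h (proj P q)" using R(2) unfolding projects_to_def by blast
  have 1: "pd u (R' \<circ> cover) y = pd u (R' \<circ> cover) x" unfolding y_def
  proof (rule pd_translate[OF open_W xW])
    fix q assume q: "q \<in> W"
    have "R' (cover (q + a)) = h' (proj P (rot (- b) (cover q)))"
      using h'[of "cover (q + a)"] aW[OF q] by (simp add: cov rot_proj)
    also have "\<dots> = R' (rot (- b) (cover q))" using h'[OF phase_space_rot] q by simp
    also have "\<dots> = R' (cover q)" using R'(3) q by (simp add: invariant_def)
    finally show "(R' \<circ> cover) (q + a) = (R' \<circ> cover) q" by simp
  qed
  have 2: "pd u (R \<circ> cover) z = pd u (R \<circ> cover) y"
  proof -
    let ?S = "W \<inter> (\<lambda>q. q + (z - y)) -` W"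
    have "pd u (R \<circ> cover) (y + (z - y)) = pd u (R \<circ> cover) y"
    proof (rule pd_translate[of ?S])
      show "open ?S" by (intro open_Int open_W open_vimage) (intro continuous_intros)
      show "y \<in> ?S" using yW zW by simp
      fix q assume q: "q \<in> ?S"
      have "(z - y) $ k = 0" if "k \<in> P" for k
        using that by (simp add: z_def unshift_def y_def a_def zero_prod_def)
      hence "proj P (cover (q + (z - y))) = proj P (cover q)" by (simp add: proj_def cover_def vec_eq_iff)
      thus "(R \<circ> cover) (q + (z - y)) = (R \<circ> cover) q" using q h by auto
    qed
    thus ?thesis by simp
  qed
  have d: "((\<lambda>x. R' x - R x) \<circ> cover has_derivative (\<lambda>u. pd u (R' \<circ> cover) y - pd u (R \<circ> cover) y)) (at y)"
    using has_derivative_diff[OF has_derivative_pd[OF diff[OF R'(1) yW]] has_derivative_pd[OF diff[OF R(1) yW]]]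
    by (simp add: o_def)
  have "\<bar>pd u ((\<lambda>x. R' x - R x) \<circ> cover) y\<bar> \<le> DIM('k coord) * B * norm u"
    by (rule pd_bound) (use d C2_norm_fun_bound[OF B yU] in \<open>auto simp: differentiable_def\<close>)
  thus ?thesis unfolding pd_eqI[OF d] z_def[symmetric] 2 by (simp add: 1)
qed

text \<open>
  Tested with a vector \<open>u\<close> in the directions of $M_0$, the first equation of the system is
  $\omega_0(u,w)=d_uF$. The function \<open>H1'\<close> does not contribute, and the unperturbed part cancels against
  \<open>field\<close>.
\<close>

lemma force_identity:
  assumes R': "Ck_fun 1 J R'" and H1: "Ck_fun 1 J H1'" "projects_to J (- P) H1'" and \<Phi>: "Ck_fun 1 J \<Phi>"
    and x: "x \<in> W" and w: "lham_vec P (\<lambda>x. \<omega> * (sum_ham H P x + \<mu> * R' x) + \<epsilon> * H1' x + \<omega>\<^sup>2 * \<epsilon> * \<Phi> x) G x w"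
    and u: "\<And>k. k \<notin> P \<Longrightarrow> u $ k = 0"
  shows "(\<Sum>k\<in>P. om1 (u $ k) ((w - field x) $ k)) = \<omega> * \<mu> * pd u (R' \<circ> cover) x + \<omega>\<^sup>2 * \<epsilon> * pd u (\<Phi> \<circ> cover) x"
proof -
  interpret bounded_bilinear om1 by (rule bounded_bilinear_om1)
  have diff: "(f \<circ> cover) differentiable (at x)" if "Ck_fun 1 J f" for f
    using that x by (simp add: Ck_fun_def)
  have dH: "(sum_ham H P \<circ> cover) differentiable (at x)"
    using sum_ham_has_derivative[OF x] unfolding differentiable_def by blast
  have "om (- P) u q = 0" for q unfolding om_def using u by (intro sum.neutral) (simp add: zero_left)
  hence "om P u w = pd u ((\<lambda>x. \<omega> * (sum_ham H P x + \<mu> * R' x) + \<epsilon> * H1' x + \<omega>\<^sup>2 * \<epsilon> * \<Phi> x) \<circ> cover) x"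
    using w unfolding lham_vec_def by blast
  also have "\<dots> = \<omega> * (pd u (sum_ham H P \<circ> cover) x + \<mu> * pd u (R' \<circ> cover) x) + \<epsilon> * pd u (H1' \<circ> cover) x
      + \<omega>\<^sup>2 * \<epsilon> * pd u (\<Phi> \<circ> cover) x"
    by (rule pd_eqI)
      (simp only: o_def, intro has_derivative_add has_derivative_mult_right
        has_derivative_pd[unfolded o_def] dH[unfolded o_def] diff[unfolded o_def] R' H1 \<Phi>)
  also have "pd u (H1' \<circ> cover) x = 0"
  proof (rule pd_zero_direction[OF open_W x diff[OF H1(1)]])
    fix t assume "x + t *\<^sub>R u \<in> W"
    moreover have "proj (- P) (cover (x + t *\<^sub>R u)) = proj (- P) (cover x)"
      using u by (simp add: proj_def cover_def vec_eq_iff)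
    ultimately show "(H1' \<circ> cover) (x + t *\<^sub>R u) = (H1' \<circ> cover) x"
      using H1(2) x unfolding projects_to_def by auto
  qed
  finally have 1: "om P u w = \<omega> * (pd u (sum_ham H P \<circ> cover) x + \<mu> * pd u (R' \<circ> cover) x) + \<omega>\<^sup>2 * \<epsilon> * pd u (\<Phi> \<circ> cover) x"
    by (simp only: add_0_right mult_zero_right)
  have "(\<Sum>k\<in>P. om1 (u $ k) ((w - field x) $ k)) = om P u w - om P u (field x)"
    by (simp add: om_def diff_right sum_subtractf)
  thus ?thesis unfolding 1 om_field(1)[OF x] by (simp add: algebra_simps)
qed

lemma sum_ham_invariant: "sum_ham H B (rot \<beta> x) = sum_ham H B x"
  by (simp add: sum_ham_def lift_ham_def fun1_def rot_def split_beta)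

lemma open_nbhd_tube:
  assumes "\<sigma> ` UNIV \<subseteq> phase_space J" and \<rho>: "\<rho> > 0"
  shows "open_nbhd (subproduct J P) (proj P ` phase_orbit \<sigma>)
     (subproduct J P \<inter> (\<Union>g\<in>phase_orbit \<sigma>. ball (proj P g) \<rho>))"
proof -
  have "phase_orbit \<sigma> \<subseteq> phase_space J" using assms phase_space_rot unfolding phase_orbit_def by blast
  hence "proj P ` phase_orbit \<sigma> \<subseteq> subproduct J P" unfolding subproduct_def by blast
  moreover have "proj P g \<in> ball (proj P g) \<rho>" for g :: "'k point" using \<rho> by simp
  ultimately show ?thesis unfolding open_nbhd_def by (intro conjI openin_open_Int open_UN ballI open_ball) blast
qed

text \<open>
  Rotations are isometries that preserve \<open>\<gamma>\<close>.
\<close>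

lemma tube_rot:
  assumes "x \<in> subproduct J P \<inter> (\<Union>g\<in>phase_orbit \<sigma>. ball (proj P g) \<rho>)"
  shows "rot \<beta> x \<in> subproduct J P \<inter> (\<Union>g\<in>phase_orbit \<sigma>. ball (proj P g) \<rho>)"
proof -
  obtain y where y: "y \<in> phase_space J" "x = proj P y" using assms unfolding subproduct_def by blast
  obtain g where g: "g \<in> phase_orbit \<sigma>" "dist (proj P g) x < \<rho>" using assms by auto
  have "rot \<beta> x \<in> subproduct J P" unfolding y(2) rot_proj subproduct_def using phase_space_rot[OF y(1)] by blast
  moreover have "dist (proj P (rot \<beta> g)) (rot \<beta> x) < \<rho>" using g(2) by (simp add: rot_proj[symmetric] dist_rot)
  ultimately show ?thesis using rot_phase_orbit[OF g(1)] by auto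
qed

text \<open>
  The functions $\widetilde H$ and $\widetilde H_1+\varpi^2\widetilde\Phi$ of the perturbed system.
\<close>

definition pert_ham where
  "pert_ham \<mu> \<epsilon> R' H1' \<Phi> = (\<lambda>x. \<omega> * (sum_ham H P x + \<mu> * R' x) + \<epsilon> * H1' x + \<omega>\<^sup>2 * \<epsilon> * \<Phi> x)"

definition pert_ham\<^sub>1 where
  "pert_ham\<^sub>1 H1' \<Phi> = (\<lambda>x. H1' x + \<omega>\<^sup>2 * \<Phi> x)"

definition admissible where
  "admissible R D U\<^sub>1 \<mu>\<^sub>0 U\<^sub>0 \<epsilon> \<mu> T' \<alpha> R' H1' \<Phi> \<longleftrightarrow> \<epsilon> > 0 \<and> \<omega> * \<epsilon> / \<mu>\<^sub>0 \<le> \<mu> \<and> \<mu> \<le> \<mu>\<^sub>0 \<and> \<bar>T' - T\<bar> + \<bar>\<alpha>\<bar> \<le> D * \<mu> \<and>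
     Ck_fun 2 J R' \<and> Ck_fun 2 J H1' \<and> Ck_fun 2 J \<Phi> \<and>
     invariant J (pert_ham \<mu> \<epsilon> R' H1' \<Phi>) \<and> invariant J (pert_ham\<^sub>1 H1' \<Phi>) \<and> projects_to J P R' \<and> projects_to J (- P) H1' \<and>
     C2_norm_fun (product_set J P U\<^sub>0 U\<^sub>1) (\<lambda>x. R' x - R x) \<le> ennreal \<mu>\<^sub>0 \<and>
     C2_norm_fun (product_set J P U\<^sub>0 U\<^sub>1) \<Phi> \<le> ennreal D"

text \<open>
  The forces on the $M_0$-component of a relatively periodic solution in the tube are computed by
  \<open>force_identity\<close>. They are of order \<open>\<mu>\<close> because the solution stays in the tube, where the gradient
  of \<open>R\<close> is bounded, and by \<open>derivative_transfer\<close> they are those of $\omega\mu R$ up to an error of order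
  $\mu\mu_0$. Hence the lift of the solution is a \<open>perturbed_curve\<close> when \<open>\<mu>\<^sub>0\<close> is small.
\<close>

lemma no_relative_periodic_solutions:
  assumes \<omega>1: "\<omega> \<le> 1" and R: "smooth_fun J R" "projects_to J P R"
    and sol: "lham_solution J P F F\<^sub>1 UNIV \<sigma>" and torus: "phase_orbit \<sigma> \<subseteq> cyl_torus I\<^sub>0"
    and x: "x \<in> phase_orbit \<sigma>" "\<not> critical_point_on (level_set J P H I\<^sub>0) (average J P F F\<^sub>1 T R) x"
    and D: "D > 0"
  obtains \<mu>\<^sub>0 U\<^sub>0 where "\<mu>\<^sub>0 > 0" "open_nbhd (subproduct J P) (proj P ` phase_orbit \<sigma>) U\<^sub>0"
    "\<And>\<epsilon> \<mu> T' \<alpha> R' H1' \<Phi> \<delta>. admissible R D U\<^sub>1 \<mu>\<^sub>0 U\<^sub>0 \<epsilon> \<mu> T' \<alpha> R' H1' \<Phi> \<Longrightarrow>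
      rel_periodic_solution J P (pert_ham \<mu> \<epsilon> R' H1' \<Phi>) (pert_ham\<^sub>1 H1' \<Phi>) T' \<alpha> \<delta> \<Longrightarrow>
      range \<delta> \<subseteq> product_set J P U\<^sub>0 U\<^sub>1 \<Longrightarrow> False"
proof -
  have R1: "Ck_fun 1 J R" using R(1) by (simp add: smooth_fun_def smooth_on_def Ck_fun_def)
  have \<sigma>torus: "\<sigma> t \<in> cyl_torus I\<^sub>0" for t
  proof -
    have "rot 0 (\<sigma> t) \<in> phase_orbit \<sigma>" unfolding phase_orbit_def by blast
    thus ?thesis using torus by auto
  qed
  obtain c\<^sub>0 v where c0: "cover c\<^sub>0 = x" "on_torus c\<^sub>0" "tangent v"
    and ne: "integral {0..T} (\<lambda>t. pd (variation v t) (R \<circ> cover) (reference c\<^sub>0 t)) \<noteq> 0"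
    using noncritical_point[OF _ R1 R(2) x(2)] x(1) torus by blast
  have c0W: "c\<^sub>0 \<in> W" using c0(2) by (simp add: on_torus_def)
  obtain rG Gb where rG: "rG > 0" "Gb \<ge> 0"
    "\<And>y s b. s \<in> {0..T} \<Longrightarrow> norm (y - reference c\<^sub>0 s) < rG \<Longrightarrow> b \<in> Basis \<Longrightarrow> \<bar>pd b (R \<circ> cover) y\<bar> \<le> Gb"
    by (rule gradient_bound[OF c0W R1]) blast
  define d where "d = real DIM('k coord)"
  have d: "d \<ge> 0" by (simp add: d_def)
  define G where "G = real DIM(coord1) * (Gb + d + D)"
  have G: "G \<ge> 0" using rG d D by (simp add: G_def)
  obtain \<rho> where \<rho>: "\<rho> > 0" and no_curve: "\<forall>x f s b \<mu> T' \<alpha> m. \<not> perturbed_curve R c\<^sub>0 G D \<rho> x f s b \<mu> T' \<alpha> m"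
    using no_relative_periodic_curve[OF c0(2,3) R1 ne less_imp_le[OF D] G] by (elim exE conjE) (rule that)
  (* The tube must be so thin that a solution starting in it meets the initial condition of
     perturbed_curve and that the gradient bound Gb holds throughout. *)
  define r where "r = min \<rho> (rG / (2 * (real (card P) + 1)))"
  have r: "r > 0" "r \<le> \<rho>" "card P * r < rG"
  proof -
    show "r > 0" "r \<le> \<rho>" using \<rho> rG by (simp_all add: r_def add_nonneg_pos)
    have "r \<le> rG / (2 * (real (card P) + 1))" by (simp add: r_def)
    hence "(real (card P) + 1) * r \<le> rG / 2" by (simp add: field_simps)
    thus "card P * r < rG" using \<open>r > 0\<close> rG(1) by (simp add: algebra_simps)
  qed
  obtain \<rho>t where \<rho>t: "\<rho>t > 0" "\<And>x g. g \<in> phase_orbit \<sigma> \<Longrightarrow> dist (proj P g) (proj P (cover x)) < \<rho>t \<Longrightarrow>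
     (\<exists>s\<in>{0..T}. \<exists>b. \<exists>n :: 'k \<Rightarrow> int. \<forall>k\<in>P. norm (x $ k - (c\<^sub>0 $ k + (\<nu> k * s + (b + 2 * pi * of_int (n k))) *\<^sub>R e\<^sub>\<phi>)) \<le> r)"
    using tube_lift[OF sol \<sigma>torus _ r(1), of c\<^sub>0] x(1) c0(1) by blast
  define U\<^sub>0 where "U\<^sub>0 = subproduct J P \<inter> (\<Union>g\<in>phase_orbit \<sigma>. ball (proj P g) \<rho>t)"
  have rotU: "rot \<beta> x \<in> U\<^sub>0" if "x \<in> U\<^sub>0" for x \<beta> using tube_rot that unfolding U\<^sub>0_def by blast
  define \<mu>\<^sub>0 where "\<mu>\<^sub>0 = min (min 1 \<rho>) (min (T / (2 * D)) (\<rho> / ((d + 1) * (1 + D))))"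
  have \<mu>0: "\<mu>\<^sub>0 > 0" "\<mu>\<^sub>0 \<le> 1" "\<mu>\<^sub>0 \<le> \<rho>" "D * \<mu>\<^sub>0 < T" "d * (1 + D) * \<mu>\<^sub>0 \<le> \<rho>"
  proof -
    show "\<mu>\<^sub>0 > 0" "\<mu>\<^sub>0 \<le> 1" "\<mu>\<^sub>0 \<le> \<rho>" using \<rho> T D d by (simp_all add: \<mu>\<^sub>0_def add_nonneg_pos)
    have "\<mu>\<^sub>0 \<le> T / (2 * D)" by (simp add: \<mu>\<^sub>0_def)
    thus "D * \<mu>\<^sub>0 < T" using D T by (simp add: field_simps)
    have "\<mu>\<^sub>0 \<le> \<rho> / ((d + 1) * (1 + D))" by (simp add: \<mu>\<^sub>0_def)
    moreover have "(d + 1) * (1 + D) > 0" using d D by simp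
    ultimately have "((d + 1) * (1 + D)) * \<mu>\<^sub>0 \<le> \<rho>" by (simp add: pos_le_divide_eq mult.commute)
    moreover have "d * (1 + D) * \<mu>\<^sub>0 \<le> (d + 1) * (1 + D) * \<mu>\<^sub>0"
      using D \<open>\<mu>\<^sub>0 > 0\<close> by (intro mult_right_mono) auto
    ultimately show "d * (1 + D) * \<mu>\<^sub>0 \<le> \<rho>" by simp
  qed
  show ?thesis
  proof (rule that[OF \<mu>0(1)])
    have "\<sigma> ` UNIV \<subseteq> phase_space J" using sol unfolding lham_solution_def by blast
    from open_nbhd_tube[OF this \<rho>t(1)]
    show "open_nbhd (subproduct J P) (proj P ` phase_orbit \<sigma>) U\<^sub>0" by (simp add: U\<^sub>0_def)
  next
    fix \<epsilon> \<mu> T' \<alpha> and R' H1' \<Phi> :: "'k point \<Rightarrow> real" and \<delta>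
    let ?U = "product_set J P U\<^sub>0 U\<^sub>1"
    define Hp where "Hp = pert_ham \<mu> \<epsilon> R' H1' \<Phi>"
    define Gp where "Gp = pert_ham\<^sub>1 H1' \<Phi>"
    note pert_defs = Hp_def pert_ham_def Gp_def pert_ham\<^sub>1_def
    assume adm: "admissible R D U\<^sub>1 \<mu>\<^sub>0 U\<^sub>0 \<epsilon> \<mu> T' \<alpha> R' H1' \<Phi>"
      and "rel_periodic_solution J P (pert_ham \<mu> \<epsilon> R' H1' \<Phi>) (pert_ham\<^sub>1 H1' \<Phi>) T' \<alpha> \<delta>" and rel2: "range \<delta> \<subseteq> ?U"
    hence rel1: "rel_periodic_solution J P Hp Gp T' \<alpha> \<delta>" by (simp only: Hp_def Gp_def)
    note rel = rel1 rel2
    have \<epsilon>: "\<epsilon> > 0" "\<omega> * \<epsilon> / \<mu>\<^sub>0 \<le> \<mu>" and \<mu>le: "\<mu> \<le> \<mu>\<^sub>0" and per: "\<bar>T' - T\<bar> + \<bar>\<alpha>\<bar> \<le> D * \<mu>"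
      and Ck: "Ck_fun 2 J R'" "Ck_fun 2 J H1'" "Ck_fun 2 J \<Phi>" and inv: "invariant J Hp" "invariant J Gp"
      and pr: "projects_to J P R'" "projects_to J (- P) H1'"
      and C2: "C2_norm_fun ?U (\<lambda>x. R' x - R x) \<le> ennreal \<mu>\<^sub>0" "C2_norm_fun ?U \<Phi> \<le> ennreal D"
      using adm unfolding admissible_def Hp_def Gp_def by blast+
    have "\<omega> * \<epsilon> / \<mu>\<^sub>0 > 0" using \<omega> \<epsilon>(1) \<mu>0(1) by simp
    hence \<mu>: "\<mu> > 0" using \<epsilon>(2) by simp
    have \<omega>\<epsilon>: "\<omega> * \<epsilon> \<le> \<mu> * \<mu>\<^sub>0" using \<epsilon>(2) \<mu>0(1) by (simp add: field_simps)
    have w2: "0 \<le> \<omega>\<^sup>2 * \<epsilon>" "\<omega>\<^sup>2 * \<epsilon> \<le> \<mu> * \<mu>\<^sub>0"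
    proof -
      show "0 \<le> \<omega>\<^sup>2 * \<epsilon>" using \<epsilon>(1) by simp
      have "\<omega>\<^sup>2 * \<epsilon> = \<omega> * (\<omega> * \<epsilon>)" by (simp add: power2_eq_square)
      also have "\<dots> \<le> 1 * (\<mu> * \<mu>\<^sub>0)"
        by (rule mult_mono[OF \<omega>1 \<omega>\<epsilon>]) (use \<omega> \<epsilon>(1) in auto)
      finally show "\<omega>\<^sup>2 * \<epsilon> \<le> \<mu> * \<mu>\<^sub>0" by simp
    qed
    have w1: "0 \<le> \<omega> * \<mu>" "\<omega> * \<mu> \<le> \<mu>" using \<omega> \<omega>1 \<mu> by (simp_all add: mult_le_cancel_right1)
    have C1: "Ck_fun 1 J R'" "Ck_fun 1 J H1'" "Ck_fun 1 J \<Phi>"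
      using Ck unfolding Ck_fun_def One_nat_def numeral_2_eq_2 by (blast intro: Ck_on_mono)+
    (* Hp - epsilon Gp = omega (H_0 + mu R'), and H_0 is invariant. *)
    have R'inv: "invariant J R'" unfolding invariant_def
    proof (intro allI ballI)
      fix \<beta> x assume x: "x \<in> phase_space J"
      have eq: "Hp (rot \<beta> x) = Hp x" "Gp (rot \<beta> x) = Gp x" using inv x unfolding invariant_def by blast+
      have "\<omega> * \<mu> * (R' (rot \<beta> x) - R' x) = (Hp (rot \<beta> x) - Hp x) - \<epsilon> * (Gp (rot \<beta> x) - Gp x)"
        by (simp add: pert_defs sum_ham_invariant algebra_simps)
      also have "\<dots> = 0" unfolding eq by simp
      finally have "\<omega> * \<mu> * (R' (rot \<beta> x) - R' x) = 0" .
      thus "R' (rot \<beta> x) = R' x" using \<omega> \<mu> by simp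
    qed
    have CkH: "Ck_fun 2 J Hp"
    proof -
      have "Ck_on 2 W (\<lambda>c. \<omega> * ((sum_ham H P \<circ> cover) c + \<mu> * (R' \<circ> cover) c) + \<epsilon> * (H1' \<circ> cover) c + \<omega>\<^sup>2 * \<epsilon> * (\<Phi> \<circ> cover) c)"
        using Ck sum_ham_Ck[of 2 P] unfolding Ck_fun_def by (intro Ck_on_add Ck_on_cmult open_W)
      thus ?thesis by (simp add: Ck_fun_def o_def pert_defs)
    qed
    have CkG: "Ck_fun 2 J Gp"
    proof -
      have "Ck_on 2 W (\<lambda>c. (H1' \<circ> cover) c + \<omega>\<^sup>2 * (\<Phi> \<circ> cover) c)"
        using Ck unfolding Ck_fun_def by (intro Ck_on_add Ck_on_cmult open_W)
      thus ?thesis by (simp add: Ck_fun_def o_def pert_defs)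
    qed
    have "D * \<mu> \<le> D * \<mu>\<^sub>0" using \<mu>le D by (intro mult_left_mono) auto
    hence T': "T' > 0" using per \<mu>0(4) by linarith
    have \<delta>per: "\<delta> T' = rot \<alpha> (\<delta> 0)"
      by (rule rel_periodic_solution_shift[OF open_J CkH inv(1) CkG inv(2) rel(1) T'])
    obtain c where c: "\<And>t. \<delta> t = cover (c t)" "\<And>t. \<delta> t \<in> phase_space J"
      "\<And>t. \<exists>w. lham_vec P Hp Gp (c t) w \<and> (c has_vector_derivative w) (at t)"
      using rel(1) unfolding rel_periodic_solution_def lham_solution_def by blast
    obtain w where w: "\<And>t. lham_vec P Hp Gp (c t) (w t)" "\<And>t. (c has_vector_derivative w t) (at t)"
    proof -
      have "\<forall>t. \<exists>w. lham_vec P Hp Gp (c t) w \<and> (c has_vector_derivative w) (at t)" by (rule allI) (rule c(3))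
      from choice[OF this] show thesis using that by blast
    qed
    have cW: "c t \<in> W" for t using c(2)[of t] unfolding c(1)[of t] by simp
    have cU: "cover (c t) \<in> ?U" for t using subsetD[OF rel(2) rangeI[of \<delta> t]] unfolding c(1) .
    define f where "f = (\<lambda>t k. (w t - field (c t)) $ k)"
    have near: "\<exists>s\<in>{0..T}. \<exists>b. \<exists>n :: 'k \<Rightarrow> int. \<forall>k\<in>P.
        norm (c t $ k - (c\<^sub>0 $ k + (\<nu> k * s + (b + 2 * pi * of_int (n k))) *\<^sub>R e\<^sub>\<phi>)) \<le> r" for t
    proof -
      have "proj P (cover (c t)) \<in> U\<^sub>0" using cU[of t] by (simp add: product_set_def)
      then obtain g where "g \<in> phase_orbit \<sigma>" "dist (proj P g) (proj P (cover (c t))) < \<rho>t" unfolding U\<^sub>0_def by auto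
      thus ?thesis by (rule \<rho>t(2))
    qed
    note transfer = derivative_transfer[OF R1 R(2) C1(1) pr(1) R'inv C2(1) less_imp_le[OF \<mu>0(1)] rotU cU c0W]
    have force: "(\<Sum>k\<in>P. om1 (u $ k) (f t k)) = \<omega> * \<mu> * pd u (R' \<circ> cover) (c t) + \<omega>\<^sup>2 * \<epsilon> * pd u (\<Phi> \<circ> cover) (c t)"
      if "\<And>k. k \<notin> P \<Longrightarrow> u $ k = 0" for t u
      unfolding f_def by (rule force_identity[OF C1(1,2) pr(2) C1(3) cW w(1)[unfolded Hp_def pert_ham_def] that])
    have \<Phi>b: "\<bar>pd b (\<Phi> \<circ> cover) (c t)\<bar> \<le> D" if "b \<in> Basis" for b t
      using C2_norm_fun_bound[OF C2(2) _ cU that] D by simp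
    have \<Phi>d: "(\<Phi> \<circ> cover) differentiable (at (c t))" for t using C1(3) cW by (simp add: Ck_fun_def)
    have fbound: "norm (f t k) \<le> G * \<mu>" if k: "k \<in> P" for t k
    proof -
      obtain s b and n :: "'k \<Rightarrow> int" where s: "s \<in> {0..T}" and
        sb: "\<And>k. k \<in> P \<Longrightarrow> norm (c t $ k - (c\<^sub>0 $ k + (\<nu> k * s + (b + 2 * pi * of_int (n k))) *\<^sub>R e\<^sub>\<phi>)) \<le> r"
        using near by blast
      let ?y = "unshift c\<^sub>0 (\<lambda>k. b + 2 * pi * of_int (n k)) (c t)"
      have yg: "norm (?y - reference c\<^sub>0 s) < rG"
        using norm_unshift_reference_le[of "c t" c\<^sub>0 s "\<lambda>k. b + 2 * pi * of_int (n k)" r] sb r(3) by force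
      have "\<bar>om1 a (f t k)\<bar> \<le> (Gb + d + D) * \<mu>" if a: "a \<in> Basis" for a
      proof -
        interpret bounded_bilinear om1 by (rule bounded_bilinear_om1)
        let ?u = "axis k a :: 'k coord"
        have u: "?u \<in> Basis" using a by (auto simp: Basis_vec_def)
        have "om1 a (f t k) = (\<Sum>j\<in>P. om1 (?u $ j) (f t j))"
        proof -
          have "(\<Sum>j\<in>P. om1 (?u $ j) (f t j)) = (\<Sum>j\<in>P. if j = k then om1 a (f t k) else 0)"
            unfolding axis_def by (rule sum.cong) (auto simp: zero_left)
          thus ?thesis using k by simp
        qed
        also have "\<dots> = \<omega> * \<mu> * pd ?u (R' \<circ> cover) (c t) + \<omega>\<^sup>2 * \<epsilon> * pd ?u (\<Phi> \<circ> cover) (c t)"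
          by (rule force) (use k in \<open>auto simp: axis_def\<close>)
        finally have 1: "om1 a (f t k) = \<omega> * \<mu> * pd ?u (R' \<circ> cover) (c t) + \<omega>\<^sup>2 * \<epsilon> * pd ?u (\<Phi> \<circ> cover) (c t)" .
        have "\<bar>pd ?u (R' \<circ> cover) (c t) - pd ?u (R \<circ> cover) ?y\<bar> \<le> d * \<mu>\<^sub>0 * norm ?u"
          unfolding d_def by (rule transfer)
        also have "\<dots> \<le> d" using u d \<mu>0(2) \<mu>0(1) by (simp add: mult_left_le)
        finally have "\<bar>pd ?u (R' \<circ> cover) (c t)\<bar> \<le> Gb + d" using rG(3)[OF s yg u] by linarith
        hence "\<bar>\<omega> * \<mu> * pd ?u (R' \<circ> cover) (c t)\<bar> \<le> \<mu> * (Gb + d)"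
          unfolding abs_mult[of "\<omega> * \<mu>"] using w1 \<mu> by (intro mult_mono) auto
        moreover have "\<bar>\<omega>\<^sup>2 * \<epsilon> * pd ?u (\<Phi> \<circ> cover) (c t)\<bar> \<le> \<mu> * D"
        proof -
          have "\<mu> * \<mu>\<^sub>0 \<le> \<mu> * 1" using \<mu> \<mu>0 by (intro mult_left_mono) auto
          hence "\<omega>\<^sup>2 * \<epsilon> \<le> \<mu>" using w2 by simp
          thus ?thesis unfolding abs_mult[of "\<omega>\<^sup>2 * \<epsilon>"] using w2 \<Phi>b[OF u] \<mu> by (intro mult_mono) auto
        qed
        ultimately show ?thesis unfolding 1 by (simp add: algebra_simps)
      qed
      hence "(\<Sum>a\<in>Basis. \<bar>om1 a (f t k)\<bar>) \<le> (\<Sum>a\<in>(Basis::coord1 set). (Gb + d + D) * \<mu>)" by (rule sum_mono)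
      also have "\<dots> = G * \<mu>" by (simp add: G_def)
      finally show ?thesis using norm_le_om1[of "f t k"] by linarith
    qed
    obtain s b and n :: "'k \<Rightarrow> int" where s: "s \<in> {0..T}" and
      sb: "\<And>k. k \<in> P \<Longrightarrow> norm (c 0 $ k - (c\<^sub>0 $ k + (\<nu> k * s + (b + 2 * pi * of_int (n k))) *\<^sub>R e\<^sub>\<phi>)) \<le> r"
      using near by blast
    define bn where "bn = (\<lambda>k. b + 2 * pi * real_of_int (n k))"
    have "cover (c T') = cover (c 0 + (\<chi> k. \<alpha> *\<^sub>R e\<^sub>\<phi>))" using \<delta>per unfolding c(1) rot_cover .
    then obtain m :: "'k \<Rightarrow> int" where m: "c T' = c 0 + (\<chi> k. \<alpha> *\<^sub>R e\<^sub>\<phi>) + (\<chi> k. (2 * pi * of_int (m k)) *\<^sub>R e\<^sub>\<phi>)"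
      unfolding cover_eq_iff by blast
    have xT: "c T' $ k = c 0 $ k + (\<alpha> + 2 * pi * of_int (m k)) *\<^sub>R e\<^sub>\<phi>" for k
      unfolding m vector_add_component vec_lambda_beta by (simp only: scaleR_add_left add.assoc)
    have der: "((\<lambda>t. c t $ k) has_vector_derivative \<omega> *\<^sub>R ham_field (H k) (c t $ k) + f t k) (at t)" if "k \<in> P" for k t
      using has_vector_derivative_vec_nth[OF w(2), of k t] that by (simp add: f_def field_def)
    have err: "\<bar>(\<Sum>k\<in>P. om1 (u $ k) (f t k)) - \<omega> * \<mu> * pd u (R \<circ> cover) (unshift c\<^sub>0 bn (c t))\<bar> \<le> \<rho> * \<mu> * norm u"
      if u: "\<And>k. k \<notin> P \<Longrightarrow> u $ k = 0" for t u
    proof -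
      have "\<bar>pd u (R' \<circ> cover) (c t) - pd u (R \<circ> cover) (unshift c\<^sub>0 bn (c t))\<bar> \<le> d * \<mu>\<^sub>0 * norm u"
        unfolding d_def bn_def by (rule transfer)
      hence "\<bar>\<omega> * \<mu> * (pd u (R' \<circ> cover) (c t) - pd u (R \<circ> cover) (unshift c\<^sub>0 bn (c t)))\<bar> \<le> \<mu> * (d * \<mu>\<^sub>0 * norm u)"
        unfolding abs_mult[of "\<omega> * \<mu>"] using w1 \<mu> by (intro mult_mono) auto
      moreover have "\<bar>\<omega>\<^sup>2 * \<epsilon> * pd u (\<Phi> \<circ> cover) (c t)\<bar> \<le> (\<mu> * \<mu>\<^sub>0) * (d * D * norm u)"
      proof -
        have "\<bar>pd u (\<Phi> \<circ> cover) (c t)\<bar> \<le> d * D * norm u" unfolding d_def by (rule pd_bound[OF \<Phi>d \<Phi>b])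
        thus ?thesis unfolding abs_mult[of "\<omega>\<^sup>2 * \<epsilon>"] using w2 \<mu> \<mu>0(1) by (intro mult_mono) auto
      qed
      ultimately have "\<bar>\<omega> * \<mu> * (pd u (R' \<circ> cover) (c t) - pd u (R \<circ> cover) (unshift c\<^sub>0 bn (c t)))
          + \<omega>\<^sup>2 * \<epsilon> * pd u (\<Phi> \<circ> cover) (c t)\<bar> \<le> \<mu> * (d * \<mu>\<^sub>0 * norm u) + (\<mu> * \<mu>\<^sub>0) * (d * D * norm u)"
        by linarith
      also have "\<dots> = (d * (1 + D) * \<mu>\<^sub>0) * (\<mu> * norm u)" by (simp add: algebra_simps)
      also have "\<dots> \<le> \<rho> * (\<mu> * norm u)" using \<mu>0(5) \<mu> by (intro mult_right_mono) auto
      finally have le: "\<bar>\<omega> * \<mu> * (pd u (R' \<circ> cover) (c t) - pd u (R \<circ> cover) (unshift c\<^sub>0 bn (c t)))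
          + \<omega>\<^sup>2 * \<epsilon> * pd u (\<Phi> \<circ> cover) (c t)\<bar> \<le> \<rho> * (\<mu> * norm u)" .
      have "(\<Sum>k\<in>P. om1 (u $ k) (f t k)) = \<omega> * \<mu> * pd u (R' \<circ> cover) (c t) + \<omega>\<^sup>2 * \<epsilon> * pd u (\<Phi> \<circ> cover) (c t)"
        by (rule force) (rule u)
      with le show ?thesis by (simp add: algebra_simps)
    qed
    show False
    proof (rule notE[OF no_curve[THEN spec[of _ c], THEN spec[of _ f], THEN spec[of _ s], THEN spec[of _ bn],
            THEN spec[of _ \<mu>], THEN spec[of _ T'], THEN spec[of _ \<alpha>], THEN spec[of _ m]]],
          unfold perturbed_curve_def, intro conjI ballI allI impI)
      show "norm (c 0 $ k - (c\<^sub>0 $ k + (\<nu> k * s + bn k) *\<^sub>R e\<^sub>\<phi>)) \<le> \<rho>" if "k \<in> P" for k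
        using sb[OF that] r(2) unfolding bn_def by linarith
      show "\<bar>(\<Sum>k\<in>P. om1 (u $ k) (f t k)) - \<omega> * \<mu> * pd u (R \<circ> cover) (unshift c\<^sub>0 bn (c t))\<bar> \<le> \<rho> * \<mu> * norm u"
        if "\<forall>k. k \<notin> P \<longrightarrow> u $ k = 0" for t u using err that by blast
      show "c T' $ k = c 0 $ k + (\<alpha> + 2 * pi * of_int (m k)) *\<^sub>R e\<^sub>\<phi>" for k by (rule xT)
    qed (use \<mu> \<mu>le \<mu>0(3) s per der fbound in auto)
  qed
qed

end

theorem theorem3p4:
  fixes n :: nat and m :: "nat \<Rightarrow> nat" and ix :: "'k::finite \<Rightarrow> nat \<times> nat"
    and a b :: "'k \<Rightarrow> ereal" and J :: "'k \<Rightarrow> real set" and P :: "'k set"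
    and H :: "'k \<Rightarrow> real \<times> real \<times> real \<Rightarrow> real" and \<tau> :: "'k \<Rightarrow> real \<Rightarrow> real"
    and \<Omega> :: "'k \<Rightarrow> real \<Rightarrow> real"
    and aseg bseg :: "'k \<Rightarrow> real"
    and H\<^sub>0 H\<^sub>1 :: "'k point \<Rightarrow> real"
  assumes n: "n \<ge> 1"
    and ix: "bij_betw ix UNIV (SIGMA i:{1..n}. {0..m i})"
    and N: "(\<Sum>i=1..n. 1 + m i) \<ge> 2"
    and P: "P = {k. snd (ix k) = 0}"
    and ab: "\<And>k. a k < b k"
    and J: "J = (\<lambda>k. einterval (a k) (b k))"
    and smooth_H: "\<And>k. smooth_on (J k \<times> UNIV \<times> UNIV) (H k)"
    and H\<^sub>0: "H\<^sub>0 = sum_ham H P" and H\<^sub>1: "H\<^sub>1 = sum_ham H (- P)"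
    and cond1: "\<And>k. all_periodic (J k) (H k) (\<tau> k)"
    and cond2: "\<And>k. nondegenerate (J k) (H k) (\<tau> k)"
    and \<Omega>: "\<Omega> = (\<lambda>k. freq (H k) (\<tau> k))"
    and seg: "\<And>k. aseg k \<le> bseg k" "\<And>k. {aseg k..bseg k} \<subseteq> J k"
  shows "\<exists>\<omega>\<^sub>0>0. \<forall>\<omega> \<omega>\<^sub>1 T (K :: 'k \<Rightarrow> int) I\<^sub>0 R\<^sub>0 \<sigma> \<gamma>.
    0 < \<omega> \<and> \<omega> \<le> \<omega>\<^sub>0 \<and> (\<forall>k. I\<^sub>0 k \<in> {aseg k..bseg k}) \<and>
    \<comment> \<open>relative resonance; \<open>1 - snd (ix k)\<close> is truncated subtraction\<close>
    T > 0 \<and> (\<exists>k. K k \<noteq> 0) \<and> \<omega>\<^sub>1 = \<omega> * \<Omega> (inv ix (1, 0)) (I\<^sub>0 (inv ix (1, 0))) \<and>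
    (\<forall>k. \<omega> ^ (1 - snd (ix k)) * \<Omega> k (I\<^sub>0 k) = \<omega>\<^sub>1 + of_int (K k) * (2 * pi / T)) \<and>
    (\<exists>l::int. \<omega>\<^sub>1 * T = 2 * pi * of_int l) \<and>
    smooth_fun J R\<^sub>0 \<and> projects_to J P R\<^sub>0 \<and>
    lham_solution J P (\<lambda>x. \<omega> * H\<^sub>0 x) H\<^sub>1 UNIV \<sigma> \<and> (\<forall>t. \<sigma> (t + T) = \<sigma> t) \<and>
    \<gamma> = phase_orbit \<sigma> \<and> \<gamma> \<subseteq> cyl_torus I\<^sub>0 \<and>
    (\<exists>x\<in>\<gamma>. \<not> critical_point_on (level_set J P H I\<^sub>0)
               (average J P (\<lambda>x. \<omega> * H\<^sub>0 x) H\<^sub>1 T R\<^sub>0) x)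
    \<longrightarrow>
    (\<forall>D>0. \<forall>U\<^sub>1. open_nbhd (subproduct J (- P)) (proj (- P) ` cyl_torus I\<^sub>0) U\<^sub>1 \<and>
        compact (top_of_set (subproduct J (- P)) closure_of U\<^sub>1) \<longrightarrow>
      (\<exists>\<mu>\<^sub>0>0. \<exists>U\<^sub>0. open_nbhd (subproduct J P) (proj P ` \<gamma>) U\<^sub>0 \<and>
        (\<forall>\<epsilon> \<mu> T' \<alpha>' R\<^sub>0' H\<^sub>0' H\<^sub>1' \<Phi>' H'.
          \<epsilon> > 0 \<and> \<omega> * \<epsilon> / \<mu>\<^sub>0 \<le> \<mu> \<and> \<mu> \<le> \<mu>\<^sub>0 \<and> \<bar>T' - T\<bar> + \<bar>\<alpha>'\<bar> \<le> D * \<mu> \<and>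
          Ck_fun 2 J R\<^sub>0' \<and> Ck_fun 2 J H\<^sub>1' \<and> Ck_fun 2 J \<Phi>' \<and>
          H\<^sub>0' = (\<lambda>x. H\<^sub>0 x + \<mu> * R\<^sub>0' x) \<and>
          H' = (\<lambda>x. \<omega> * H\<^sub>0' x + \<epsilon> * H\<^sub>1' x + \<omega>\<^sup>2 * \<epsilon> * \<Phi>' x) \<and>
          invariant J H' \<and> invariant J (\<lambda>x. H\<^sub>1' x + \<omega>\<^sup>2 * \<Phi>' x) \<and>
          projects_to J P R\<^sub>0' \<and> projects_to J (- P) H\<^sub>1' \<and>
          C2_norm_fun (product_set J P U\<^sub>0 U\<^sub>1) (\<lambda>x. R\<^sub>0' x - R\<^sub>0 x) \<le> ennreal \<mu>\<^sub>0 \<and>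
          C2_norm_fun (product_set J P U\<^sub>0 U\<^sub>1) \<Phi>' \<le> ennreal D
          \<longrightarrow>
          (\<nexists>\<delta>. rel_periodic_solution J P H' (\<lambda>x. H\<^sub>1' x + \<omega>\<^sup>2 * \<Phi>' x) T' \<alpha>' \<delta> \<and>
               range \<delta> \<subseteq> product_set J P U\<^sub>0 U\<^sub>1))))"
proof (rule exI[of _ 1], rule conjI, simp, intro allI impI)
  fix \<omega> \<omega>\<^sub>1 T :: real and K :: "'k \<Rightarrow> int" and I\<^sub>0 :: "'k \<Rightarrow> real" and R\<^sub>0 :: "'k point \<Rightarrow> real"
    and \<sigma> :: "real \<Rightarrow> 'k point" and \<gamma> U\<^sub>1 :: "'k point set" and D :: real
  assume A: "0 < \<omega> \<and> \<omega> \<le> 1 \<and> (\<forall>k. I\<^sub>0 k \<in> {aseg k..bseg k}) \<and>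
    T > 0 \<and> (\<exists>k. K k \<noteq> 0) \<and> \<omega>\<^sub>1 = \<omega> * \<Omega> (inv ix (1, 0)) (I\<^sub>0 (inv ix (1, 0))) \<and>
    (\<forall>k. \<omega> ^ (1 - snd (ix k)) * \<Omega> k (I\<^sub>0 k) = \<omega>\<^sub>1 + of_int (K k) * (2 * pi / T)) \<and>
    (\<exists>l::int. \<omega>\<^sub>1 * T = 2 * pi * of_int l) \<and>
    smooth_fun J R\<^sub>0 \<and> projects_to J P R\<^sub>0 \<and>
    lham_solution J P (\<lambda>x. \<omega> * H\<^sub>0 x) H\<^sub>1 UNIV \<sigma> \<and> (\<forall>t. \<sigma> (t + T) = \<sigma> t) \<and>
    \<gamma> = phase_orbit \<sigma> \<and> \<gamma> \<subseteq> cyl_torus I\<^sub>0 \<and>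
    (\<exists>x\<in>\<gamma>. \<not> critical_point_on (level_set J P H I\<^sub>0) (average J P (\<lambda>x. \<omega> * H\<^sub>0 x) H\<^sub>1 T R\<^sub>0) x)"
    and D: "0 < D"
  obtain l :: int where l: "\<omega>\<^sub>1 * T = 2 * pi * of_int l" using A by blast
  have T: "T > 0" using A by blast
  obtain x where x: "x \<in> phase_orbit \<sigma>"
    "\<not> critical_point_on (level_set J P H I\<^sub>0) (average J P (\<lambda>x. \<omega> * sum_ham H P x) (sum_ham H (- P)) T R\<^sub>0) x"
    using A unfolding H\<^sub>0 H\<^sub>1 by blast
  interpret model_system J P H \<tau> I\<^sub>0 \<omega> T "\<lambda>k. l + K k"
  proof
    show "open (J k)" for k by (simp add: J)
    show "I\<^sub>0 k \<in> J k" for k using A seg(2)[of k] by blast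
    show "\<omega> * freq (H k) (\<tau> k) (I\<^sub>0 k) * T = 2 * pi * of_int (l + K k)" if "k \<in> P" for k
    proof -
      have "\<omega> ^ (1 - snd (ix k)) * \<Omega> k (I\<^sub>0 k) = \<omega>\<^sub>1 + of_int (K k) * (2 * pi / T)" using A by blast
      hence "\<omega> * freq (H k) (\<tau> k) (I\<^sub>0 k) = \<omega>\<^sub>1 + of_int (K k) * (2 * pi / T)" using that by (simp add: P \<Omega>)
      hence "\<omega> * freq (H k) (\<tau> k) (I\<^sub>0 k) * T = \<omega>\<^sub>1 * T + of_int (K k) * (2 * pi)" using T by (simp add: field_simps)
      thus ?thesis unfolding l by (simp add: algebra_simps)
    qed
  qed (use A smooth_H cond1 cond2 in auto)
  have \<gamma>: "\<gamma> = phase_orbit \<sigma>" using A by blast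
  note prem = no_relative_periodic_solutions[OF _ _ _ _ _ x D, of U\<^sub>1]
  show "\<exists>\<mu>\<^sub>0>0. \<exists>U\<^sub>0. open_nbhd (subproduct J P) (proj P ` \<gamma>) U\<^sub>0 \<and>
        (\<forall>\<epsilon> \<mu> T' \<alpha>' R\<^sub>0' H\<^sub>0' H\<^sub>1' \<Phi>' H'.
          \<epsilon> > 0 \<and> \<omega> * \<epsilon> / \<mu>\<^sub>0 \<le> \<mu> \<and> \<mu> \<le> \<mu>\<^sub>0 \<and> \<bar>T' - T\<bar> + \<bar>\<alpha>'\<bar> \<le> D * \<mu> \<and>
          Ck_fun 2 J R\<^sub>0' \<and> Ck_fun 2 J H\<^sub>1' \<and> Ck_fun 2 J \<Phi>' \<and>
          H\<^sub>0' = (\<lambda>x. H\<^sub>0 x + \<mu> * R\<^sub>0' x) \<and>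
          H' = (\<lambda>x. \<omega> * H\<^sub>0' x + \<epsilon> * H\<^sub>1' x + \<omega>\<^sup>2 * \<epsilon> * \<Phi>' x) \<and>
          invariant J H' \<and> invariant J (\<lambda>x. H\<^sub>1' x + \<omega>\<^sup>2 * \<Phi>' x) \<and>
          projects_to J P R\<^sub>0' \<and> projects_to J (- P) H\<^sub>1' \<and>
          C2_norm_fun (product_set J P U\<^sub>0 U\<^sub>1) (\<lambda>x. R\<^sub>0' x - R\<^sub>0 x) \<le> ennreal \<mu>\<^sub>0 \<and>
          C2_norm_fun (product_set J P U\<^sub>0 U\<^sub>1) \<Phi>' \<le> ennreal D
          \<longrightarrow>
          (\<nexists>\<delta>. rel_periodic_solution J P H' (\<lambda>x. H\<^sub>1' x + \<omega>\<^sup>2 * \<Phi>' x) T' \<alpha>' \<delta> \<and>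
               range \<delta> \<subseteq> product_set J P U\<^sub>0 U\<^sub>1))"
  proof (rule prem)
    show "\<omega> \<le> 1" "smooth_fun J R\<^sub>0" "projects_to J P R\<^sub>0" using A by blast+
    show "lham_solution J P (\<lambda>x. \<omega> * sum_ham H P x) (sum_ham H (- P)) UNIV \<sigma>"
      using A unfolding H\<^sub>0 H\<^sub>1 by blast
    show "phase_orbit \<sigma> \<subseteq> cyl_torus I\<^sub>0" using A by blast
    fix \<mu>\<^sub>0 U\<^sub>0
    assume "\<mu>\<^sub>0 > 0" "open_nbhd (subproduct J P) (proj P ` phase_orbit \<sigma>) U\<^sub>0"
      and no: "\<And>\<epsilon> \<mu> T' \<alpha> R' H1' \<Phi> \<delta>. admissible R\<^sub>0 D U\<^sub>1 \<mu>\<^sub>0 U\<^sub>0 \<epsilon> \<mu> T' \<alpha> R' H1' \<Phi> \<Longrightarrow>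
      rel_periodic_solution J P (pert_ham \<mu> \<epsilon> R' H1' \<Phi>) (pert_ham\<^sub>1 H1' \<Phi>) T' \<alpha> \<delta> \<Longrightarrow>
      range \<delta> \<subseteq> product_set J P U\<^sub>0 U\<^sub>1 \<Longrightarrow> False"
    show ?thesis
    proof (rule exI[of _ \<mu>\<^sub>0], rule conjI, fact, rule exI[of _ U\<^sub>0], rule conjI)
      show "open_nbhd (subproduct J P) (proj P ` \<gamma>) U\<^sub>0" unfolding \<gamma> by fact
    qed (intro allI impI notI, elim exE conjE, hypsubst, rule no[unfolded admissible_def pert_ham_def pert_ham\<^sub>1_def], unfold H\<^sub>0, intro conjI)
  qed
qed

end
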